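(* Let $f$ be any one of the functions $\eta$, $\zeta$, $\xi$. (1) For every fixed real $t$ with $|t|\ge 8$, the function $\sigma\mapsto|f(\sigma+it)|$ is strictly decreasing on $(-\infty,0]$. (2) The statement "for every fixed real $t$ with $|t|\ge 8$, the function $\sigma\mapsto |f(\sigma+it)|$ is strictly decreasing on $(-\infty,\tfrac12]$" is equivalent to the Riemann hypothesis (all nontrivial zeros of $\zeta$ have real part $\tfrac12$).
   Context: $\zeta$ is the Riemann zeta function. The Riemann xi function is $\xi(s)=(s-1)\Gamma(1+s/2)\pi^{-s/2}\zeta(s)$. Euler's eta function is $\eta(s)=(1-2^{1-s})\zeta(s)$. Write $s=\sigma+it$. *)

theory Defs
  imports "HOL-Complex_Analysis.Complex_Analysis"
begin

(* The Riemann zeta function, as the analytic continuation of its Dirichlet series to the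
   complex plane without the point 1. By the identity theorem the continuation is unique on
   that set; the clause at the pole 1 only fixes a junk value, so that THE applies. *)
definition riemann_zeta :: "complex \<Rightarrow> complex" where
  "riemann_zeta = (THE f. f holomorphic_on (- {1}) \<and>
     (\<forall>s. Re s > 1 \<longrightarrow> (\<lambda>n. 1 / of_nat (Suc n) powr s) sums f s) \<and> f 1 = 0)"

(* The next two formulas are meant literally: at s = 1, and for xi also at the poles
   -2, -4, ... of the Gamma factor (where Gamma is 0 by the library's convention), the value
   is 0 rather than that of the analytic continuation. All these points are real. *)
definition euler_eta :: "complex \<Rightarrow> complex" where
  "euler_eta s = (1 - 2 powr (1 - s)) * riemann_zeta s"

definition riemann_xi :: "complex \<Rightarrow> complex" where
  "riemann_xi s = (s - 1) * Gamma (1 + s / 2) * of_real pi powr (- s / 2) * riemann_zeta s"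

(* s = 1 is excluded explicitly because riemann_zeta takes the junk value 0 there. *)
definition nontrivial_zeta_zeros :: "complex set" where
  "nontrivial_zeta_zeros =
     {s. s \<noteq> 1 \<and> riemann_zeta s = 0 \<and> (\<nexists>n::nat. n \<ge> 1 \<and> s = - 2 * of_nat n)}"

definition riemann_hypothesis :: bool where
  "riemann_hypothesis \<longleftrightarrow> (\<forall>s \<in> nontrivial_zeta_zeros. Re s = 1 / 2)"

end

(* With F(w) = 2 xi(1/2 + w), Riemann's theta integral exhibits F as an even entire function of
   growth exp(o(|w|^2)). On compact sets |F(w)| is then approximated by |F(0)| times the modulus of
   finite products of factors 1 - w^2/z^2 over zeros z, and each |w - z| |w + z| decreases strictly
   in Re w as long as w lies to the left of z and -z. Since the zeros satisfy |Re z| <= 1/2, and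
   Re z = 0 under the Riemann hypothesis, |xi| decreases on the stated half-lines. The quotient
   |zeta / xi| decreases for |t| >= 8 by a digamma estimate, and |1 - 2^(1-s)| decreases as well.
   Conversely, a zero to the left of the critical line contradicts strict monotonicity when its
   ordinate is at least 8 in modulus; lower zeros off the line are excluded numerically, because
   F(1/2) / F(0) is too close to 1 to accommodate their factors. *)
theory Submission
  imports Defs "HOL-Real_Asymp.Real_Asymp"
begin

text \<open>The bound 8 marks where the gamma factor wins. As the real part of s grows, ln |zeta /
  xi| falls at half the rate Re psi(1 + s/2), which is about ln (|t| / 2) or more, and rises by (ln
  pi) / 2 through the power of pi and by at most 1 / (2 |t|) through 1 / |s - 1|; |t| / 2 >= 4 > pi
  leaves just enough room. The hypothesis of the converse says nothing about smaller ordinates,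
  which is why low zeros need a separate argument. Hadamard's infinite product is avoided: for every
  disc and every d > 0 some finite product over zeros is correct up to a factor exp d. Comparing two
  points costs exp (2 * d), while the factor of one fixed zero gains a ratio below 1 that does not
  depend on d. Choosing d after that zero turns weak monotonicity into strict monotonicity. At least
  one zero is therefore required, and it comes from |Xi 0| < 1 = Xi (1/2). Evenness is what excludes
  a linear exponential factor, so that growth exp (o(r^2)) suffices.\<close>

section \<open>The functional equation of the theta function\<close>

text \<open>
  Polya's proof of the theta transformation: expanding the cosines as exponentials turns a sum of
  powers of cosines into a sum over every \<open>l\<close>-th binomial coefficient. With \<open>m\<close> of order \<open>l\<^sup>2\<close>
  both sides tend termwise to Gaussians, and Tannery's theorem applies.
\<close>

lemma sum_powers_root_of_unity:
  fixes d :: int and l :: nat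
  assumes "l > 0"
  shows "(\<Sum>k<l. cis (2 * pi * of_int d / of_nat l) ^ k) = (if int l dvd d then of_nat l else 0)"
proof (cases "int l dvd d")
  case True
  then obtain e where "d = int l * e" by (elim dvdE)
  then have "cis (2 * pi * of_int d / of_nat l) = 1"
    using assms cos_int_2pin[of e] sin_int_2pin[of e] by (auto simp: complex_eq_iff mult_ac)
  with True show ?thesis by simp
next
  case False
  let ?z = "cis (2 * pi * of_int d / of_nat l)"
  have "?z \<noteq> 1"
  proof
    assume "?z = 1"
    then have "cos (2 * pi * of_int d / of_nat l) = 1" by (simp add: complex_eq_iff)
    then obtain n :: int where "2 * pi * of_int d / of_nat l = of_int n * 2 * pi"
      by (auto simp: cos_one_2pi_int)
    then have "real_of_int d = of_int (n * int l)" using assms by (simp add: field_simps)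
    then have "d = n * int l" by linarith
    with False show False by simp
  qed
  moreover have "?z ^ l = 1"
    using assms cos_int_2pin[of d] sin_int_2pin[of d]
    by (simp add: Complex.DeMoivre complex_eq_iff mult_ac)
  ultimately show ?thesis using False by (simp add: geometric_sum)
qed

lemma cos_power_sum_raw:
  fixes l m :: nat
  assumes "l > 0"
  shows "(\<Sum>k<l. cos (pi * k / l) ^ (2 * m)) =
         l / 4 ^ m * (\<Sum>j\<le>2*m. if int l dvd (int j - int m) then real (2 * m choose j) else 0)"
proof -
  have 1: "complex_of_real (4 ^ m * cos (pi * k / l) ^ (2 * m)) =
      (\<Sum>j\<le>2*m. of_nat (2 * m choose j) * cis (2 * pi * of_int (int j - int m) / l) ^ k)" for k
  proof -
    let ?p = "pi * k / l"
    have "complex_of_real (4 ^ m * cos ?p ^ (2 * m)) = (cis ?p + cis (- ?p)) ^ (2 * m)"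
    proof -
      have "cis ?p + cis (- ?p) = complex_of_real (2 * cos ?p)" by (simp add: complex_eq_iff)
      moreover have "(2 * cos ?p) ^ (2 * m) = 4 ^ m * cos ?p ^ (2 * m)"
        by (simp add: power_mult power_mult_distrib)
      ultimately show ?thesis by (metis of_real_power)
    qed
    also have "\<dots> = (\<Sum>j\<le>2*m. of_nat (2 * m choose j) * cis ?p ^ j * cis (- ?p) ^ (2 * m - j))"
      by (rule binomial_ring)
    also have "\<dots> = (\<Sum>j\<le>2*m. of_nat (2 * m choose j) * cis (2 * pi * of_int (int j - int m) / l) ^ k)"
    proof (rule sum.cong[OF refl])
      fix j assume j: "j \<in> {..2*m}"
      have "real j * ?p + real (2 * m - j) * (- ?p) = real k * (2 * pi * of_int (int j - int m) / l)"
        using j assms by (auto simp: of_nat_diff field_simps)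
      then show "of_nat (2 * m choose j) * cis ?p ^ j * cis (- ?p) ^ (2 * m - j) =
          (of_nat (2 * m choose j) * cis (2 * pi * of_int (int j - int m) / l) ^ k :: complex)"
        by (simp add: Complex.DeMoivre cis_mult mult.assoc del: of_int_diff)
    qed
    finally show ?thesis .
  qed
  have "complex_of_real (4 ^ m * (\<Sum>k<l. cos (pi * k / l) ^ (2 * m))) =
     (\<Sum>k<l. \<Sum>j\<le>2*m. of_nat (2 * m choose j) * cis (2 * pi * of_int (int j - int m) / l) ^ k)"
    unfolding 1[symmetric] by (simp add: sum_distrib_left)
  also have "\<dots> = (\<Sum>j\<le>2*m. of_nat (2 * m choose j) * (\<Sum>k<l. cis (2 * pi * of_int (int j - int m) / l) ^ k))"
    by (subst sum.swap) (simp only: sum_distrib_left)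
  also have "\<dots> = of_real (l * (\<Sum>j\<le>2*m. if int l dvd (int j - int m) then real (2 * m choose j) else 0))"
    unfolding sum_powers_root_of_unity[OF assms] sum_distrib_left of_real_sum
    by (intro sum.cong refl) simp
  finally have "4 ^ m * (\<Sum>k<l. cos (pi * k / l) ^ (2 * m)) =
     l * (\<Sum>j\<le>2*m. if int l dvd (int j - int m) then real (2 * m choose j) else 0)"
    using of_real_eq_iff by blast
  then show ?thesis by (simp add: field_simps)
qed

lemma sum_symmetric_atMost:
  fixes h :: "nat \<Rightarrow> real"
  assumes "\<And>i. i \<le> m \<Longrightarrow> h (m - i) = h (m + i)"
  shows "(\<Sum>j\<le>2*m. h j) = h m + 2 * (\<Sum>i=1..m. h (m + i))"
proof -
  have "{..2*m} = {..<m} \<union> ({m} \<union> {m+1..m+m})" by auto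
  then have "(\<Sum>j\<le>2*m. h j) = (\<Sum>j<m. h j) + (h m + (\<Sum>j=m+1..m+m. h j))"
    by (simp only:) (subst sum.union_disjoint; auto simp: sum.union_disjoint)
  moreover have "(\<Sum>j=m+1..m+m. h j) = (\<Sum>i=1..m. h (m + i))"
    using sum.shift_bounds_cl_nat_ivl[of h 1 m m] by (simp add: add.commute)
  moreover have "(\<Sum>j<m. h j) = (\<Sum>i=1..m. h (m + i))"
  proof (rule sum.reindex_bij_witness[of _ "\<lambda>i. m - i" "\<lambda>i. m - i"])
    fix a assume "a \<in> {..<m}"
    then show "h (m + (m - a)) = h a" using assms[of "m - a"] by simp
  qed auto
  ultimately show ?thesis by simp
qed

lemma sum_multiples:
  fixes h :: "nat \<Rightarrow> real"
  assumes "l > 0" "\<And>i. i > m \<Longrightarrow> h i = 0"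
  shows "(\<Sum>i=1..m. if l dvd i then h i else 0) = (\<Sum>r<m. h (l * Suc r))"
proof -
  have "(\<Sum>i=1..m. if l dvd i then h i else 0) = (\<Sum>i \<in> {i\<in>{1..m}. l dvd i}. h i)"
    by (subst sum.inter_filter) auto
  also have "\<dots> = (\<Sum>r \<in> {r\<in>{..<m}. l * Suc r \<le> m}. h (l * Suc r))"
    by (rule sum.reindex_bij_witness[of _ "\<lambda>r. l * Suc r" "\<lambda>i. i div l - 1"])
       (use assms(1) in \<open>auto simp: Suc_le_eq simp del: mult_Suc_right elim!: dvdE, metis Suc_pred bot_nat_0.not_eq_extremum lessI less_le_trans mult_0_right mult_le_mono1 nat_mult_1 Suc_leI One_nat_def\<close>)
  also have "\<dots> = (\<Sum>r<m. h (l * Suc r))"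
    by (rule sum.mono_neutral_left) (auto simp: not_le simp del: mult_Suc_right intro!: assms(2))
  finally show ?thesis .
qed

text \<open>An odd \<open>l\<close> lets \<open>k\<close> and \<open>l - k\<close> pair off without
  a middle term. Factoring out the central coefficient leaves ratios that converge to Gaussians,
  while the factor in front tends to \<open>1 / sqrt x\<close> in the scaling used below.\<close>

lemma cos_power_sum:
  fixes q m :: nat
  defines "l \<equiv> 2 * q + 1"
  shows "1 + 2 * (\<Sum>k<q. cos (pi * Suc k / l) ^ (2 * m)) =
    l * real (2 * m choose m) / 4 ^ m *
      (1 + 2 * (\<Sum>r<m. real (2 * m choose (m + l * Suc r)) / real (2 * m choose m)))"
proof -
  have l: "l > 0" by (simp add: l_def)
  let ?h = "\<lambda>k. cos (pi * real k / l) ^ (2 * m)"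
  have "{..<l} = {0} \<union> ({1..q} \<union> {q+1..2*q})" by (auto simp: l_def)
  then have "(\<Sum>k<l. ?h k) = 1 + ((\<Sum>k=1..q. ?h k) + (\<Sum>k=q+1..2*q. ?h k))"
    by (simp only:) (subst sum.union_disjoint; auto simp: sum.union_disjoint)
  also have "(\<Sum>k=q+1..2*q. ?h k) = (\<Sum>k=1..q. ?h k)"
  proof (rule sum.reindex_bij_witness[of _ "\<lambda>k. l - k" "\<lambda>k. l - k"])
    fix k assume k: "k \<in> {q+1..2*q}"
    then have "pi * real (l - k) / l = pi - pi * real k / l"
      using l by (simp add: of_nat_diff l_def field_simps)
    then show "?h (l - k) = ?h k" by (simp add: power_mult)
  qed (auto simp: l_def)
  also have "(\<Sum>k=1..q. ?h k) = (\<Sum>k<q. ?h (Suc k))"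
    by (rule sum.reindex_bij_witness[of _ Suc "\<lambda>k. k - 1"]) auto
  finally have L: "(\<Sum>k<l. ?h k) = 1 + 2 * (\<Sum>k<q. ?h (Suc k))" by simp
  let ?c = "\<lambda>j. if int l dvd (int j - int m) then real (2 * m choose j) else 0"
  have "(\<Sum>j\<le>2*m. ?c j) = ?c m + 2 * (\<Sum>i=1..m. ?c (m + i))"
  proof (rule sum_symmetric_atMost)
    fix i assume i: "i \<le> m"
    have "2 * m choose (m - i) = 2 * m choose (m + i)"
      using binomial_symmetric[of "m + i" "2 * m"] i by simp
    then show "?c (m - i) = ?c (m + i)" using i by (auto simp: of_nat_diff)
  qed
  also have "(\<Sum>i=1..m. ?c (m + i)) = (\<Sum>i=1..m. if l dvd i then real (2 * m choose (m + i)) else 0)"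
    by (intro sum.cong refl) simp
  also have "\<dots> = (\<Sum>r<m. real (2 * m choose (m + l * Suc r)))"
    by (rule sum_multiples) (use l in auto)
  finally have R: "(\<Sum>j\<le>2*m. ?c j) = real (2 * m choose m) + 2 * (\<Sum>r<m. real (2 * m choose (m + l * Suc r)))"
    by simp
  have c: "real (2 * m choose m) > 0" by simp
  have "1 + 2 * (\<Sum>k<q. ?h (Suc k)) =
    l / 4 ^ m * (real (2 * m choose m) + 2 * (\<Sum>r<m. real (2 * m choose (m + l * Suc r))))"
    using cos_power_sum_raw[OF l, of m] unfolding L R .
  also have "real (2 * m choose m) + 2 * (\<Sum>r<m. real (2 * m choose (m + l * Suc r))) =
     real (2 * m choose m) * (1 + 2 * (\<Sum>r<m. real (2 * m choose (m + l * Suc r)) / real (2 * m choose m)))"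
    using c unfolding sum_divide_distrib[symmetric] distrib_left by simp
  finally show ?thesis by simp
qed

section \<open>Asymptotics of binomial coefficients\<close>

lemma wallis_prod_eq:
  "(\<Prod>k=1..n. (4*real k^2) / (4*real k^2 - 1)) = 1 / ((real (2*n choose n) / 4 ^ n)\<^sup>2 * (2 * real n + 1))"
proof (induction n)
  case (Suc n)
  have "real (Suc n) * real (2 * Suc n choose Suc n) = 2 * (2 * real n + 1) * real (2 * n choose n)"
  proof -
    have 1: "real (2*n choose n) = fact (2*n) / (fact n * fact n)"
      using binomial_fact[of n "2*n", where 'a = real] by simp
    have 2: "real (2 * Suc n choose Suc n) = fact (2 * n + 2) / (fact (Suc n) * fact (Suc n))"
      using binomial_fact[of "Suc n" "2*Suc n", where 'a = real] by simp
    show ?thesis unfolding 1 2 by (simp add: divide_simps) (simp add: algebra_simps)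
  qed
  then have c: "real (2 * Suc n choose Suc n) = 2 * (2 * real n + 1) * real (2 * n choose n) / (real n + 1)"
    by (simp add: field_simps)
  define B where "B = real (2 * n choose n)"
  define P where "P = (\<Prod>k=1..n. (4*real k^2) / (4*real k^2 - 1))"
  have B: "B > 0" by (simp add: B_def)
  have IH: "P = 1 / ((B / 4 ^ n)\<^sup>2 * (2 * real n + 1))" using Suc.IH unfolding P_def B_def .
  have d: "4*real (Suc n)^2 - 1 = (2 * real n + 1) * (2 * real n + 3)"
    by (simp add: power2_eq_square algebra_simps)
  have "(\<Prod>k=1..Suc n. (4*real k^2) / (4*real k^2 - 1)) = P * (4*real (Suc n)^2 / (4*real (Suc n)^2 - 1))"
    by (simp add: P_def)
  also have "\<dots> = 1 / ((2 * (2 * real n + 1) * B / (real n + 1) / 4 ^ Suc n)\<^sup>2 * (2 * real (Suc n) + 1))"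
    using B unfolding IH d by (simp add: divide_simps) (simp add: power2_eq_square algebra_simps)
  finally show ?case unfolding c B_def .
qed simp

text \<open>Wallis' product, read off from its partial products. It fixes the constant in the theta
  transformation.\<close>

lemma central_binomial_limit:
  "(\<lambda>n. (real (2*n choose n) / 4 ^ n)\<^sup>2 * (2 * real n + 1)) \<longlonglongrightarrow> 2 / pi"
  using tendsto_inverse[OF wallis] unfolding wallis_prod_eq by (simp add: inverse_eq_divide)

lemma binomial_ratio_step:
  assumes "j < m"
  shows "real (2*m choose (m + Suc j)) = real (2*m choose (m + j)) * (real (m - j) / real (m + j + 1))"
proof -
  have "Suc (m + j) * (2*m choose Suc (m + j)) = (2*m - (m + j)) * (2*m choose (m + j))"
    using binomial_absorb_comp[of "2*m" "m+j"] binomial_absorption[of "m+j" "2*m"]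
    by simp
  also have "2*m - (m + j) = m - j" by simp
  finally have "real (Suc (m + j)) * real (2*m choose Suc (m + j)) = real (m - j) * real (2*m choose (m + j))"
    by (metis of_nat_mult)
  then show ?thesis by (simp add: field_simps)
qed

text \<open>Consecutive ratios are (m - i) / (m + i + 1), which lies between exp (-(2i + 1) / (m -
  i)) and exp (-(2i + 1) / (m + i + 1)). Replacing \<open>i\<close> by the common bound
  \<open>J\<close> in the denominators lets the exponents add up, since the odd numbers 2i + 1 with
  i < j sum to j^2.\<close>

lemma binomial_ratio_bounds:
  assumes "j \<le> J"
  shows "J \<le> m \<Longrightarrow> real (2*m choose (m + j)) \<le> real (2*m choose m) * exp (- (real j)\<^sup>2 / real (m + J))"
    and "J < m \<Longrightarrow> real (2*m choose (m + j)) \<ge> real (2*m choose m) * exp (- (real j)\<^sup>2 / real (m - J))"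
proof -
  have e: "exp (- (real (Suc i))\<^sup>2 / d) = exp (- (real i)\<^sup>2 / d) * exp (- (2 * real i + 1) / d)" for i d
    by (simp add: exp_add[symmetric] power2_eq_square algebra_simps add_divide_distrib diff_divide_distrib)
  show "real (2*m choose (m + j)) \<le> real (2*m choose m) * exp (- (real j)\<^sup>2 / real (m + J))" if "J \<le> m"
    using assms
  proof (induction j)
    case (Suc j)
    have "real (m - j) / real (m + j + 1) = 1 + (- (2 * real j + 1) / real (m + j + 1))"
      using Suc.prems that by (simp add: field_simps of_nat_diff)
    also have "\<dots> \<le> exp (- (2 * real j + 1) / real (m + j + 1))" by (rule exp_ge_add_one_self)
    also have "\<dots> \<le> exp (- (2 * real j + 1) / real (m + J))"
    proof -
      have "(2 * real j + 1) / real (m + J) \<le> (2 * real j + 1) / real (m + j + 1)"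
        using Suc.prems by (intro divide_left_mono) auto
      then show ?thesis by (simp only: minus_divide_left[symmetric] neg_le_iff_le exp_le_cancel_iff)
    qed
    finally have "real (m - j) / real (m + j + 1) \<le> exp (- (2 * real j + 1) / real (m + J))" .
    then have "real (2*m choose (m + j)) * (real (m - j) / real (m + j + 1)) \<le>
      (real (2*m choose m) * exp (- (real j)\<^sup>2 / real (m + J))) * exp (- (2 * real j + 1) / real (m + J))"
      using Suc by (intro mult_mono) auto
    then show ?case using binomial_ratio_step[of j m] Suc.prems that unfolding e by (simp add: mult.assoc)
  qed simp
  show "real (2*m choose (m + j)) \<ge> real (2*m choose m) * exp (- (real j)\<^sup>2 / real (m - J))" if "J < m"
    using assms
  proof (induction j)
    case (Suc j)
    have jm: "real (m - j) > 0" using Suc.prems that by simp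
    have "exp (- (2 * real j + 1) / real (m - J)) \<le> exp (- (2 * real j + 1) / real (m - j))"
    proof -
      have "(2 * real j + 1) / real (m - j) \<le> (2 * real j + 1) / real (m - J)"
        using Suc.prems that by (intro divide_left_mono) auto
      then show ?thesis by (simp only: minus_divide_left[symmetric] neg_le_iff_le exp_le_cancel_iff)
    qed
    also have "\<dots> = 1 / exp ((2 * real j + 1) / real (m - j))"
      by (simp only: minus_divide_left[symmetric] exp_minus inverse_eq_divide)
    also have "\<dots> \<le> 1 / (1 + (2 * real j + 1) / real (m - j))"
      by (intro divide_left_mono exp_ge_add_one_self) (use jm in \<open>auto intro!: mult_pos_pos add_pos_nonneg\<close>)
    also have "\<dots> = real (m - j) / real (m + j + 1)"
      using jm by (simp add: field_simps of_nat_diff)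
    finally have "exp (- (2 * real j + 1) / real (m - J)) \<le> real (m - j) / real (m + j + 1)" .
    then have "(real (2*m choose m) * exp (- (real j)\<^sup>2 / real (m - J))) * exp (- (2 * real j + 1) / real (m - J)) \<le>
       real (2*m choose (m + j)) * (real (m - j) / real (m + j + 1))"
      using Suc by (intro mult_mono) auto
    then show ?case using binomial_ratio_step[of j m] Suc.prems that unfolding e by (simp add: mult.assoc)
  qed simp
qed

text \<open>The product of exp (u^2 / 2) and cos u decreases on [0, pi], because u cos u <= sin u
  there. This yields the dominating terms for Tannery's theorem on the cosine side.\<close>

lemma cos_le_exp_neg_sq:
  fixes x :: real
  assumes "0 \<le> x" "x \<le> pi"
  shows "cos x \<le> exp (- x\<^sup>2 / 2)"
proof -
  have A: "u * cos u - sin u \<le> 0" if "0 \<le> u" "u \<le> pi" for u :: real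
  proof -
    have "(\<lambda>u. u * cos u - sin u) u \<le> (\<lambda>u. u * cos u - sin u) 0"
      by (rule DERIV_nonpos_imp_nonincreasing[OF that(1)])
         (use that in \<open>auto intro!: derivative_eq_intros exI simp: sin_ge_zero\<close>)
    then show ?thesis by simp
  qed
  have "(\<lambda>u. exp (u\<^sup>2 / 2) * cos u) x \<le> (\<lambda>u. exp (u\<^sup>2 / 2) * cos u) 0"
  proof (rule DERIV_nonpos_imp_nonincreasing[OF assms(1)])
    fix u assume u: "0 \<le> u" "u \<le> x"
    have "((\<lambda>u. exp (u\<^sup>2 / 2) * cos u) has_real_derivative exp (u\<^sup>2 / 2) * (u * cos u - sin u)) (at u)"
      by (auto intro!: derivative_eq_intros simp: algebra_simps)
    moreover have "exp (u\<^sup>2 / 2) * (u * cos u - sin u) \<le> 0"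
      using A[of u] u assms by (intro mult_nonneg_nonpos) auto
    ultimately show "\<exists>y. ((\<lambda>u. exp (u\<^sup>2 / 2) * cos u) has_real_derivative y) (at u) \<and> y \<le> 0" by blast
  qed
  then have "exp (x\<^sup>2 / 2) * cos x \<le> 1" by simp
  then show ?thesis by (simp add: exp_minus field_simps)
qed

text \<open>\<open>1 + 2 * omega x\<close> is Jacobi's theta function, the sum of exp (- pi n^2 x)
  over all integers n.\<close>

definition omega :: "real \<Rightarrow> real" where
  "omega x = (\<Sum>n. exp (- (pi * (real (Suc n))\<^sup>2 * x)))"

lemma summable_exp_neg_Suc:
  assumes "(c::real) > 0" shows "summable (\<lambda>k. exp (- (c * real (Suc k))))"
proof -
  have "summable (\<lambda>k. exp (-c) * exp (-c) ^ k)"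
    by (intro summable_mult summable_geometric) (use assms in auto)
  then show ?thesis by (simp add: exp_of_nat_mult[symmetric] exp_add[symmetric] algebra_simps)
qed

theorem theta_functional_equation:
  assumes x: "x > 0"
  shows "1 + 2 * omega x = (1 + 2 * omega (1 / x)) / sqrt x"
proof -
  \<comment> \<open>With m close to y l^2, the power cos (pi k / l) ^ (2 m) tends to exp (- pi^2 k^2
    y) and the binomial ratio at distance l r tends to exp (- r^2 / y). The choice y = x / pi turns
    these into the terms of \<open>omega x\<close> and \<open>omega (1 / x)\<close>.\<close>
  define y where "y = x / pi"
  have y: "y > 0" using x by (simp add: y_def)
  define l :: "nat \<Rightarrow> nat" where "l = (\<lambda>q. 2 * q + 1)"
  define m :: "nat \<Rightarrow> nat" where "m = (\<lambda>q. nat \<lfloor>y * (real (l q))\<^sup>2\<rfloor>)"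
  have l0: "real (l q) > 0" for q by (simp add: l_def)
  have ml_le: "real (m q) \<le> y * (real (l q))\<^sup>2" for q
    using y by (simp add: m_def)
  have ml_ge: "real (m q) \<ge> y * (real (l q))\<^sup>2 - 1" for q
    unfolding m_def by linarith
  have l_inv: "(\<lambda>q. c / real (l q)) \<longlonglongrightarrow> 0" for c unfolding l_def by real_asymp
  have ratio: "(\<lambda>q. real (m q) / (real (l q))\<^sup>2) \<longlonglongrightarrow> y"
  proof (rule tendsto_sandwich)
    show "(\<lambda>q. y - 1 / (real (l q))\<^sup>2) \<longlonglongrightarrow> y" unfolding l_def by real_asymp
    show "\<forall>\<^sub>F q in sequentially. y - 1 / (real (l q))\<^sup>2 \<le> real (m q) / (real (l q))\<^sup>2"
    proof (intro always_eventually allI)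
      fix q
      have "y - 1 / (real (l q))\<^sup>2 = (y * (real (l q))\<^sup>2 - 1) / (real (l q))\<^sup>2"
        using l0[of q] by (simp add: diff_divide_distrib)
      also have "\<dots> \<le> real (m q) / (real (l q))\<^sup>2" by (intro divide_right_mono ml_ge) simp
      finally show "y - 1 / (real (l q))\<^sup>2 \<le> real (m q) / (real (l q))\<^sup>2" .
    qed
    show "\<forall>\<^sub>F q in sequentially. real (m q) / (real (l q))\<^sup>2 \<le> y"
      using ml_le l0 by (intro always_eventually allI) (simp add: field_simps)
  qed auto
  have m_top: "filterlim m at_top sequentially"
  proof -
    have "filterlim (\<lambda>q. y * (real (l q))\<^sup>2 - 1) at_top sequentially"
      using y unfolding l_def by real_asymp
    then have "filterlim (\<lambda>q. real (m q)) at_top sequentially"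
      by (rule filterlim_at_top_mono) (use ml_ge in auto)
    then show ?thesis by (simp add: filterlim_sequentially_iff_filterlim_real)
  qed
  have ev_half: "\<forall>\<^sub>F q in sequentially. real (m q) / (real (l q))\<^sup>2 > y / 2"
    using order_tendstoD(1)[OF ratio, of "y/2"] y by simp

  \<comment> \<open>Terms from \<open>q\<close> on are set to 0, so that the finite sums become
    series in the form of Tannery's theorem; \<open>b\<close> below is extended in the same
    way.\<close>
  define a where "a = (\<lambda>k q. if k < q then cos (pi * Suc k / l q) ^ (2 * m q) else 0)"
  have a_lim: "(\<lambda>q. a k q) \<longlonglongrightarrow> exp (- (pi * (real (Suc k))\<^sup>2 * x))" for k
  proof -
    define c where "c = pi * Suc k"
    have c0: "c > 0" by (simp add: c_def)
    have "(\<lambda>q. 2 * (real (m q) / (real (l q))\<^sup>2) * ((real (l q))\<^sup>2 * ln (cos (c / l q)))) \<longlonglongrightarrow> 2 * y * (- c\<^sup>2 / 2)"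
    proof (intro tendsto_intros ratio)
      show "(\<lambda>q. (real (l q))\<^sup>2 * ln (cos (c / l q))) \<longlonglongrightarrow> - c\<^sup>2 / 2"
        using c0 unfolding l_def by (real_asymp simp: field_simps power2_eq_square)
    qed
    then have "(\<lambda>q. exp (2 * (real (m q) / (real (l q))\<^sup>2) * ((real (l q))\<^sup>2 * ln (cos (c / l q))))) \<longlonglongrightarrow> exp (2 * y * (- c\<^sup>2 / 2))"
      by (rule tendsto_exp)
    also have "2 * y * (- c\<^sup>2 / 2) = - (pi * (real (Suc k))\<^sup>2 * x)"
      by (simp add: y_def c_def power2_eq_square field_simps)
    finally show ?thesis
    proof (rule Lim_transform_eventually)
      have "\<forall>\<^sub>F q in sequentially. c / l q < pi / 2"
        using order_tendstoD(2)[OF l_inv, of "pi/2" c] by simp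
      moreover have "\<forall>\<^sub>F q in sequentially. k < q" by (rule eventually_gt_at_top)
      ultimately show "\<forall>\<^sub>F q in sequentially. exp (2 * (real (m q) / (real (l q))\<^sup>2) * ((real (l q))\<^sup>2 * ln (cos (c / l q)))) = a k q"
      proof eventually_elim
        case (elim q)
        have "cos (c / l q) > 0" using elim c0 l0[of q] by (intro cos_gt_zero_pi) (auto intro: order.strict_trans2[of _ 0])
        then have "cos (c / l q) ^ (2 * m q) = exp (real (2 * m q) * ln (cos (c / l q)))"
          by (simp only: exp_of_nat_mult exp_ln)
        then show ?case using elim l0[of q] by (simp add: a_def c_def)
      qed
    qed
  qed
  have a_bound: "norm (a k q) \<le> exp (- ((pi\<^sup>2 * y / 2) * real (Suc k)))"
    if q: "real (m q) / (real (l q))\<^sup>2 > y / 2" for k q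
  proof (cases "k < q")
    case True
    define u where "u = pi * Suc k / l q"
    have "pi * real (2 * Suc k) \<le> pi * real (l q)"
      using True by (intro mult_left_mono) (auto simp: l_def)
    then have u: "0 \<le> u" "u \<le> pi / 2" using l0[of q] by (auto simp: u_def field_simps)
    have "norm (a k q) = cos u ^ (2 * m q)" using True by (simp add: a_def u_def power_mult)
    also have "\<dots> \<le> exp (- u\<^sup>2 / 2) ^ (2 * m q)"
      by (intro power_mono cos_le_exp_neg_sq cos_ge_zero) (use u pi_gt_zero in linarith)+
    also have "\<dots> = exp (- (pi\<^sup>2 * (real (m q) / (real (l q))\<^sup>2) * (real (Suc k))\<^sup>2))"
      by (simp add: exp_of_nat_mult[symmetric] u_def power_divide power_mult_distrib field_simps
          del: of_nat_Suc)
    also have "\<dots> \<le> exp (- (pi\<^sup>2 * (y / 2) * real (Suc k)))"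
      by (simp only: exp_le_cancel_iff neg_le_iff_le, intro mult_mono)
         (use q y in \<open>auto simp: power2_eq_square\<close>)
    finally show ?thesis by simp
  qed (simp add: a_def)
  have T1: "(\<lambda>q. suminf (\<lambda>k. a k q)) \<longlonglongrightarrow> omega x"
  proof -
    have "\<forall>\<^sub>F kq in at_top \<times>\<^sub>F sequentially. (True \<and> real (m (snd kq)) / (real (l (snd kq)))\<^sup>2 > y / 2)"
      by (rule eventually_prodI[OF eventually_True ev_half])
    then have "\<forall>\<^sub>F (k, q) in at_top \<times>\<^sub>F sequentially. norm (a k q) \<le> exp (- ((pi\<^sup>2 * y / 2) * real (Suc k)))"
      by eventually_elim (use a_bound in auto)
    from tannerys_theorem[OF a_lim this summable_exp_neg_Suc] y show ?thesis
      by (simp add: omega_def)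
  qed
  have S1: "suminf (\<lambda>k. a k q) = (\<Sum>k<q. cos (pi * Suc k / l q) ^ (2 * m q))" for q
    by (subst suminf_finite[of "{..<q}"]) (auto simp: a_def)

  define b where "b = (\<lambda>r q. if r < m q then real (2 * m q choose (m q + l q * Suc r)) / real (2 * m q choose m q) else 0)"
  have b_lim: "(\<lambda>q. b r q) \<longlonglongrightarrow> exp (- (pi * (real (Suc r))\<^sup>2 * (1 / x)))" for r
  proof -
    have ev: "\<forall>\<^sub>F q in sequentially. l q * Suc r < m q"
    proof -
      have "\<forall>\<^sub>F q in sequentially. real (Suc r) / l q < y / 2"
        using order_tendstoD(2)[OF l_inv, of "y/2" "Suc r"] y by simp
      with ev_half show ?thesis
      proof eventually_elim
        case (elim q)
        then have "real (Suc r) / l q < real (m q) / (real (l q))\<^sup>2" by linarith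
        then have "real (Suc r) / l q * (real (l q))\<^sup>2 < real (m q) / (real (l q))\<^sup>2 * (real (l q))\<^sup>2"
          by (intro mult_strict_right_mono) (use l0[of q] in auto)
          moreover have "real (Suc r) / l q * (real (l q))\<^sup>2 = real (l q * Suc r)"
          using l0[of q] by (simp only: of_nat_mult) (simp add: power2_eq_square)
        ultimately have "real (l q * Suc r) < real (m q)" using l0[of q] by simp
        then show ?case by linarith
      qed
    qed
    \<comment> \<open>\<open>c = -1\<close> and \<open>c = 1\<close> belong to the denominators m -
      l (r + 1) and m + l (r + 1) of the lower and upper binomial bounds, divided by l^2. The shift
      vanishes in the limit, so both sides of the sandwich agree.\<close>
    have lim: "(\<lambda>q. exp (- (real (Suc r))\<^sup>2 / (real (m q) / (real (l q))\<^sup>2 + c * (real (Suc r) / l q)))) \<longlonglongrightarrow>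
       exp (- (pi * (real (Suc r))\<^sup>2 * (1 / x)))" for c
    proof -
      have "(\<lambda>q. exp (- (real (Suc r))\<^sup>2 / (real (m q) / (real (l q))\<^sup>2 + c * (real (Suc r) / l q)))) \<longlonglongrightarrow>
       exp (- (real (Suc r))\<^sup>2 / (y + c * 0))"
        by (intro tendsto_intros ratio l_inv) (use y in auto)
      then show ?thesis using x by (simp add: y_def mult_ac)
    qed
    have scale: "- (real (l q * Suc r))\<^sup>2 / (real (m q) + c * real (l q * Suc r)) =
      - (real (Suc r))\<^sup>2 / (real (m q) / (real (l q))\<^sup>2 + c * (real (Suc r) / l q))" for c q
    proof -
      have "real (m q) + c * real (l q * Suc r) = (real (l q))\<^sup>2 * (real (m q) / (real (l q))\<^sup>2 + c * (real (Suc r) / l q))"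
        using l0[of q] by (simp add: field_simps power2_eq_square)
      moreover have "(real (l q * Suc r))\<^sup>2 = (real (l q))\<^sup>2 * (real (Suc r))\<^sup>2"
        by (simp only: of_nat_mult power_mult_distrib)
      ultimately show ?thesis using l0[of q] by simp
    qed
    show ?thesis
    proof (rule tendsto_sandwich[OF _ _ lim[of "-1"] lim[of 1]])
      show "\<forall>\<^sub>F q in sequentially. exp (- (real (Suc r))\<^sup>2 / (real (m q) / (real (l q))\<^sup>2 + -1 * (real (Suc r) / l q))) \<le> b r q"
        using ev
      proof eventually_elim
        case (elim q)
        have "r < m q" using elim l0[of q] by (simp add: l_def)
        then show ?case using binomial_ratio_bounds(2)[OF order_refl elim] elim unfolding scale[symmetric]
          by (simp add: b_def field_simps of_nat_diff del: mult_Suc_right of_nat_Suc)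
      qed
      show "\<forall>\<^sub>F q in sequentially. b r q \<le> exp (- (real (Suc r))\<^sup>2 / (real (m q) / (real (l q))\<^sup>2 + 1 * (real (Suc r) / l q)))"
        using ev
      proof eventually_elim
        case (elim q)
        have "r < m q" using elim l0[of q] by (simp add: l_def)
        then show ?case using binomial_ratio_bounds(1)[OF order_refl less_imp_le[OF elim]] elim unfolding scale[symmetric]
          by (simp add: b_def field_simps del: mult_Suc_right of_nat_Suc)
      qed
    qed
  qed
  have b_bound: "norm (b r q) \<le> exp (- (1 / (2 * y) * real (Suc r)))" for r q
  \<comment> \<open>Beyond \<open>m q\<close> the binomial coefficient is 0; up to
    \<open>m q\<close> the denominator m + l (r + 1) is at most 2 m, hence at most 2 y l^2.\<close>
  proof (cases "l q * Suc r \<le> m q")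
    case True
    have m0: "real (m q) > 0" using True l0[of q] by (cases "m q") auto
    have "r < m q" using True l0[of q] by (simp add: l_def)
    then have "norm (b r q) \<le> exp (- (real (l q * Suc r))\<^sup>2 / real (m q + l q * Suc r))"
      using binomial_ratio_bounds(1)[OF order_refl True]
      by (simp add: b_def field_simps del: mult_Suc_right of_nat_Suc)
    also have "\<dots> \<le> exp (- (1 / (2 * y) * real (Suc r)))"
    proof -
      have "1 / (2 * y) * real (Suc r) \<le> 1 / (2 * y) * (real (Suc r))\<^sup>2"
        using y by (intro mult_left_mono) (auto simp: power2_eq_square)
      also have "\<dots> = (real (l q * Suc r))\<^sup>2 / (2 * (y * (real (l q))\<^sup>2))"
        using y l0[of q] unfolding of_nat_mult power_mult_distrib by (simp del: of_nat_Suc)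
      also have "\<dots> \<le> (real (l q * Suc r))\<^sup>2 / (2 * real (m q))"
        by (intro divide_left_mono mult_left_mono ml_le) (use m0 y l0[of q] in auto)
      also have "\<dots> \<le> (real (l q * Suc r))\<^sup>2 / real (m q + l q * Suc r)"
      proof (rule divide_left_mono)
        have "real (l q * Suc r) \<le> real (m q)" using True by (simp only: of_nat_le_iff)
        then show "real (m q + l q * Suc r) \<le> 2 * real (m q)" by (simp only: of_nat_add)
      qed (use m0 in \<open>auto intro!: mult_pos_pos add_pos_nonneg\<close>)
      finally show ?thesis by simp
    qed
    finally show ?thesis .
  qed (auto simp: b_def not_le binomial_eq_0 simp del: mult_Suc_right)
  have T2: "(\<lambda>q. suminf (\<lambda>k. b k q)) \<longlonglongrightarrow> omega (1 / x)"
  proof -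
    have "\<forall>\<^sub>F (k, q) in at_top \<times>\<^sub>F sequentially. norm (b k q) \<le> exp (- (1 / (2 * y) * real (Suc k)))"
      using b_bound by (intro always_eventually) auto
    from tannerys_theorem[OF b_lim this summable_exp_neg_Suc] y show ?thesis
      by (simp add: omega_def)
  qed
  have S2: "suminf (\<lambda>k. b k q) = (\<Sum>r<m q. real (2 * m q choose (m q + l q * Suc r)) / real (2 * m q choose m q))" for q
    by (subst suminf_finite[of "{..<m q}"]) (auto simp: b_def)

  define C where "C = (\<lambda>n. real (2*n choose n) / 4 ^ n)"
  have eq: "1 + 2 * suminf (\<lambda>k. a k q) = real (l q) * C (m q) * (1 + 2 * suminf (\<lambda>k. b k q))" for q
    using cos_power_sum[of q "m q"] unfolding S1 S2 C_def l_def by simp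
  \<comment> \<open>The Wallis limit concerns the square of \<open>C\<close>, so the constant is
    found squared: 2 m + 1 is asymptotic to 2 y l^2.\<close>
  have "(\<lambda>q. (real (l q) * C (m q))\<^sup>2) \<longlonglongrightarrow> (2 / pi) / (2 * y + 0)"
  proof (rule Lim_transform_eventually)
    have "(\<lambda>q. (C (m q))\<^sup>2 * (2 * real (m q) + 1)) \<longlonglongrightarrow> 2 / pi"
      using filterlim_compose[OF central_binomial_limit m_top] unfolding C_def .
    moreover have "(\<lambda>q. 1 / (real (l q))\<^sup>2) \<longlonglongrightarrow> 0" unfolding l_def by real_asymp
    ultimately show "(\<lambda>q. (C (m q))\<^sup>2 * (2 * real (m q) + 1) / (2 * (real (m q) / (real (l q))\<^sup>2) + 1 / (real (l q))\<^sup>2)) \<longlonglongrightarrow> (2 / pi) / (2 * y + 0)"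
      by (intro tendsto_intros ratio) (use y in auto)
    show "\<forall>\<^sub>F q in sequentially. (C (m q))\<^sup>2 * (2 * real (m q) + 1) / (2 * (real (m q) / (real (l q))\<^sup>2) + 1 / (real (l q))\<^sup>2) = (real (l q) * C (m q))\<^sup>2"
    proof (intro always_eventually allI)
      fix q
      have "2 * (real (m q) / (real (l q))\<^sup>2) + 1 / (real (l q))\<^sup>2 = (2 * real (m q) + 1) / (real (l q))\<^sup>2"
        by (simp add: add_divide_distrib)
      then show "(C (m q))\<^sup>2 * (2 * real (m q) + 1) / (2 * (real (m q) / (real (l q))\<^sup>2) + 1 / (real (l q))\<^sup>2) = (real (l q) * C (m q))\<^sup>2"
        using l0[of q] by (simp add: power_mult_distrib mult_ac)
    qed
  qed
  also have "(2 / pi) / (2 * y + 0) = 1 / x" by (simp add: y_def)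
  finally have "(\<lambda>q. sqrt ((real (l q) * C (m q))\<^sup>2)) \<longlonglongrightarrow> sqrt (1 / x)" by (rule tendsto_real_sqrt)
  then have K: "(\<lambda>q. real (l q) * C (m q)) \<longlonglongrightarrow> 1 / sqrt x" by (simp add: C_def real_sqrt_divide)
  have "(\<lambda>q. 1 + 2 * suminf (\<lambda>k. a k q)) \<longlonglongrightarrow> 1 / sqrt x * (1 + 2 * omega (1 / x))"
    unfolding eq by (intro tendsto_intros K T2)
  moreover have "(\<lambda>q. 1 + 2 * suminf (\<lambda>k. a k q)) \<longlonglongrightarrow> 1 + 2 * omega x"
    by (intro tendsto_intros T1)
  ultimately show ?thesis using LIMSEQ_unique by fastforce
qed

section \<open>The entire function Xi\<close>

lemma exp_pi_lower: "exp pi \<ge> (229/10 :: real)"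
proof -
  \<comment> \<open>32 * 0.0981 = 3.1392 is just below pi, and at 0.0981 the quadratic Taylor
    polynomial is accurate enough to survive the 32nd power.\<close>
  have "(229/10 :: real) \<le> (1 + 981/10000 + (981/10000)\<^sup>2 / 2) ^ 32"
    by (simp add: power2_eq_square power_divide field_simps)
  also have "\<dots> \<le> exp (981/10000) ^ 32"
    by (intro power_mono exp_lower_Taylor_quadratic) auto
  also have "\<dots> = exp (32 * (981/10000))" by (simp add: exp_of_nat_mult[symmetric])
  also have "\<dots> \<le> exp pi" using pi_approx by simp
  finally show ?thesis .
qed

section \<open>Bounds and continuity of the theta series\<close>

lemma omega_term_le:
  assumes "x > 0"
  shows "exp (- (pi * (real (Suc n))\<^sup>2 * x)) \<le> exp (- (pi * x)) * exp (- (3 * pi * x)) ^ n"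
proof -
  have "1 + 3 * real n \<le> (real (Suc n))\<^sup>2"
    by (cases n) (auto simp: power2_eq_square algebra_simps)
  then have "(pi * x) * (1 + 3 * real n) \<le> (pi * x) * (real (Suc n))\<^sup>2"
    using assms by (intro mult_left_mono) auto
  then show ?thesis by (simp add: exp_of_nat_mult[symmetric] exp_add[symmetric] algebra_simps)
qed

lemma summable_omega_bound:
  assumes "x > 0" shows "summable (\<lambda>n. exp (- (pi * x)) * exp (- (3 * pi * x)) ^ n)"
  by (intro summable_mult summable_geometric) (use assms in auto)

lemma summable_omega:
  assumes "x > 0" shows "summable (\<lambda>n. exp (- (pi * (real (Suc n))\<^sup>2 * x)))"
  by (rule summable_comparison_test'[OF summable_omega_bound[OF assms], of 0])
     (use omega_term_le[OF assms] in auto)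

lemma omega_pos: "x > 0 \<Longrightarrow> omega x > 0"
  unfolding omega_def by (intro suminf_pos summable_omega) auto

lemma omega_le:
  assumes "x \<ge> 1" shows "omega x \<le> 101/100 * exp (- (pi * x))"
proof -
  have x: "x > 0" using assms by simp
  have s: "exp (- (3 * pi * x)) \<le> 1/1000"
  proof -
    have "(22::real) ^ 3 \<le> exp pi ^ 3" using exp_pi_lower by (intro power_mono) auto
    also have "\<dots> = exp (3 * pi * 1)" by (simp add: exp_of_nat_mult[symmetric])
    also have "\<dots> \<le> exp (3 * pi * x)" using assms by simp
    finally show ?thesis by (simp add: exp_minus field_simps)
  qed
  have "omega x \<le> (\<Sum>n. exp (- (pi * x)) * exp (- (3 * pi * x)) ^ n)"
    unfolding omega_def by (intro suminf_le summable_omega summable_omega_bound x omega_term_le)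
  also have "\<dots> = exp (- (pi * x)) * (1 / (1 - exp (- (3 * pi * x))))"
    using x by (subst suminf_mult) (auto simp: suminf_geometric intro!: summable_geometric)
  also have "\<dots> \<le> exp (- (pi * x)) * (1 / (999/1000))"
    using s x by (intro mult_left_mono divide_left_mono) auto
  also have "\<dots> \<le> exp (- (pi * x)) * (101/100)" by (intro mult_left_mono) auto
  finally show ?thesis by simp
qed

lemma continuous_on_omega: "continuous_on {1..} omega"
proof -
  have "uniform_limit {1..} (\<lambda>N x. \<Sum>n<N. exp (- (pi * (real (Suc n))\<^sup>2 * x))) (\<lambda>x. \<Sum>n. exp (- (pi * (real (Suc n))\<^sup>2 * x))) sequentially"
  proof (rule Weierstrass_m_test)
    show "norm (exp (- (pi * (real (Suc n))\<^sup>2 * x))) \<le> exp (- (pi * 1)) * exp (- (3 * pi * 1)) ^ n"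
      if "x \<in> {1..}" for n x
    proof -
      have "exp (- (pi * (real (Suc n))\<^sup>2 * x)) \<le> exp (- (pi * (real (Suc n))\<^sup>2 * 1))" using that by simp
      also have "\<dots> \<le> exp (- (pi * 1)) * exp (- (3 * pi * 1)) ^ n" by (rule omega_term_le) simp
      finally show ?thesis by simp
    qed
    show "summable (\<lambda>n. exp (- (pi * 1)) * exp (- (3 * pi * 1)) ^ n)" by (rule summable_omega_bound) simp
  qed
  then show ?thesis unfolding omega_def[abs_def]
    by (rule uniform_limit_theorem[rotated]) (auto intro!: always_eventually continuous_intros)
qed

text \<open>In the variable x = exp v this is the integral of exp (- c x) over x >= exp a. All
  estimates of \<open>xi_integral\<close> reduce to it.\<close>

lemma exp_exp_integral:
  assumes "c > (0::real)"
  shows "has_bochner_integral lborel (\<lambda>v. indicator {a..} v *\<^sub>R (exp v * exp (- (c * exp v)))) (exp (- (c * exp a)) / c)"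
proof (rule has_bochner_integral_nn_integral)
  have "(\<integral>\<^sup>+v. ennreal (exp v * exp (- (c * exp v))) * indicator {a..} v \<partial>lborel) = 0 - (- exp (- (c * exp a)) / c)"
  proof (rule nn_integral_FTC_atLeast)
    show "((\<lambda>v. - exp (- (c * exp v)) / c) \<longlongrightarrow> 0) at_top" using assms by real_asymp
    show "((\<lambda>v. - exp (- (c * exp v)) / c) has_real_derivative exp x * exp (- (c * exp x))) (at x)" for x
      using assms by (auto intro!: derivative_eq_intros)
  qed auto
  also have "(\<integral>\<^sup>+v. ennreal (exp v * exp (- (c * exp v))) * indicator {a..} v \<partial>lborel) =
     (\<integral>\<^sup>+v. ennreal (indicator {a..} v *\<^sub>R (exp v * exp (- (c * exp v)))) \<partial>lborel)"
    by (intro nn_integral_cong) (auto split: split_indicator)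
  finally show "(\<integral>\<^sup>+v. ennreal (indicator {a..} v *\<^sub>R (exp v * exp (- (c * exp v)))) \<partial>lborel) = ennreal (exp (- (c * exp a)) / c)"
    by simp
qed (use assms in auto)

text \<open>
  With \<open>x = exp v\<close> and \<open>s = 1/2 + w\<close>, \<open>xi_integral w\<close> is Riemann's integral of
  \<open>(x powr (s/2 - 1) + x powr (- (1 + s)/2)) * omega x\<close> over \<open>x \<ge> 1\<close>, and \<open>Xi w\<close> is twice the
  paper's \<open>\<xi>(1/2 + w)\<close>.
\<close>

definition xi_kernel :: "complex \<Rightarrow> real \<Rightarrow> complex" where
  "xi_kernel w v = exp (of_real (v / 4)) * (exp (w * of_real v / 2) + exp (- (w * of_real v / 2))) * of_real (omega (exp v))"

definition xi_integral :: "complex \<Rightarrow> complex" where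
  "xi_integral w = (LINT v:{0..}|lborel. xi_kernel w v)"

definition Xi :: "complex \<Rightarrow> complex" where
  "Xi w = 1 + (w\<^sup>2 - 1/4) * xi_integral w"

lemma continuous_on_omega_exp: "continuous_on {0..} (\<lambda>v. omega (exp v))"
  by (rule continuous_on_compose2[OF continuous_on_omega]) (auto intro!: continuous_intros)

lemma continuous_on_xi_kernel: "continuous_on {0..} (xi_kernel w)"
  unfolding xi_kernel_def by (intro continuous_intros continuous_on_omega_exp) auto

lemma set_borel_measurable_xi_kernel: "set_borel_measurable lborel {0..} (xi_kernel w)"
  unfolding set_borel_measurable_def
  using borel_measurable_continuous_on_indicator[OF _ continuous_on_xi_kernel] by simp

lemma norm_xi_kernel_le:
  assumes "v \<ge> 0"
  shows "norm (xi_kernel w v) \<le> exp (v / 4) * (exp (\<bar>Re w\<bar> * v / 2) + exp (- (\<bar>Re w\<bar> * v / 2))) * omega (exp v)"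
proof -
  have "norm (exp (w * of_real v / 2) + exp (- (w * of_real v / 2))) \<le> exp (Re w * v / 2) + exp (- (Re w * v / 2))"
    by (rule order.trans[OF norm_triangle_ineq]) simp
  also have "\<dots> = exp (\<bar>Re w\<bar> * v / 2) + exp (- (\<bar>Re w\<bar> * v / 2))" by (auto simp: abs_if)
  finally show ?thesis
    using omega_pos[of "exp v"] unfolding xi_kernel_def norm_mult
    by (intro mult_mono) (auto simp: norm_exp_eq_Re)
qed

text \<open>One majorant yields integrability, a bound on the size, and a truncation error; the last
  gives the locally uniform convergence behind \<open>xi_integral_holomorphic\<close>.\<close>

lemma xi_integral_bound:
  assumes bound: "\<And>v. v \<ge> 0 \<Longrightarrow> norm (xi_kernel w v) \<le> C * (exp v * exp (- (c * exp v)))" and c: "c > 0"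
  shows "set_integrable lborel {0..} (xi_kernel w)"
    and "norm (xi_integral w) \<le> C * exp (- c) / c"
    and "a \<ge> 0 \<Longrightarrow> norm (xi_integral w - (LINT v:{0..a}|lborel. xi_kernel w v)) \<le> C * exp (- (c * exp a)) / c"
proof -
  have d: "set_integrable lborel {a..} (\<lambda>v. C * (exp v * exp (- (c * exp v))))" for a
    using exp_exp_integral[OF c, of a] unfolding set_integrable_def has_bochner_integral_iff
    by (auto intro!: integrable_mult_right[where c = C] simp: mult.left_commute)
  have di: "(LINT v:{a..}|lborel. C * (exp v * exp (- (c * exp v)))) = C * exp (- (c * exp a)) / c" for a
    using exp_exp_integral[OF c, of a] unfolding set_lebesgue_integral_def has_bochner_integral_iff
    by (simp add: mult.left_commute)
  show int: "set_integrable lborel {0..} (xi_kernel w)"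
    by (rule set_integrable_bound[OF d[of 0] set_borel_measurable_xi_kernel]) (use bound in \<open>auto intro!: AE_I2 order.trans[OF _ abs_ge_self]\<close>)
  have tail: "norm (LINT v:{a..}|lborel. xi_kernel w v) \<le> C * exp (- (c * exp a)) / c" if "a \<ge> 0" for a
  proof -
    have i: "set_integrable lborel {a..} (xi_kernel w)"
      by (rule set_integrable_subset[OF int]) (use that in auto)
    have "norm (LINT v:{a..}|lborel. xi_kernel w v) \<le> (LINT v:{a..}|lborel. norm (xi_kernel w v))"
      by (rule set_integral_norm_bound[OF i])
    also have "\<dots> \<le> (LINT v:{a..}|lborel. C * (exp v * exp (- (c * exp v))))"
      by (rule set_integral_mono[OF set_integrable_norm[OF i] d]) (use bound that in auto)
    finally show ?thesis unfolding di .
  qed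
  show "norm (xi_integral w) \<le> C * exp (- c) / c" using tail[of 0] by (simp add: xi_integral_def)
  show "norm (xi_integral w - (LINT v:{0..a}|lborel. xi_kernel w v)) \<le> C * exp (- (c * exp a)) / c" if a: "a \<ge> 0"
  proof -
    have "(LINT v:{0..}|lborel. xi_kernel w v) = (LINT v:{0..a} \<union> {a..}|lborel. xi_kernel w v)"
      using a by (intro arg_cong[of _ _ "\<lambda>A. LINT v:A|lborel. xi_kernel w v"]) auto
    also have "\<dots> = (LINT v:{0..a}|lborel. xi_kernel w v) + (LINT v:{a..}|lborel. xi_kernel w v)"
    proof (rule set_integral_Un_AE)
      have "AE v in lborel. v \<noteq> a" by (rule AE_lborel_singleton)
      then show "AE v in lborel. \<not> (v \<in> {0..a} \<and> v \<in> {a..})" by eventually_elim auto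
    qed (use a in \<open>auto intro!: set_integrable_subset[OF int]\<close>)
    finally show ?thesis using tail[OF a] by (simp add: xi_integral_def)
  qed
qed

lemma xi_kernel_bound_strip:
  assumes "\<bar>Re w\<bar> \<le> 1/2" "v \<ge> 0"
  shows "norm (xi_kernel w v) \<le> 202/100 * (exp v * exp (- (pi * exp v)))"
proof -
  have "norm (xi_kernel w v) \<le> exp (v / 4) * (exp (\<bar>Re w\<bar> * v / 2) + exp (- (\<bar>Re w\<bar> * v / 2))) * omega (exp v)"
    by (rule norm_xi_kernel_le) fact
  also have "\<dots> \<le> (2 * exp v) * (101/100 * exp (- (pi * exp v)))"
  proof (rule mult_mono)
    have "exp (v / 4) * (exp (\<bar>Re w\<bar> * v / 2) + exp (- (\<bar>Re w\<bar> * v / 2))) =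
       exp (v / 4 + \<bar>Re w\<bar> * v / 2) + exp (v / 4 - \<bar>Re w\<bar> * v / 2)"
      by (simp add: distrib_left exp_add[symmetric])
    also have "\<dots> \<le> exp v + exp v"
    proof (intro add_mono)
      have "\<bar>Re w\<bar> * v \<le> 1/2 * v" "\<bar>Re w\<bar> * v \<ge> 0" using mult_right_mono[OF assms] assms(2) by auto
      then show "exp (v / 4 + \<bar>Re w\<bar> * v / 2) \<le> exp v" "exp (v / 4 - \<bar>Re w\<bar> * v / 2) \<le> exp v"
        unfolding exp_le_cancel_iff using assms(2) by linarith+
    qed
    finally show "exp (v / 4) * (exp (\<bar>Re w\<bar> * v / 2) + exp (- (\<bar>Re w\<bar> * v / 2))) \<le> 2 * exp v" by simp
    show "omega (exp v) \<le> 101/100 * exp (- (pi * exp v))" using omega_le[of "exp v"] assms by simp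
  qed (use omega_pos[of "exp v"] in auto)
  finally show ?thesis by simp
qed

text \<open>The numerical input for everything about low zeros: a quarter of 57/2000 bounds the
  distance of \<open>Xi 0\<close> from 1, and its reciprocal bounds |w^2 - 1/4| from below at a zero
  \<open>w\<close>.\<close>

lemma norm_xi_integral_strip:
  assumes "\<bar>Re w\<bar> \<le> 1/2" shows "norm (xi_integral w) \<le> 57/2000"
proof -
  have "norm (xi_integral w) \<le> 202/100 * exp (- pi) / pi"
    by (rule xi_integral_bound(2)) (use xi_kernel_bound_strip[OF assms] in auto)
  also have "\<dots> = (202/100) / (exp pi * pi)" by (simp add: exp_minus field_simps)
  also have "\<dots> \<le> (202/100) / ((229/10) * (3.14))"
    by (intro divide_left_mono mult_mono exp_pi_lower) (use pi_approx in auto)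
  also have "\<dots> \<le> 57/2000" by simp
  finally show ?thesis .
qed

text \<open>For a > 0 the exponent a v - exp v is largest at v = ln a, with value a ln a - a. This
  is the origin of the growth exp (O(r ln r)) of \<open>Xi\<close>; as pi > 3, enough decay remains
  for the integral over \<open>v\<close>.\<close>

lemma xi_kernel_bound_general:
  assumes "norm w \<le> r" "v \<ge> 0"
  shows "norm (xi_kernel w v) \<le> 4 * exp ((r/2 + 1/4) * ln (r/2 + 1/4)) * (exp v * exp (- (1 * exp v)))"
proof -
  define a where "a = r/2 + 1/4"
  have a: "a > 0" using assms(1) norm_ge_zero[of w] by (simp add: a_def add_nonneg_pos order.trans[OF norm_ge_zero])
  have "norm (xi_kernel w v) \<le> exp (v / 4) * (exp (\<bar>Re w\<bar> * v / 2) + exp (- (\<bar>Re w\<bar> * v / 2))) * omega (exp v)"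
    by (rule norm_xi_kernel_le) fact
  also have "\<dots> \<le> (2 * exp (a * v)) * (101/100 * exp (- (pi * exp v)))"
  proof (rule mult_mono)
    have "exp (v / 4) * (exp (\<bar>Re w\<bar> * v / 2) + exp (- (\<bar>Re w\<bar> * v / 2))) =
       exp (v / 4 + \<bar>Re w\<bar> * v / 2) + exp (v / 4 - \<bar>Re w\<bar> * v / 2)"
      by (simp add: distrib_left exp_add[symmetric])
    also have "\<dots> \<le> exp (a * v) + exp (a * v)"
    proof (intro add_mono)
      have "\<bar>Re w\<bar> * v \<le> r * v" "\<bar>Re w\<bar> * v \<ge> 0"
        using assms abs_Re_le_cmod[of w] by (auto intro!: mult_right_mono)
      then show "exp (v / 4 + \<bar>Re w\<bar> * v / 2) \<le> exp (a * v)" "exp (v / 4 - \<bar>Re w\<bar> * v / 2) \<le> exp (a * v)"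
        by (auto simp: a_def algebra_simps)
    qed
    finally show "exp (v / 4) * (exp (\<bar>Re w\<bar> * v / 2) + exp (- (\<bar>Re w\<bar> * v / 2))) \<le> 2 * exp (a * v)" by simp
    show "omega (exp v) \<le> 101/100 * exp (- (pi * exp v))" using omega_le[of "exp v"] assms by simp
  qed (use omega_pos[of "exp v"] in auto)
  also have "\<dots> \<le> 4 * exp (a * v - pi * exp v)" by (simp add: exp_diff exp_minus field_simps)
  also have "\<dots> \<le> 4 * exp (a * ln a + v - exp v)"
  proof -
    have "ln (exp v / a) \<le> exp v / a - 1" using a by (intro ln_le_minus_one) auto
    then have "a * (v - ln a) \<le> a * (exp v / a - 1)" using a by (intro mult_left_mono) (simp_all add: ln_div)
    then have "a * v \<le> a * ln a + exp v - a" using a by (simp add: algebra_simps)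
    moreover have "3 * exp v \<le> pi * exp v" using pi_gt3 by (intro mult_right_mono) auto
    moreover have "exp v > 0" by simp
    ultimately have "a * v - pi * exp v \<le> a * ln a + v - exp v" using a assms(2) by linarith
    then show ?thesis by simp
  qed
  also have "\<dots> = 4 * exp ((r/2 + 1/4) * ln (r/2 + 1/4)) * (exp v * exp (- (1 * exp v)))"
    by (simp add: a_def[symmetric] exp_diff exp_add exp_minus field_simps)
  finally show ?thesis .
qed

lemma set_integrable_xi_kernel: "set_integrable lborel {0..} (xi_kernel w)"
  by (rule xi_integral_bound(1)[OF xi_kernel_bound_general[OF order_refl]]) auto

lemma xi_integral_holomorphic: "xi_integral holomorphic_on UNIV"
proof (rule holomorphic_uniform_sequence)
  define In where "In = (\<lambda>n w. integral (cbox 0 (real n)) (xi_kernel w))"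
  show "In n holomorphic_on UNIV" for n
    unfolding In_def
  proof (rule leibniz_rule_holomorphic)
    fix w v
    show "((\<lambda>w. xi_kernel w v) has_field_derivative
       exp (of_real (v / 4)) * (of_real v / 2 * exp (w * of_real v / 2) - of_real v / 2 * exp (- (w * of_real v / 2))) * of_real (omega (exp v))) (at w within UNIV)"
      unfolding xi_kernel_def by (auto intro!: derivative_eq_intros simp: algebra_simps)
    show "xi_kernel w integrable_on cbox 0 (real n)"
      by (intro integrable_continuous continuous_on_subset[OF continuous_on_xi_kernel]) auto
    have "continuous_on (UNIV \<times> cbox 0 (real n)) (\<lambda>x::complex \<times> real. omega (exp (snd x)))"
      by (rule continuous_on_compose2[OF continuous_on_omega_exp]) (auto intro!: continuous_intros)
    then show "continuous_on (UNIV \<times> cbox 0 (real n)) (\<lambda>(w, v).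
      exp (of_real (v / 4)) * (of_real v / 2 * exp (w * of_real v / 2) - of_real v / 2 * exp (- (w * of_real v / 2))) * of_real (omega (exp v)) :: complex)"
      unfolding case_prod_beta by (intro continuous_intros) auto
  qed auto
  fix z :: complex
  show "\<exists>d>0. cball z d \<subseteq> UNIV \<and> uniform_limit (cball z d) In xi_integral sequentially"
  proof (intro exI[of _ 1] conjI)
    define C where "C = 4 * exp (((norm z + 1)/2 + 1/4) * ln ((norm z + 1)/2 + 1/4))"
    show "uniform_limit (cball z 1) In xi_integral sequentially"
    proof (rule uniform_limitI)
      fix e :: real assume e: "e > 0"
      have "(\<lambda>n. C * exp (- (1 * exp (real n))) / 1) \<longlonglongrightarrow> 0"
        by (cases "C = 0") (simp, real_asymp)
      then have "\<forall>\<^sub>F n in sequentially. C * exp (- (1 * exp (real n))) / 1 < e" using e by (rule order_tendstoD)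
      then show "\<forall>\<^sub>F n in sequentially. \<forall>w\<in>cball z 1. dist (In n w) (xi_integral w) < e"
      proof eventually_elim
        case (elim n)
        show ?case
        proof
          fix w assume "w \<in> cball z 1"
          then have w: "norm w \<le> norm z + 1"
            using norm_triangle_ineq2[of w z] by (auto simp: dist_norm norm_minus_commute)
          have "set_integrable lborel {0..real n} (xi_kernel w)"
            by (rule set_integrable_subset[OF set_integrable_xi_kernel]) auto
          from set_borel_integral_eq_integral(2)[OF this]
          have "In n w = (LINT v:{0..real n}|lborel. xi_kernel w v)" by (simp add: In_def)
          moreover have "norm (xi_integral w - (LINT v:{0..real n}|lborel. xi_kernel w v)) \<le> C * exp (- (1 * exp (real n))) / 1"
            unfolding C_def by (rule xi_integral_bound(3)[OF xi_kernel_bound_general[OF w]]) auto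
          ultimately show "dist (In n w) (xi_integral w) < e"
            using elim by (simp add: dist_norm norm_minus_commute)
        qed
      qed
    qed
  qed auto
qed auto

lemma Xi_holomorphic: "Xi holomorphic_on UNIV"
  unfolding Xi_def[abs_def] by (intro holomorphic_intros xi_integral_holomorphic)

lemma xi_integral_minus: "xi_integral (- w) = xi_integral w"
  by (simp add: xi_integral_def xi_kernel_def add.commute)

lemma Xi_minus: "Xi (- w) = Xi w"
  by (simp add: Xi_def xi_integral_minus)

lemma Xi_cnj: "Xi (cnj w) = cnj (Xi w)"
proof -
  have "xi_kernel (cnj w) v = cnj (xi_kernel w v)" for v
    by (simp add: xi_kernel_def exp_cnj)
  then have "xi_integral (cnj w) = cnj (xi_integral w)"
    unfolding xi_integral_def set_lebesgue_integral_def by (simp flip: integral_cnj complex_cnj_scaleR)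
  then show ?thesis by (simp add: Xi_def)
qed

lemma Xi_growth:
  assumes "e > 0"
  shows "\<exists>r. \<forall>w. norm w \<ge> r \<longrightarrow> norm (Xi w) \<le> exp (e * (norm w)\<^sup>2)"
proof -
  have "\<forall>\<^sub>F r in at_top. 1 + (r\<^sup>2 + 1/4) * (4 * exp ((r/2 + 1/4) * ln (r/2 + 1/4))) \<le> exp (e * r\<^sup>2)"
    using assms by real_asymp
  then obtain r0 where r0: "\<And>r. r \<ge> r0 \<Longrightarrow> 1 + (r\<^sup>2 + 1/4) * (4 * exp ((r/2 + 1/4) * ln (r/2 + 1/4))) \<le> exp (e * r\<^sup>2)"
    by (auto simp: eventually_at_top_linorder)
  have "norm (Xi w) \<le> exp (e * (norm w)\<^sup>2)" if "norm w \<ge> r0" for w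
  proof -
    let ?r = "norm w"
    let ?E = "4 * exp ((?r/2 + 1/4) * ln (?r/2 + 1/4))"
    have "norm (xi_integral w) \<le> ?E * exp (- 1) / 1"
      by (rule xi_integral_bound(2)[OF xi_kernel_bound_general[OF order_refl]]) auto
    also have "\<dots> \<le> ?E * 1 / 1" by (intro divide_right_mono mult_left_mono) auto
    finally have i: "norm (xi_integral w) \<le> ?E" by simp
    have "norm (w\<^sup>2 - 1/4) \<le> ?r\<^sup>2 + 1/4"
      by (rule order.trans[OF norm_triangle_ineq4]) (simp add: norm_power)
    then have "norm ((w\<^sup>2 - 1/4) * xi_integral w) \<le> (?r\<^sup>2 + 1/4) * ?E"
      unfolding norm_mult using i by (intro mult_mono) auto
    then have "norm (Xi w) \<le> 1 + (?r\<^sup>2 + 1/4) * ?E"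
      unfolding Xi_def by (intro order.trans[OF norm_triangle_ineq]) simp
    also have "\<dots> \<le> exp (e * ?r\<^sup>2)" using r0[OF that] .
    finally show ?thesis .
  qed
  then show ?thesis by blast
qed

lemma Xi_half: "Xi (1/2) = 1"
  by (simp add: Xi_def power2_eq_square)

text \<open>At \<open>w = 0\<close> the kernel is real and positive. The strict upper bound later
  forces a zero of \<open>Xi\<close> to exist, and the lower bound excludes low zeros off the
  line.\<close>

lemma norm_Xi_0: "norm (Xi 0) \<ge> 1 - 57/8000" "norm (Xi 0) < 1"
proof -
  define k where "k = (\<lambda>v. 2 * exp (v / 4) * omega (exp v))"
  have k: "xi_kernel 0 v = of_real (k v)" for v using exp_of_real[of "v / 4", where 'a = complex] by (simp add: xi_kernel_def k_def)
  have int: "set_integrable lborel {0..} k"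
    using set_integrable_xi_kernel[of 0] unfolding k set_integrable_def
    by (simp add: scaleR_conv_of_real complex_of_real_integrable_eq flip: of_real_mult)
  define j where "j = (LINT v:{0..}|lborel. k v)"
  have xj: "xi_integral 0 = of_real j"
    unfolding xi_integral_def j_def k set_lebesgue_integral_def
    by (simp add: scaleR_conv_of_real flip: of_real_mult)
  have c: "pi + 1 > 0" by (simp add: add_pos_pos)
  have d: "set_integrable lborel {0..} (\<lambda>v. exp v * exp (- ((pi + 1) * exp v)))"
    and di: "(LINT v:{0..}|lborel. exp v * exp (- ((pi + 1) * exp v))) = exp (- ((pi + 1) * exp 0)) / (pi + 1)"
    using exp_exp_integral[OF c, of 0]
    unfolding set_integrable_def has_bochner_integral_iff set_lebesgue_integral_def by auto
  \<comment> \<open>Only positivity of the integral is at stake, so a minorant in closed form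
    suffices: one more factor exp (- exp v) outweighs the surplus growth of exp v.\<close>
  have "exp v * exp (- ((pi + 1) * exp v)) \<le> k v" if v: "v \<in> {0..}" for v
  proof -
    have "exp (- (pi * exp v)) \<le> omega (exp v)"
    proof -
      have "(\<Sum>n\<in>{0}. exp (- (pi * (real (Suc n))\<^sup>2 * exp v))) \<le> omega (exp v)"
        unfolding omega_def by (intro sum_le_suminf summable_omega) auto
      then show ?thesis by simp
    qed
    moreover have "exp v * exp (- exp v) \<le> 2 * exp (v / 4)"
    proof -
      have "exp v * exp (- exp v) \<le> exp (v / 4)"
      proof -
        have "v + - exp v \<le> v / 4" using exp_ge_add_one_self[of v] v unfolding atLeast_iff by linarith
        then show ?thesis by (simp only: exp_add[symmetric] exp_le_cancel_iff)
      qed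
      then show ?thesis using exp_gt_zero[of "v/4"] by linarith
    qed
    ultimately have "(exp v * exp (- exp v)) * exp (- (pi * exp v)) \<le> (2 * exp (v / 4)) * omega (exp v)"
      by - (rule mult_mono, assumption+, simp_all)
    moreover have "(exp v * exp (- exp v)) * exp (- (pi * exp v)) = exp v * exp (- ((pi + 1) * exp v))"
      by (simp add: exp_add[symmetric] algebra_simps)
    ultimately show ?thesis by (simp only: k_def)
  qed
  from set_integral_mono[OF d int this]
  have "exp (- ((pi + 1) * exp 0)) / (pi + 1) \<le> j" by (simp add: di j_def)
  moreover have "exp (- ((pi + 1) * exp 0)) / (pi + 1) > 0" using c by simp
  ultimately have j0: "j > 0" by linarith
  have j1: "j \<le> 57/2000" using norm_xi_integral_strip[of 0] j0 by (simp add: xj)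
  have "Xi 0 = of_real (1 - j / 4)" by (simp add: Xi_def xj)
  then have "norm (Xi 0) = \<bar>1 - j / 4\<bar>" by (simp only: norm_of_real)
  then show "norm (Xi 0) \<ge> 1 - 57/8000" "norm (Xi 0) < 1" using j0 j1 by auto
qed

text \<open>At a zero, |w^2 - 1/4| is the reciprocal of |xi_integral w|, hence at least 2000/57 >
  35; the real part and the constant 1/4 account for at most 1/2 of it.\<close>

lemma Xi_zero_Im:
  assumes "Xi w = 0" "\<bar>Re w\<bar> \<le> 1/2" shows "(Im w)\<^sup>2 \<ge> 34"
proof -
  have "(w\<^sup>2 - 1/4) * xi_integral w = - 1" using assms(1) by (simp add: Xi_def eq_neg_iff_add_eq_0 add.commute)
  then have "norm (w\<^sup>2 - 1/4) * norm (xi_integral w) = 1" by (metis norm_minus_cancel norm_mult norm_one)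
  moreover have "norm (w\<^sup>2 - 1/4) * norm (xi_integral w) \<le> norm (w\<^sup>2 - 1/4) * (57/2000)"
    by (intro mult_left_mono norm_xi_integral_strip assms) auto
  ultimately have 1: "norm (w\<^sup>2 - 1/4) \<ge> 2000/57" by simp
  have "norm (w\<^sup>2 - 1/4) \<le> (norm w)\<^sup>2 + 1/4"
    by (rule order.trans[OF norm_triangle_ineq4]) (simp add: norm_power)
  also have "(norm w)\<^sup>2 = (Re w)\<^sup>2 + (Im w)\<^sup>2" by (rule cmod_power2)
  also have "(Re w)\<^sup>2 \<le> (1/2)\<^sup>2" using assms(2) power_mono[of "\<bar>Re w\<bar>" "1/2" 2] by simp
  finally show ?thesis using 1 by (simp add: power2_eq_square)
qed

section \<open>Mellin transform and continuation of zeta\<close>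

lemma Gamma_integral_exp:
  assumes "Re z > 0"
  shows "has_bochner_integral lborel (\<lambda>v. exp (z * of_real v) * of_real (exp (- exp v))) (Gamma z)"
proof -
  let ?f = "\<lambda>t. complex_of_real t powr (z - 1) / of_real (exp t)"
  have range: "range (exp :: real \<Rightarrow> real) = {0<..}"
    by (auto simp: image_iff) (metis exp_ln)
  have eq: "\<bar>exp v\<bar> *\<^sub>R ?f (exp v) = exp (z * of_real v) * of_real (exp (- exp v))" for v
  proof -
    have p: "complex_of_real (exp v) powr (z - 1) = exp ((z - 1) * of_real v)"
      by (simp add: powr_def Ln_of_real)
    have "exp (complex_of_real v) * exp ((z - 1) * of_real v) = exp (z * of_real v)"
      by (simp add: exp_add[symmetric] algebra_simps)
    then show ?thesis unfolding p
      by (simp add: scaleR_conv_of_real exp_minus exp_of_real[symmetric] field_simps)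
  qed
  have "(\<lambda>v. \<bar>exp v\<bar> *\<^sub>R ?f (exp v)) absolutely_integrable_on UNIV \<and> integral UNIV (\<lambda>v. \<bar>exp v\<bar> *\<^sub>R ?f (exp v)) = Gamma z
     \<longleftrightarrow> ?f absolutely_integrable_on range exp \<and> integral (range exp) ?f = Gamma z"
    by (rule has_absolute_integral_change_of_variables_real) (auto intro!: derivative_eq_intros simp: inj_on_def)
  also have "?f absolutely_integrable_on range exp \<and> integral (range exp) ?f = Gamma z"
    unfolding range using absolutely_integrable_Gamma_integral'[OF assms] Gamma_integral_complex'[OF assms]
    by (auto simp: integral_unique)
  finally have 1: "(\<lambda>v. exp (z * of_real v) * of_real (exp (- exp v))) absolutely_integrable_on UNIV"
    "integral UNIV (\<lambda>v. exp (z * of_real v) * of_real (exp (- exp v))) = Gamma z"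
    unfolding eq by auto
  have "integrable lborel (\<lambda>v. exp (z * of_real v) * of_real (exp (- exp v)))"
    using 1(1) unfolding set_integrable_def by (subst (asm) integrable_completion) auto
  with 1(2) show ?thesis
    by (simp add: has_bochner_integral_iff integral_lborel)
qed

lemma Gamma_integral_theta_term:
  assumes "Re s > 0"
  shows "has_bochner_integral lborel
      (\<lambda>v. exp (s * of_real v / 2) * of_real (exp (- (pi * (real (Suc n))\<^sup>2 * exp v))))
      (Gamma (s / 2) * of_real pi powr (- s / 2) * (1 / of_nat (Suc n) powr s))"
proof -
  \<comment> \<open>Rescaling Euler's integral by pi n^2 is a translation in the logarithmic
    variable.\<close>
  define t where "t = ln (pi * (real (Suc n))\<^sup>2)"
  have et: "exp t = pi * (real (Suc n))\<^sup>2" unfolding t_def by (intro exp_ln) auto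
  have "has_bochner_integral lborel (\<lambda>v. exp (s / 2 * of_real (t + 1 * v)) * of_real (exp (- exp (t + 1 * v)))) (Gamma (s / 2) /\<^sub>R \<bar>1\<bar>)"
    using Gamma_integral_exp[of "s / 2"] assms
    by (subst lborel_has_bochner_integral_real_affine_iff[symmetric, where c = 1 and t = t]) auto
  from has_bochner_integral_mult_right[OF this, of "exp (- (s / 2 * of_real t))"]
  have "has_bochner_integral lborel (\<lambda>v. exp (- (s / 2 * of_real t)) * (exp (s / 2 * of_real (t + 1 * v)) * of_real (exp (- exp (t + 1 * v)))))
     (exp (- (s / 2 * of_real t)) * Gamma (s / 2))" by simp
  also have "(\<lambda>v. exp (- (s / 2 * of_real t)) * (exp (s / 2 * of_real (t + 1 * v)) * of_real (exp (- exp (t + 1 * v))))) =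
     (\<lambda>v. exp (s * of_real v / 2) * of_real (exp (- (pi * (real (Suc n))\<^sup>2 * exp v))))"
  proof
    fix v
    have "exp (- (s / 2 * of_real t)) * exp (s / 2 * of_real (t + 1 * v)) = exp (s * of_real v / 2)"
      by (simp add: exp_add[symmetric] algebra_simps add_divide_distrib diff_divide_distrib)
    moreover have "exp (t + 1 * v) = pi * (real (Suc n))\<^sup>2 * exp v" by (simp add: exp_add et del: of_nat_Suc)
    ultimately show "exp (- (s / 2 * of_real t)) * (exp (s / 2 * of_real (t + 1 * v)) * of_real (exp (- exp (t + 1 * v)))) =
      exp (s * of_real v / 2) * of_real (exp (- (pi * (real (Suc n))\<^sup>2 * exp v)))"
      by (simp only: mult.assoc[symmetric])
  qed
  also have "exp (- (s / 2 * of_real t)) * Gamma (s / 2) = Gamma (s / 2) * of_real pi powr (- s / 2) * (1 / of_nat (Suc n) powr s)"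
  proof -
    have "t = ln pi + 2 * ln (real (Suc n))" unfolding t_def by (simp add: ln_mult ln_realpow)
    then have "- (s / 2 * of_real t) = - s / 2 * of_real (ln pi) + - (s * of_real (ln (real (Suc n))))"
      by (simp add: algebra_simps add_divide_distrib)
    then have "exp (- (s / 2 * of_real t)) = exp (- s / 2 * of_real (ln pi)) * exp (- (s * of_real (ln (real (Suc n)))))"
      by (simp only: exp_add)
    also have "\<dots> = of_real pi powr (- s / 2) * (1 / of_nat (Suc n) powr s)"
      by (simp add: powr_def Ln_of_real Ln_of_nat exp_minus inverse_eq_divide del: of_nat_Suc)
    finally show ?thesis by (simp add: mult_ac)
  qed
  finally show ?thesis .
qed

section \<open>Mellin transform of the theta series\<close>

lemma summable_norm_zeta:
  assumes "Re s > 1"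
  shows "summable (\<lambda>n. norm (1 / of_nat (Suc n) powr s))"
proof -
  have "norm (1 / of_nat (Suc n) powr s) = real (Suc n) powr (- Re s)" for n
    by (simp add: norm_divide norm_powr_real_powr powr_minus field_simps del: of_nat_Suc)
  moreover have "summable (\<lambda>n. real (Suc n) powr (- Re s))"
    using assms summable_real_powr_iff[of "- Re s"] by (subst summable_Suc_iff) auto
  ultimately show ?thesis by simp
qed

lemma zeta_Mellin:
  assumes "Re s > 1"
  shows "has_bochner_integral lborel (\<lambda>v. exp (s * of_real v / 2) * of_real (omega (exp v)))
    (Gamma (s / 2) * of_real pi powr (- s / 2) * (\<Sum>n. 1 / of_nat (Suc n) powr s))"
proof -
  define h where "h = (\<lambda>n v. exp (s * of_real v / 2) * complex_of_real (exp (- (pi * (real (Suc n))\<^sup>2 * exp v))))"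
  define K where "K = (\<lambda>s::complex. Gamma (s / 2) * of_real pi powr (- s / 2))"
  have hb: "has_bochner_integral lborel (h n) (K s * (1 / of_nat (Suc n) powr s))" for n
    using Gamma_integral_theta_term[of s n] assms by (simp add: h_def K_def)
  \<comment> \<open>The norm of the integrand is the integrand at the real point
    \<open>Re s\<close>, so the same formula evaluates its integral. Exchanging sum and integral is
    thereby reduced to absolute convergence of the Dirichlet series.\<close>
  have hn: "(\<integral>v. norm (h n v) \<partial>lborel) = norm (K (of_real (Re s))) * real (Suc n) powr (- Re s)" for n
  proof -
    let ?x = "complex_of_real (Re s)"
    have "has_bochner_integral lborel (\<lambda>v. complex_of_real (norm (h n v))) (K ?x * (1 / of_nat (Suc n) powr ?x))"
    proof -
      have "complex_of_real (norm (h n v)) = exp (?x * of_real v / 2) * of_real (exp (- (pi * (real (Suc n))\<^sup>2 * exp v)))" for v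
        using exp_of_real[of "Re s * v / 2", where 'a = complex]
        unfolding h_def norm_mult by (simp del: of_nat_Suc)
      then show ?thesis using Gamma_integral_theta_term[of ?x n] assms by (simp add: K_def)
    qed
    then have "complex_of_real (\<integral>v. norm (h n v) \<partial>lborel) = K ?x * (1 / of_nat (Suc n) powr ?x)"
      by (simp add: has_bochner_integral_iff del: of_nat_Suc)
    then have "\<bar>\<integral>v. norm (h n v) \<partial>lborel\<bar> = norm (K ?x * (1 / of_nat (Suc n) powr ?x))"
      by (metis norm_of_real)
    also have "\<dots> = norm (K ?x) * real (Suc n) powr (- Re s)"
      by (simp add: norm_mult norm_divide norm_powr_real_powr powr_minus field_simps del: of_nat_Suc)
    finally show ?thesis by simp
  qed
  have sums_h: "(\<lambda>n. h n v) sums (exp (s * of_real v / 2) * of_real (omega (exp v)))" for v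
    unfolding h_def omega_def by (intro sums_mult sums_of_real summable_sums summable_omega) auto
  have summ: "summable (\<lambda>n. norm (h n v))" for v
    unfolding h_def norm_mult norm_of_real using summable_omega[of "exp v"]
    by (intro summable_mult) simp
  have "summable (\<lambda>n. \<integral>v. norm (h n v) \<partial>lborel)"
    unfolding hn using summable_norm_zeta[OF assms]
    by (intro summable_mult) (simp add: norm_divide norm_powr_real_powr powr_minus inverse_eq_divide del: of_nat_Suc)
  note S = integrable_suminf[of lborel h, OF _ _ this] sums_integral[of lborel h, OF _ _ this]
  have int: "integrable lborel (h n)" for n using hb has_bochner_integral_iff by blast
  have "(\<lambda>v. \<Sum>n. h n v) = (\<lambda>v. exp (s * of_real v / 2) * of_real (omega (exp v)))"
    using sums_h by (auto simp: sums_iff)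
  with S int summ have "integrable lborel (\<lambda>v. exp (s * of_real v / 2) * of_real (omega (exp v)))"
    and sums: "(\<lambda>n. integral\<^sup>L lborel (h n)) sums (\<integral>v. exp (s * of_real v / 2) * of_real (omega (exp v)) \<partial>lborel)"
    by auto
  moreover have "(\<lambda>n. integral\<^sup>L lborel (h n)) sums (K s * (\<Sum>n. 1 / of_nat (Suc n) powr s))"
    using hb summable_norm_cancel[OF summable_norm_zeta[OF assms]]
    by (simp only: has_bochner_integral_iff) (intro sums_mult summable_sums)
  ultimately show ?thesis
    using sums_unique2[OF sums] by (simp add: has_bochner_integral_iff K_def)
qed

lemma has_bochner_integral_fold:
  fixes f :: "real \<Rightarrow> complex"
  assumes "has_bochner_integral lborel f a"
  shows "has_bochner_integral lborel (\<lambda>v. indicator {0..} v *\<^sub>R (f v + f (- v))) a"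
proof -
  have int: "integrable lborel f" and a: "integral\<^sup>L lborel f = a" using assms by (auto simp: has_bochner_integral_iff)
  have f[measurable]: "f \<in> borel_measurable borel" using borel_measurable_integrable[OF int] by simp
  have 1: "integrable lborel (\<lambda>v. indicator {0..} v *\<^sub>R f v)" "integrable lborel (\<lambda>v. indicator {..<0} v *\<^sub>R f v)"
    by (rule integrable_mult_indicator[OF _ int], simp)+
  have r: "has_bochner_integral lborel (\<lambda>v. indicator {..<0} (- v) *\<^sub>R f (- v)) (integral\<^sup>L lborel (\<lambda>v. indicator {..<0} v *\<^sub>R f v))"
  proof -
    have "has_bochner_integral lborel (\<lambda>v. indicator {..<0} v *\<^sub>R f v) (integral\<^sup>L lborel (\<lambda>v. indicator {..<0} v *\<^sub>R f v))"
      using 1(2) by (simp add: has_bochner_integral_iff)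
    from lborel_has_bochner_integral_real_affine_iff[THEN iffD1, OF _ this, of "-1" 0] show ?thesis by simp
  qed
  have "has_bochner_integral lborel (\<lambda>v. indicator {0..} v *\<^sub>R f v + indicator {..<0} (- v) *\<^sub>R f (- v))
     (integral\<^sup>L lborel (\<lambda>v. indicator {0..} v *\<^sub>R f v) + integral\<^sup>L lborel (\<lambda>v. indicator {..<0} v *\<^sub>R f v))"
    by (rule has_bochner_integral_add[OF _ r]) (use 1(1) in \<open>simp add: has_bochner_integral_iff\<close>)
  also have "integral\<^sup>L lborel (\<lambda>v. indicator {0..} v *\<^sub>R f v) + integral\<^sup>L lborel (\<lambda>v. indicator {..<0} v *\<^sub>R f v) = a"
    unfolding Bochner_Integration.integral_add[OF 1, symmetric] a[symmetric]
    by (intro Bochner_Integration.integral_cong) (auto split: split_indicator)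
  \<comment> \<open>At \<open>v = 0\<close> the two integrands differ, since the folded one counts
    that point twice.\<close>
  finally show ?thesis
    by (rule has_bochner_integral_discrete_difference[where X="{0}", THEN iffD1, rotated 4])
       (auto split: split_indicator)
qed

lemma Laplace_exp:
  assumes "Re c > 0"
  shows "has_bochner_integral lborel (\<lambda>v. indicator {0..} v *\<^sub>R exp (- (c * of_real v))) (1 / c)"
proof -
  define r where "r = Re c"
  have r: "r > 0" using assms by (simp add: r_def)
  have "(\<integral>\<^sup>+v. ennreal (exp (- (r * v))) * indicator {0..} v \<partial>lborel) = ennreal (0 - (- exp (- (r * 0)) / r))"
  proof (rule nn_integral_FTC_atLeast[where F = "\<lambda>v. - exp (- (r * v)) / r" and T = 0])
    show "((\<lambda>v. - exp (- (r * v)) / r) \<longlongrightarrow> 0) at_top" using r by real_asymp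
    show "((\<lambda>v. - exp (- (r * v)) / r) has_real_derivative exp (- (r * x))) (at x)" for x
      using r by (auto intro!: derivative_eq_intros)
  qed auto
  also have "(\<integral>\<^sup>+v. ennreal (exp (- (r * v))) * indicator {0..} v \<partial>lborel) =
      (\<integral>\<^sup>+v. ennreal (norm (indicator {0..} v *\<^sub>R exp (- (c * of_real v)))) \<partial>lborel)"
    by (intro nn_integral_cong) (auto simp: r_def norm_exp_eq_Re split: split_indicator)
  finally have int: "set_integrable lborel {0..} (\<lambda>v. exp (- (c * of_real v)))"
    unfolding set_integrable_def by (intro integrableI_bounded) auto
  have c: "c \<noteq> 0" using assms by auto
  have "(LBINT v=0..\<infinity>. exp (- (c * of_real v))) = 0 - (- 1 / c)"
  proof (rule interval_integral_FTC_integrable[where F = "\<lambda>v. - exp (- (c * of_real v)) / c"])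
    show "set_integrable lborel (einterval 0 \<infinity>) (\<lambda>v. exp (- (c * of_real v)))"
      by (rule set_integrable_subset[OF int]) (auto simp: einterval_def)
    show "((\<lambda>v. - exp (- (c * of_real v)) / c) has_vector_derivative exp (- (c * of_real x))) (at x)" for x
    proof -
      have "((\<lambda>v. - exp (- (c * v)) / c) has_field_derivative exp (- (c * of_real x))) (at (of_real x))"
        using c by (auto intro!: derivative_eq_intros)
      from has_vector_derivative_real_field[OF this] show ?thesis by simp
    qed
    show "(((\<lambda>v. - exp (- (c * of_real v)) / c) \<circ> real_of_ereal) \<longlongrightarrow> - 1 / c) (at_right 0)"
      unfolding zero_ereal_def ereal_tendsto_simps1
      by (rule tendsto_eq_intros refl | simp add: c)+
    show "(((\<lambda>v. - exp (- (c * of_real v)) / c) \<circ> real_of_ereal) \<longlongrightarrow> 0) (at_left \<infinity>)"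
      unfolding ereal_tendsto_simps1
    proof (rule tendsto_norm_zero_cancel)
      have "((\<lambda>v. exp (- (r * v)) / norm c) \<longlongrightarrow> 0) at_top" using r c by real_asymp
      then show "((\<lambda>v. norm (- exp (- (c * complex_of_real v)) / c)) \<longlongrightarrow> 0) at_top"
        by (simp add: norm_divide norm_exp_eq_Re r_def)
    qed
  qed (auto intro!: continuous_intros)
  then have "(LBINT v:{0<..}. exp (- (c * of_real v))) = 1 / c"
    by (simp add: interval_lebesgue_integral_def einterval_def greaterThan_def)
  moreover have "(LBINT v:{0..}. exp (- (c * of_real v))) = (LBINT v:{0<..}. exp (- (c * of_real v)))"
    unfolding set_lebesgue_integral_def
    by (rule integral_discrete_difference[where X = "{0}"]) (auto split: split_indicator)
  ultimately show ?thesis using int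
    by (simp add: has_bochner_integral_iff set_integrable_def set_lebesgue_integral_def)
qed

text \<open>The theta transformation solved for the value at the reciprocal argument. The summand
  without \<open>omega\<close> is what produces the poles at 0 and 1.\<close>

lemma omega_reflect: "omega (exp (- v)) = exp (v / 2) * omega (exp v) + (exp (v / 2) - 1) / 2"
proof -
  have "1 + 2 * omega (exp v) = (1 + 2 * omega (exp (- v))) / exp (v / 2)"
  proof -
    have "sqrt (exp v) = exp (v / 2)"
      by (rule real_sqrt_unique) (simp_all add: power2_eq_square flip: exp_add)
    then show ?thesis using theta_functional_equation[of "exp v"] by (simp add: exp_minus inverse_eq_divide)
  qed
  then show ?thesis by (simp add: field_simps)
qed

text \<open>The Mellin integral is folded at \<open>v = 0\<close> and its reflected half rewritten
  by \<open>omega_reflect\<close>. The terms with \<open>omega\<close> assemble to the kernel at s -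
  1/2; the elementary ones integrate to 1 / (s - 1) - 1 / s.\<close>

lemma zeta_xi_integral:
  assumes "Re s > 1"
  shows "Gamma (s / 2) * of_real pi powr (- s / 2) * (\<Sum>n. 1 / of_nat (Suc n) powr s) =
    xi_integral (s - 1/2) + 1 / (s * (s - 1))"
proof -
  let ?D = "Gamma (s / 2) * of_real pi powr (- s / 2) * (\<Sum>n. 1 / of_nat (Suc n) powr s)"
  have s: "s \<noteq> 0" "s \<noteq> 1" using assms by auto
  have 1: "has_bochner_integral lborel (\<lambda>v. indicator {0..} v *\<^sub>R
     (exp (s * of_real v / 2) * of_real (omega (exp v)) + exp (s * of_real (- v) / 2) * of_real (omega (exp (- v))))) ?D"
    using has_bochner_integral_fold[OF zeta_Mellin[OF assms]] by simp
  have "has_bochner_integral lborel (\<lambda>v. indicator {0..} v *\<^sub>R exp (- ((s - 1) / 2 * of_real v))) (1 / ((s - 1) / 2))"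
    "has_bochner_integral lborel (\<lambda>v. indicator {0..} v *\<^sub>R exp (- (s / 2 * of_real v))) (1 / (s / 2))"
    by (rule Laplace_exp; use assms in simp)+
  from has_bochner_integral_diff[OF this]
  have "has_bochner_integral lborel (\<lambda>v. 1/2 * (indicator {0..} v *\<^sub>R exp (- ((s - 1) / 2 * of_real v)) -
      indicator {0..} v *\<^sub>R exp (- (s / 2 * of_real v)))) (1/2 * (1 / ((s - 1) / 2) - 1 / (s / 2)))"
    by (intro has_bochner_integral_mult_right) auto
  moreover have "has_bochner_integral lborel (\<lambda>v. indicator {0..} v *\<^sub>R xi_kernel (s - 1/2) v) (xi_integral (s - 1/2))"
    using set_integrable_xi_kernel[of "s - 1/2"]
    by (simp add: has_bochner_integral_iff xi_integral_def set_integrable_def set_lebesgue_integral_def)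
  ultimately have 2: "has_bochner_integral lborel (\<lambda>v. indicator {0..} v *\<^sub>R xi_kernel (s - 1/2) v +
      1/2 * (indicator {0..} v *\<^sub>R exp (- ((s - 1) / 2 * of_real v)) - indicator {0..} v *\<^sub>R exp (- (s / 2 * of_real v))))
      (xi_integral (s - 1/2) + 1/2 * (1 / ((s - 1) / 2) - 1 / (s / 2)))"
    by (intro has_bochner_integral_add)
  have "(\<lambda>v. indicator {0..} v *\<^sub>R
     (exp (s * of_real v / 2) * of_real (omega (exp v)) + exp (s * of_real (- v) / 2) * of_real (omega (exp (- v))))) =
    (\<lambda>v. indicator {0..} v *\<^sub>R xi_kernel (s - 1/2) v +
      1/2 * (indicator {0..} v *\<^sub>R exp (- ((s - 1) / 2 * of_real v)) - indicator {0..} v *\<^sub>R exp (- (s / 2 * of_real v))))"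
  proof
    fix v :: real
    define E where "E = complex_of_real (omega (exp v))"
    define x where "x = complex_of_real v"
    have o: "complex_of_real (omega (exp (- v))) = exp (x / 2) * E + (exp (x / 2) - 1) / 2"
      unfolding omega_reflect E_def x_def using exp_of_real[of "v/2", where 'a = complex] by simp
    have k: "xi_kernel (s - 1/2) v = exp (s * x / 2) * E + exp (- (s * x / 2)) * exp (x / 2) * E"
      unfolding xi_kernel_def E_def[symmetric] x_def[symmetric]
      by (simp add: x_def[symmetric] distrib_left distrib_right mult.assoc[symmetric] exp_add[symmetric])
        (simp add: algebra_simps add_divide_distrib diff_divide_distrib)
    have e: "exp (- ((s - 1) / 2 * x)) = exp (- (s * x / 2)) * exp (x / 2)"
      by (simp add: exp_add[symmetric] algebra_simps diff_divide_distrib add_divide_distrib)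
    have "exp (s * x / 2) * E + exp (s * (- x) / 2) * (exp (x / 2) * E + (exp (x / 2) - 1) / 2) =
       xi_kernel (s - 1/2) v + 1/2 * (exp (- ((s - 1) / 2 * x)) - exp (- (s / 2 * x)))"
      unfolding k e by (simp add: algebra_simps diff_divide_distrib)
    then show "indicator {0..} v *\<^sub>R
     (exp (s * of_real v / 2) * of_real (omega (exp v)) + exp (s * of_real (- v) / 2) * of_real (omega (exp (- v)))) =
     indicator {0..} v *\<^sub>R xi_kernel (s - 1/2) v +
      1/2 * (indicator {0..} v *\<^sub>R exp (- ((s - 1) / 2 * of_real v)) - indicator {0..} v *\<^sub>R exp (- (s / 2 * of_real v)))"
      unfolding E_def[symmetric] o of_real_minus x_def[symmetric] by (cases "v \<ge> 0") auto
  qed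
  with 1 2 have "?D = xi_integral (s - 1/2) + 1/2 * (1 / ((s - 1) / 2) - 1 / (s / 2))"
    using has_bochner_integral_eq by (metis (no_types, lifting))
  also have "1/2 * (1 / ((s - 1) / 2) - 1 / (s / 2)) = 1 / (s * (s - 1))" using s by (simp add: field_simps)
  finally show ?thesis .
qed

text \<open>The factor \<open>s\<close> is absorbed by turning the Gamma value at s / 2 into the one
  at 1 + s / 2. With the entire function \<open>rGamma\<close>, the right-hand side makes sense for
  all \<open>s\<close> other than 1 and serves as the continuation.\<close>

lemma zeta_sums_Xi:
  assumes "Re s > 1"
  shows "(\<lambda>n. 1 / of_nat (Suc n) powr s) sums (Xi (s - 1/2) * of_real pi powr (s / 2) * rGamma (1 + s / 2) / (2 * (s - 1)))"
proof -
  have s: "s \<noteq> 0" "s \<noteq> 1" using assms by auto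
  define D where "D = (\<Sum>n. 1 / of_nat (Suc n) powr s)"
  have "(s - 1/2)\<^sup>2 - 1/4 = s * (s - 1)" by (simp add: power2_eq_square algebra_simps)
  then have "Xi (s - 1/2) = s * (s - 1) * (xi_integral (s - 1/2) + 1 / (s * (s - 1)))"
    using s unfolding Xi_def distrib_left by simp
  also have "\<dots> = s * (s - 1) * (Gamma (s / 2) * of_real pi powr (- s / 2) * D)"
    unfolding D_def zeta_xi_integral[OF assms] ..
  finally have X: "Xi (s - 1/2) = s * (s - 1) * (Gamma (s / 2) * of_real pi powr (- s / 2) * D)" .
  have p: "of_real pi powr (- s / 2) * of_real pi powr (s / 2) = (1::complex)"
    by (simp add: powr_add[symmetric])
  have "s / 2 \<notin> \<int>\<^sub>\<le>\<^sub>0"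
  proof
    assume "s / 2 \<in> \<int>\<^sub>\<le>\<^sub>0"
    then obtain n where "s / 2 = - of_nat n" by (elim nonpos_Ints_cases')
    then have "Re (s / 2) = - real n" by simp
    then show False using assms by simp
  qed
  then have g: "Gamma (s / 2) * (s / 2 * rGamma (1 + s / 2)) = 1"
    using rGamma_plus1[of "s / 2"] by (simp add: Gamma_def add.commute rGamma_eq_zero_iff)
  have "Xi (s - 1/2) * of_real pi powr (s / 2) * rGamma (1 + s / 2) / (2 * (s - 1)) =
     (Gamma (s / 2) * (s / 2 * rGamma (1 + s / 2))) * (of_real pi powr (- s / 2) * of_real pi powr (s / 2)) * D"
    unfolding X using s by (simp add: field_simps)
  then show ?thesis unfolding g p D_def
    using summable_norm_cancel[OF summable_norm_zeta[OF assms]] by (simp add: summable_sums)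
qed

section \<open>Analytic continuation of zeta\<close>

lemma riemann_zeta_unique:
  assumes f: "f holomorphic_on - {1}" "\<And>s. Re s > 1 \<Longrightarrow> (\<lambda>n. 1 / of_nat (Suc n) powr s) sums f s" "f 1 = 0"
  shows "riemann_zeta = f"
  unfolding riemann_zeta_def
proof (rule the_equality)
  fix g assume g: "g holomorphic_on - {1} \<and> (\<forall>s. Re s > 1 \<longrightarrow> (\<lambda>n. 1 / of_nat (Suc n) powr s) sums g s) \<and> g 1 = 0"
  show "g = f"
  proof
    fix s
    show "g s = f s"
    proof (cases "s = 1")
      case False
      show ?thesis
      proof (rule analytic_continuation_open[where s = "{s. Re s > 1}" and s' = "- {1}" and f = g and g = f])
        show "open {s. Re s > 1}" by (rule open_halfspace_Re_gt)
        show "{s. Re s > 1} \<noteq> {}" by (auto intro!: exI[of _ 2])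
        show "connected (- {1::complex})" by (rule connected_punctured_universe) simp
        show "g z = f z" if "z \<in> {s. Re s > 1}" for z using f(2) g that sums_unique2 by blast
      qed (use f g False in auto)
    qed (use f g in auto)
  qed
qed (use f in auto)

lemma riemann_zeta_eq:
  assumes "s \<noteq> 1"
  shows "riemann_zeta s = Xi (s - 1/2) * of_real pi powr (s / 2) * rGamma (1 + s / 2) / (2 * (s - 1))"
proof -
  let ?f = "\<lambda>s. if s = 1 then 0 else Xi (s - 1/2) * of_real pi powr (s / 2) * rGamma (1 + s / 2) / (2 * (s - 1))"
  have "(\<lambda>s. Xi (s - 1/2)) holomorphic_on - {1}"
  proof -
    have "(\<lambda>s. s - 1/2) holomorphic_on (- {1} :: complex set)" by (intro holomorphic_intros)
    from holomorphic_on_compose_gen[OF this Xi_holomorphic] show ?thesis by (simp add: o_def)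
  qed
  then have "(\<lambda>s. Xi (s - 1/2) * of_real pi powr (s / 2) * rGamma (1 + s / 2) / (2 * (s - 1))) holomorphic_on - {1}"
    by (intro holomorphic_intros) auto
  then have "?f holomorphic_on - {1}"
    by (rule holomorphic_transform) auto
  then have eq: "riemann_zeta = ?f"
    by (rule riemann_zeta_unique) (use zeta_sums_Xi in auto)
  show ?thesis unfolding eq using assms by simp
qed

lemma riemann_zeta_sums:
  assumes "Re s > 1" shows "(\<lambda>n. 1 / of_nat (Suc n) powr s) sums riemann_zeta s"
  using zeta_sums_Xi[OF assms] riemann_zeta_eq[of s] assms by fastforce

section \<open>Zeros of Xi\<close>

text \<open>
  Sieving: removing the multiples of a prime \<open>p\<close> multiplies the Dirichlet series by \<open>1 - p powr (- s)\<close>.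
  If the zeta value were 0, all sieved series would be 0, although they tend to 1.
\<close>

lemma zeta_nonzero:
  assumes s: "Re s > 1"
  shows "riemann_zeta s \<noteq> 0"
proof
  assume z0: "riemann_zeta s = 0"
  define f where "f = (\<lambda>n::nat. 1 / of_nat n powr s)"
  \<comment> \<open>At index 0 both \<open>powr\<close> and division take the default value 0, so
    sums over all naturals agree with the Dirichlet series.\<close>
  have f0: "f 0 = 0" and f1: "f 1 = 1" by (auto simp: f_def)
  have fmult: "f (m * n) = f m * f n" for m n
    by (simp add: f_def powr_times_real)
  have fsum: "summable (\<lambda>n. norm (f n))"
    using summable_norm_zeta[OF s] by (subst summable_Suc_iff[symmetric]) (simp add: f_def)
  have abs: "(\<lambda>n. norm (f n)) summable_on A" for A
  proof -
    have "(\<lambda>n. norm (f n)) summable_on UNIV"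
      using norm_summable_imp_summable_on[of "\<lambda>n. norm (f n)"] fsum by simp
    then show ?thesis by (rule summable_on_subset_banach) simp
  qed
  have sum: "f summable_on A" for A using abs abs_summable_summable by blast
  define S where "S = (\<lambda>N. {n::nat. n \<ge> 1 \<and> (\<forall>p\<le>N. prime p \<longrightarrow> \<not> p dvd n)})"
  define T where "T = (\<lambda>N. infsum f (S N))"
  have T0: "T 0 = 0"
  proof -
    have "S 0 = {1..}" by (auto simp: S_def)
    then have "T 0 = infsum f ({1..})" by (simp add: T_def)
    also have "\<dots> = infsum f UNIV" by (rule infsum_cong_neutral) (auto simp: f0 not_le less_Suc_eq)
    also have "\<dots> = 0"
    proof -
      have "(f has_sum infsum f UNIV) UNIV" using sum by (rule has_sum_infsum)
      then have "f sums infsum f UNIV" by (rule has_sum_imp_sums)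
      moreover have "(\<lambda>n. f (Suc n)) sums 0" using riemann_zeta_sums[OF s] z0 by (simp add: f_def)
      then have "f sums (0 + f 0)" by (simp add: sums_Suc_iff)
      ultimately show ?thesis using f0 sums_unique2 by fastforce
    qed
    finally show ?thesis .
  qed
  have TN: "T N = 0" for N
  proof (induction N)
    case (Suc N)
    show ?case
    proof (cases "prime (Suc N)")
      case False
      then have "S (Suc N) = S N" by (auto simp: S_def le_Suc_eq)
      with Suc show ?thesis by (simp add: T_def)
    next
      case True
      let ?p = "Suc N"
      \<comment> \<open>Numbers without prime factors up to \<open>N\<close> either avoid the prime
        \<open>?p\<close> or are \<open>?p\<close> times such a number. By multiplicativity,
        \<open>T ?p\<close> is \<open>T N\<close> times 1 - f ?p.\<close>
      have "S N = S ?p \<union> (*) ?p ` S N"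
      proof (intro equalityI subsetI)
        fix n assume n: "n \<in> S N"
        show "n \<in> S ?p \<union> (*) ?p ` S N"
        proof (cases "?p dvd n")
          case True
          then obtain m where m: "n = ?p * m" by blast
          have "m \<in> S N" using n unfolding m S_def by (cases "m = 0") (auto simp: dvd_mult)
          with m show ?thesis by blast
        qed (use n in \<open>auto simp: S_def le_Suc_eq\<close>)
      next
        fix n assume "n \<in> S ?p \<union> (*) ?p ` S N"
        then show "n \<in> S N"
        proof
          assume "n \<in> (*) ?p ` S N"
          then obtain m where m: "n = ?p * m" "m \<in> S N" by blast
          have "\<not> q dvd n" if q: "q \<le> N" "prime q" for q
          proof
            assume "q dvd n"
            then have "q dvd ?p \<or> q dvd m" using q(2) unfolding m(1) by (simp only: prime_dvd_mult_iff)
            moreover have "\<not> q dvd ?p" using primes_dvd_imp_eq[OF q(2) True] q(1) by auto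
            ultimately show False using m(2) q by (auto simp: S_def)
          qed
          then show "n \<in> S N" using m by (auto simp: S_def)
        qed (auto simp: S_def)
      qed
      then have "T N = infsum f (S ?p \<union> (*) ?p ` S N)" by (simp add: T_def)
      also have "\<dots> = T ?p + infsum f ((*) ?p ` S N)"
        unfolding T_def
      proof (rule infsum_Un_disjoint)
        have nd: "\<not> ?p dvd n" if "n \<in> S ?p" for n using that True unfolding S_def by blast
        show "S ?p \<inter> (*) ?p ` S N = {}"
        proof (rule equals0I)
          fix n assume "n \<in> S ?p \<inter> (*) ?p ` S N"
          then obtain m where "n = ?p * m" "n \<in> S ?p" by (elim IntE imageE)
          then show False using nd[of n] by (simp only: dvd_triv_left)
        qed
      qed (rule sum)+
      also have "infsum f ((*) ?p ` S N) = infsum (\<lambda>n. f ?p * f n) (S N)"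
      proof -
        have "inj_on ((*) ?p) (S N)" by (rule inj_onI) (simp del: mult_Suc)
        then have "infsum f ((*) ?p ` S N) = infsum (f \<circ> (*) ?p) (S N)" by (rule infsum_reindex)
        then show ?thesis by (simp only: o_def fmult)
      qed
      also have "\<dots> = f ?p * T N" by (simp add: infsum_cmult_right' T_def)
      finally show ?thesis using Suc by simp
    qed
  qed (fact T0)
  \<comment> \<open>Every element of \<open>S N\<close> other than 1 has a prime factor above
    \<open>N\<close>, hence exceeds \<open>N\<close> itself; what is left is a tail of an absolutely
    convergent series.\<close>
  have tail: "norm (T N - 1) \<le> (\<Sum>n. norm (f (n + Suc N)))" if "N \<ge> 1" for N
  proof -
    have "S N = {1} \<union> (S N - {1})" by (auto simp: S_def)
    then have "T N = infsum f ({1} \<union> (S N - {1}))" by (simp add: T_def)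
    also have "\<dots> = 1 + infsum f (S N - {1})"
      by (subst infsum_Un_disjoint) (auto simp: sum f1[simplified] intro: sum)
    finally have "norm (T N - 1) = norm (infsum f (S N - {1}))" by simp
    also have "\<dots> \<le> infsum (\<lambda>n. norm (f n)) (S N - {1})" by (rule norm_infsum_bound[OF abs])
    also have "\<dots> \<le> infsum (\<lambda>n. norm (f n)) {Suc N..}"
    proof (rule infsum_mono2[OF abs abs])
      show "S N - {1} \<subseteq> {Suc N..}"
      proof
        fix n assume n: "n \<in> S N - {1}"
        then obtain p where p: "prime p" "p dvd n" using prime_factor_nat[of n] by auto
        have "\<not> p \<le> N" "n \<ge> 1" using n p by (auto simp: S_def)
        moreover from this have "p \<le> n" using p(2) by (intro dvd_imp_le) auto
        ultimately show "n \<in> {Suc N..}" by simp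
      qed
    qed auto
    also have "\<dots> = (\<Sum>n. norm (f (n + Suc N)))"
    proof -
      have "n \<in> (\<lambda>n. n + Suc N) ` UNIV" if "n \<in> {Suc N..}" for n
        by (rule image_eqI[of _ _ "n - Suc N"]) (use that in auto)
      then have img: "{Suc N..} = (\<lambda>n. n + Suc N) ` UNIV" by auto
      have "inj (\<lambda>n. n + Suc N)" by (simp add: inj_on_def)
      then have "infsum (\<lambda>n. norm (f n)) {Suc N..} = infsum ((\<lambda>n. norm (f n)) \<circ> (\<lambda>n. n + Suc N)) UNIV"
        unfolding img by (rule infsum_reindex)
      also have "\<dots> = infsum (\<lambda>n. norm (f (n + Suc N))) UNIV" by (simp only: o_def)
      also have "\<dots> = (\<Sum>n. norm (f (n + Suc N)))"
      proof -
        have "summable (\<lambda>n. norm (f (n + Suc N)))" using fsum by (subst summable_iff_shift)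
        then have "(\<lambda>n. norm (f (n + Suc N))) summable_on UNIV"
          using norm_summable_imp_summable_on[of "\<lambda>n. norm (f (n + Suc N))"] by simp
        from has_sum_imp_sums[OF has_sum_infsum[OF this]] show ?thesis by (rule sums_unique)
      qed
      finally show ?thesis .
    qed
    finally show ?thesis .
  qed
  obtain N where N: "\<And>n. n \<ge> N \<Longrightarrow> norm (\<Sum>i. norm (f (i + n))) < 1"
    using suminf_exist_split[of 1, OF _ fsum] by auto
  have "norm (T (Suc N) - 1) \<le> (\<Sum>n. norm (f (n + Suc (Suc N))))" by (rule tail) simp
  also have "\<dots> < 1" using N[of "Suc (Suc N)"] by simp
  finally show False by (simp add: TN)
qed

lemma rGamma_nonzero_upper: "Im s \<noteq> 0 \<Longrightarrow> rGamma (1 + s / 2) \<noteq> 0"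
proof
  assume "Im s \<noteq> 0" "rGamma (1 + s / 2) = 0"
  then obtain n where "1 + s / 2 = - of_nat n" by (auto simp: rGamma_eq_zero_iff elim!: nonpos_Ints_cases')
  then have "Im (1 + s / 2) = 0" by simp
  with \<open>Im s \<noteq> 0\<close> show False by simp
qed

text \<open>By evenness a zero outside the strip could be moved to the right of it, where it would
  be a zero of the convergent Dirichlet series.\<close>

lemma Xi_zero_Re:
  assumes "Xi w = 0" shows "\<bar>Re w\<bar> \<le> 1/2"
proof (rule ccontr)
  assume neg: "\<not> ?thesis"
  define u where "u = (if Re w > 0 then w else - w)"
  have u: "Xi u = 0" "Re u > 1/2" using assms neg by (auto simp: u_def Xi_minus)
  have "u + 1/2 \<noteq> 1"
  proof
    assume "u + 1/2 = 1"
    then have "Re (u + 1/2) = 1" by simp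
    with u(2) show False by simp
  qed
  then have "riemann_zeta (u + 1/2) = 0" using u(1) by (simp add: riemann_zeta_eq)
  moreover have "riemann_zeta (u + 1/2) \<noteq> 0" by (rule zeta_nonzero) (use u in simp)
  ultimately show False by simp
qed

section \<open>Even entire functions of slow growth\<close>

lemma holomorphic_divide_zero:
  assumes "f holomorphic_on UNIV" "f a = 0"
  obtains g where "g holomorphic_on UNIV" "\<And>z. f z = (z - a) * g z"
proof
  show "(\<lambda>z. if z = a then deriv f a else (f z - f a) / (z - a)) holomorphic_on UNIV"
    by (rule pole_lemma) (use assms in auto)
  show "\<And>z. f z = (z - a) * (if z = a then deriv f a else (f z - f a) / (z - a))"
    using assms by auto
qed

lemma holomorphic_reflect:
  assumes "g holomorphic_on S" "\<And>z. z \<in> S \<Longrightarrow> - z \<in> S"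
  shows "(\<lambda>z. g (- z)) holomorphic_on S"
  using holomorphic_on_compose_gen[OF holomorphic_on_minus[OF holomorphic_on_ident] assms(1), of S] assms(2)
  by (auto simp: o_def)

text \<open>Removing \<open>a\<close> and \<open>- a\<close> together keeps the quotient even, and
  normalising the factor to 1 at the origin keeps the value there. Evenness of the quotient is clear
  away from these two points and extends by the identity theorem.\<close>

lemma even_entire_divide_zero:
  fixes f :: "complex \<Rightarrow> complex"
  assumes hol: "f holomorphic_on UNIV" and even: "\<And>z. f (- z) = f z" and a: "f a = 0" "a \<noteq> 0"
  obtains g where "g holomorphic_on UNIV" "\<And>z. g (- z) = g z" "\<And>z. f z = (1 - z\<^sup>2 / a\<^sup>2) * g z"
proof -
  obtain g1 where g1: "g1 holomorphic_on UNIV" "\<And>z. f z = (z - a) * g1 z"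
    using holomorphic_divide_zero[OF hol a(1)] by blast
  have "g1 (- a) = 0" using g1(2)[of "-a"] even[of a] a by auto
  then obtain g2 where g2: "g2 holomorphic_on UNIV" "\<And>z. g1 z = (z + a) * g2 z"
    using holomorphic_divide_zero[OF g1(1)] by (metis diff_minus_eq_add)
  define g where "g = (\<lambda>z. - (a\<^sup>2) * g2 z)"
  have g: "g holomorphic_on UNIV" unfolding g_def by (intro holomorphic_intros g2)
  have fg: "f z = (1 - z\<^sup>2 / a\<^sup>2) * g z" for z
  proof -
    have "f z = (z\<^sup>2 - a\<^sup>2) * g2 z" using g1(2)[of z] g2(2)[of z] by (simp add: algebra_simps power2_eq_square)
    also have "\<dots> = (1 - z\<^sup>2 / a\<^sup>2) * g z" using a(2) by (simp add: g_def field_simps)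
    finally show ?thesis .
  qed
  have "g (- z) = g z" for z
  proof (rule analytic_continuation_open[where s = "- {a, - a}" and s' = UNIV and f = "\<lambda>z. g (- z)" and g = g])
    show "- {a, - a} \<noteq> {}"
      by (metis Compl_empty_eq boolean_algebra_class.boolean_algebra.double_compl finite.emptyI finite.insertI infinite_UNIV_char_0)
    show "(\<lambda>z. g (- z)) holomorphic_on UNIV"
      by (rule holomorphic_reflect[OF g]) auto
    fix z assume z: "z \<in> - {a, - a}"
    then have "z\<^sup>2 \<noteq> a\<^sup>2" by (auto simp: power2_eq_iff)
    then show "g (- z) = g z" using fg[of z] fg[of "- z"] even[of z] a(2) by simp
  qed (use g in auto)
  with g fg that show ?thesis by blast
qed

lemma max_modulus_cball:
  assumes "f holomorphic_on UNIV" "r > 0" "\<And>z. norm z = r \<Longrightarrow> norm (f z) \<le> B" "norm w \<le> r"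
  shows "norm (f w) \<le> B"
proof (rule maximum_modulus_frontier[of f "cball 0 r"])
  show "continuous_on (closure (cball 0 r)) f"
    using assms(1) holomorphic_on_imp_continuous_on holomorphic_on_subset by blast
qed (use assms in \<open>auto intro: holomorphic_on_subset\<close>)

text \<open>
  A maximal family of extracted zeros exists without any count of multiplicities: each factor
  \<open>1 - z\<^sup>2 / u\<close> has norm at least 8 on the circle of radius \<open>3 * R\<close>, so by the maximum principle every
  extraction shrinks the bound for the value at 0, which stays equal to \<open>f 0\<close>.
\<close>

lemma even_entire_extract_zeros:
  fixes f :: "complex \<Rightarrow> complex"
  assumes hol: "f holomorphic_on UNIV" and even: "\<And>z. f (- z) = f z" and f0: "f 0 \<noteq> 0"
    and R: "R > 0" and bound: "\<And>z. norm z = 3 * R \<Longrightarrow> norm (f z) \<le> B"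
  obtains M g where "\<And>u. u \<in># M \<Longrightarrow> \<exists>z. u = z\<^sup>2 \<and> f z = 0"
    and "\<And>z. f z = 0 \<Longrightarrow> norm z \<le> R \<Longrightarrow> z\<^sup>2 \<in># M"
    and "g holomorphic_on UNIV" "\<And>z. f z = (\<Prod>u\<in>#M. 1 - z\<^sup>2 / u) * g z"
    and "\<And>z. norm z \<le> R \<Longrightarrow> g z \<noteq> 0" "\<And>z. norm z \<le> R \<Longrightarrow> norm (g z) \<le> B"
proof -
  define E where "E = (\<lambda>M g. (\<forall>u. u \<in># M \<longrightarrow> (\<exists>z. z \<noteq> 0 \<and> u = z\<^sup>2 \<and> norm z \<le> R \<and> f z = 0)) \<and>
    g holomorphic_on UNIV \<and> (\<forall>z. g (- z) = g z) \<and> (\<forall>z. f z = (\<Prod>u\<in>#M. 1 - z\<^sup>2 / u) * g z))"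
  have gb: "norm (g z) \<le> B / 8 ^ size M" if E: "E M g" and z: "norm z \<le> 3 * R" for M g z
  proof (rule max_modulus_cball[OF _ _ _ z])
    show "g holomorphic_on UNIV" "3 * R > 0" using E R by (auto simp: E_def)
    fix w assume w: "norm (w::complex) = 3 * R"
    have "8 ^ size N \<le> norm (\<Prod>u\<in>#N. 1 - w\<^sup>2 / u)" if "N \<subseteq># M" for N
      using that
    proof (induction N)
      case (add u N)
      then have "u \<in># M" "N \<subseteq># M"
        by (meson insert_subset_eq_iff, meson mset_subset_eq_insertD subset_mset.less_imp_le)
      note IH = add.IH[OF this(2)]
      from \<open>u \<in># M\<close> obtain z where z: "z \<noteq> 0" "u = z\<^sup>2" "norm z \<le> R" using E by (auto simp: E_def)
      have "9 \<le> norm (w\<^sup>2 / u)"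
      proof -
        have "norm z ^ 2 \<le> R ^ 2" using z by (intro power_mono) auto
        then show ?thesis using z w by (simp add: norm_divide norm_power field_simps)
      qed
      then have "8 \<le> norm (1 - w\<^sup>2 / u)" using norm_triangle_ineq2[of "w\<^sup>2 / u" 1] by (simp add: norm_minus_commute)
      then have "8 * 8 ^ size N \<le> norm (1 - w\<^sup>2 / u) * norm (\<Prod>u\<in>#N. 1 - w\<^sup>2 / u)"
        using IH by (intro mult_mono) auto
      then show ?case by (simp add: norm_mult)
    qed simp
    from this[of M] have "8 ^ size M * norm (g w) \<le> norm (\<Prod>u\<in>#M. 1 - w\<^sup>2 / u) * norm (g w)"
      by (intro mult_right_mono) auto
    also have "\<dots> = norm (f w)" using E by (simp add: E_def norm_mult)
    also have "\<dots> \<le> B" using bound w by simp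
    finally show "norm (g w) \<le> B / 8 ^ size M" by (simp add: field_simps)
  qed
  have B: "B > 0"
  proof -
    have "E {#} f" using hol even by (simp add: E_def)
    from gb[OF this, of 0] R f0 show ?thesis by (simp add: order.strict_trans2[of 0 "norm (f 0)"])
  qed
  have prod0: "(\<Prod>u\<in>#M. 1 - 0\<^sup>2 / u) = (1::complex)" for M by (induction M) auto
  obtain n where n: "B / norm (f 0) < 8 ^ n" using real_arch_pow[of 8 "B / norm (f 0)"] by auto
  have size: "size M < n" if "E M g" for M g
  proof -
    have "g 0 = f 0" using that prod0[of M] unfolding E_def by (metis mult_1)
    then have "norm (f 0) \<le> B / 8 ^ size M" using gb[OF that, of 0] R by simp
    then have "8 ^ size M \<le> B / norm (f 0)" using f0 by (simp add: field_simps)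
    then have "(8::real) ^ size M < 8 ^ n" using n by linarith
    then show ?thesis by (simp add: power_strict_increasing_iff)
  qed
  have "\<exists>M. (\<exists>g. E M g) \<and> (\<forall>N. (\<exists>g. E N g) \<longrightarrow> size N \<le> size M)"
    by (rule ex_has_greatest_nat[of _ "{#}" _ n]) (use size hol even in \<open>auto simp: E_def intro: less_imp_le\<close>)
  then obtain M g where E: "E M g" and max: "\<And>N g. E N g \<Longrightarrow> size N \<le> size M" by blast
  have nz: "g z \<noteq> 0" if z: "norm z \<le> R" for z
  proof
    assume gz: "g z = 0"
    have "g 0 = f 0" using E prod0[of M] unfolding E_def by (metis mult_1)
    with gz f0 have z0: "z \<noteq> 0" by auto
    obtain h where h: "h holomorphic_on UNIV" "\<And>z. h (- z) = h z" "\<And>w. g w = (1 - w\<^sup>2 / z\<^sup>2) * h w"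
      using even_entire_divide_zero[of g z] E gz z0 by (auto simp: E_def)
    have "E (add_mset (z\<^sup>2) M) h"
      using E h z0 z gz unfolding E_def by (auto simp: mult_ac) 
    from max[OF this] show False by simp
  qed
  show ?thesis
  proof (rule that[of M g])
    show "z\<^sup>2 \<in># M" if "f z = 0" "norm z \<le> R" for z
    proof -
      have "(\<Prod>u\<in>#M. 1 - z\<^sup>2 / u) = 0" using E nz[of z] that by (auto simp: E_def)
      then show ?thesis by (auto simp: prod_mset_zero_iff)
    qed
    show "norm (g z) \<le> B" if "norm z \<le> R" for z
    proof -
      have "norm (g z) \<le> B / 8 ^ size M" using gb[OF E] that R by auto
      also have "\<dots> \<le> B / 1" using B by (intro divide_left_mono) auto
      finally show ?thesis by simp
    qed
    show "\<exists>z. u = z\<^sup>2 \<and> f z = 0" if "u \<in># M" for u using E that unfolding E_def by blast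
    show "g holomorphic_on UNIV" "f z = (\<Prod>u\<in>#M. 1 - z\<^sup>2 / u) * g z" for z
      using E unfolding E_def by blast+
  qed (use nz in auto)
qed

text \<open>
  Evenness improves the usual bound by a factor \<open>norm z / R\<close>. This is what makes growth
  \<open>exp (o(r\<^sup>2))\<close> sufficient in the product approximation below.
\<close>

lemma Borel_Caratheodory_even:
  fixes L :: "complex \<Rightarrow> complex"
  assumes hol: "L holomorphic_on ball 0 R" and even: "\<And>z. norm z < R \<Longrightarrow> L (- z) = L z"
    and L0: "L 0 = 0" and A: "\<And>z. norm z < R \<Longrightarrow> Re (L z) < A" and R: "R > 0" and z: "norm z \<le> R / 2"
  shows "norm (L z) \<le> 8 * A * (norm z)\<^sup>2 / R\<^sup>2"
proof -
  have A0: "A > 0" using A[of 0] L0 R by simp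
  \<comment> \<open>The map l / (2 A - l) sends the half-plane Re l < A into the unit disc and fixes
    0.\<close>
  define p where "p = (\<lambda>z. L (of_real R * z) / (2 * of_real A - L (of_real R * z)))"
  have dom: "norm (of_real R * z) < R" if "norm z < 1" for z :: complex
    using that R by (simp add: norm_mult)
  have den: "2 * of_real A - L (of_real R * z) \<noteq> 0" if "norm z < 1" for z
    using A[OF dom[OF that]] A0 by (auto simp: complex_eq_iff)
  have "(\<lambda>z. L (of_real R * z)) holomorphic_on ball 0 1"
  proof -
    have "(\<lambda>z. of_real R * z) holomorphic_on ball 0 1" by (intro holomorphic_intros)
    moreover have "(*) (of_real R) ` ball 0 1 \<subseteq> ball (0::complex) R" using dom by auto
    ultimately show ?thesis using holomorphic_on_compose_gen[OF _ hol] by (auto simp: o_def)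
  qed
  then have holp: "p holomorphic_on ball 0 1"
    unfolding p_def by (intro holomorphic_intros) (use den in auto)
  have p0: "p 0 = 0" by (simp add: p_def L0)
  have p1: "norm (p z) < 1" if "norm z < 1" for z
  proof -
    let ?l = "L (of_real R * z)"
    have "(norm (2 * of_real A - ?l))\<^sup>2 - (norm ?l)\<^sup>2 = 4 * A * (A - Re ?l)"
      unfolding cmod_power2 by (simp add: power2_eq_square algebra_simps)
    also have "\<dots> > 0" using A0 A[OF dom[OF that]] by simp
    finally have "norm ?l < norm (2 * of_real A - ?l)" by (simp add: power2_less_imp_less)
    then show ?thesis using den[OF that] by (simp add: p_def norm_divide)
  qed
  have p2: "norm (p z) \<le> norm z" if "norm z < 1" for z
    by (rule Schwarz_Lemma(1)[OF holp p0 p1 that])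
  obtain h where holh: "h holomorphic_on ball 0 1" and ph: "\<And>z. norm z < 1 \<Longrightarrow> p z = z * h z"
    using Schwarz3[OF holp p0] by metis
  \<comment> \<open>The even function \<open>p\<close> vanishes at 0, so its quotient by z is odd
    and vanishes there as well. Schwarz's lemma thus applies a second time, which is the source of
    the additional factor norm z / R.\<close>
  have odd: "h (- z) = - h z" if "norm z < 1" "z \<noteq> 0" for z
  proof -
    have "p (- z) = p z" using even[OF dom[OF that(1)]] by (simp add: p_def)
    then have "z * (- h (- z)) = z * h z" using ph[of z] ph[of "-z"] that by simp
    then have "- h (- z) = h z" using that(2) by (simp only: mult_cancel_left simp_thms)
    then show ?thesis by (simp add: minus_equation_iff)
  qed
  have h0: "h 0 = 0"
  proof -
    have c: "isCont h 0"
      using holomorphic_on_imp_continuous_on[OF holh] by (simp add: continuous_on_eq_continuous_at)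
    have "((\<lambda>z. h (- z) + h z) \<longlongrightarrow> h (- 0) + h 0) (at 0)"
      using c by (intro tendsto_intros isCont_tendsto_compose[of "- 0" h]) (auto simp: isCont_def)
    moreover have "((\<lambda>z. h (- z) + h z) \<longlongrightarrow> 0) (at 0)"
    proof (rule tendsto_eventually)
      show "\<forall>\<^sub>F z in at 0. h (- z) + h z = 0"
        unfolding eventually_at using odd by (intro exI[of _ 1]) auto
    qed
    ultimately have "h (- 0) + h 0 = 0" by (rule tendsto_unique[rotated]) simp
    then show ?thesis by simp
  qed
  have h2: "norm (h z) \<le> 2 * norm z" if "norm z < 1" for z
  proof -
    \<comment> \<open>The first application gives only norm (h w) <= 1, whereas Schwarz's lemma asks
      for a strict bound; halving provides it.\<close>
    have "norm (h z / 2) \<le> norm z"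
    proof (rule Schwarz_Lemma(1)[OF _ _ _ that])
      show "(\<lambda>z. h z / 2) holomorphic_on ball 0 1" by (intro holomorphic_intros holh) auto
      fix w :: complex assume w: "norm w < 1"
      show "norm (h w / 2) < 1"
        using p2[OF w] ph[OF w] h0 by (cases "w = 0") (auto simp: norm_mult norm_divide)
    qed (simp add: h0)
    then show ?thesis by (simp add: norm_divide)
  qed
  define u where "u = z / of_real R"
  have u: "norm u \<le> 1 / 2" "of_real R * u = z" using z R by (auto simp: u_def norm_divide field_simps)
  have pu: "norm (p u) \<le> 2 * (norm u)\<^sup>2"
    using ph[of u] mult_left_mono[OF h2[of u], of "norm u"] u by (simp add: norm_mult power2_eq_square)
  also have "\<dots> \<le> 2 * (1/2)\<^sup>2" using u by (intro mult_left_mono power_mono) auto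
  finally have pu2: "norm (p u) \<le> 1 / 2" by (simp add: power2_eq_square)
  have "p u * (2 * of_real A - L z) = L z" using den[of u] u by (simp add: p_def)
  then have "L z * (1 + p u) = 2 * of_real A * p u" by (simp add: algebra_simps)
  then have "norm (L z) * norm (1 + p u) = 2 * A * norm (p u)" using A0
    by (metis norm_mult norm_numeral norm_of_real abs_of_pos)
  moreover have "norm (1 + p u) \<ge> 1 / 2" using norm_triangle_ineq2[of 1 "- p u"] pu2 by simp
  then have "norm (L z) * (1 / 2) \<le> norm (L z) * norm (1 + p u)" by (intro mult_left_mono) auto
  ultimately have "norm (L z) \<le> 4 * A * norm (p u)" by simp
  also have "\<dots> \<le> 4 * A * (2 * (norm u)\<^sup>2)" using pu A0 by (intro mult_left_mono) auto
  also have "\<dots> = 8 * A * (norm z)\<^sup>2 / R\<^sup>2" using R by (simp add: u_def norm_divide power_divide)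
  finally show ?thesis .
qed

text \<open>A substitute for Hadamard's factorisation. Once the zeros in a disc of large radius R
  are divided out, the logarithm of the remaining factor, normalised at 0, has real part below 9 e
  R^2 + c. The even Borel-Caratheodory bound turns this into O(e K^2 + K^2 / R^2) for norm z <=
  K.\<close>

lemma even_entire_product_approx:
  fixes f :: "complex \<Rightarrow> complex"
  assumes hol: "f holomorphic_on UNIV" and even: "\<And>z. f (- z) = f z" and f0: "f 0 \<noteq> 0"
    and growth: "\<And>e. e > 0 \<Longrightarrow> \<exists>r. \<forall>z. norm z \<ge> r \<longrightarrow> norm (f z) \<le> exp (e * (norm z)\<^sup>2)"
    and d: "d > 0"
  obtains M where "\<And>u. u \<in># M \<Longrightarrow> \<exists>z. u = z\<^sup>2 \<and> f z = 0"
    and "\<And>z. f z = 0 \<Longrightarrow> norm z \<le> K \<Longrightarrow> z\<^sup>2 \<in># M"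
    and "\<And>z. norm z \<le> K \<Longrightarrow> norm (f z) \<le> exp d * (norm (f 0) * norm (\<Prod>u\<in>#M. 1 - z\<^sup>2 / u))"
    and "\<And>z. norm z \<le> K \<Longrightarrow> norm (f 0) * norm (\<Prod>u\<in>#M. 1 - z\<^sup>2 / u) \<le> exp d * norm (f z)"
proof -
  define C where "C = K\<^sup>2 + 1"
  have C: "C > 0" by (simp add: C_def add_nonneg_pos)
  \<comment> \<open>The factor 8 of the Borel-Caratheodory bound and the 9 from the circle of radius
    3 * R give an error 72 * e * C = d / 2. The other half of \<open>d\<close> is reserved for the
    constant \<open>c\<close>, which a large R makes small.\<close>
  define e where "e = d / (144 * C)"
  have e: "e > 0" using d C by (simp add: e_def)
  obtain r where r: "\<And>z. norm z \<ge> r \<Longrightarrow> norm (f z) \<le> exp (e * (norm z)\<^sup>2)" using growth[OF e] by blast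
  \<comment> \<open>The summand 1 makes the upper bound for the real part of \<open>L\<close>
    strict.\<close>
  define c where "c = 1 - ln (norm (f 0))"
  have "\<forall>\<^sub>F R in at_top. 8 * \<bar>c\<bar> * C / R\<^sup>2 < d / 2"
  proof -
    have "((\<lambda>R. 8 * \<bar>c\<bar> * C / R\<^sup>2) \<longlongrightarrow> 0) at_top"
      by (intro tendsto_divide_0[OF tendsto_const] filterlim_at_top_imp_at_infinity filterlim_pow_at_top filterlim_ident) auto
    from order_tendstoD(2)[OF this, of "d/2"] d show ?thesis by simp
  qed
  then obtain R where R: "8 * \<bar>c\<bar> * C / R\<^sup>2 < d / 2" "R \<ge> max (max r (2 * \<bar>K\<bar>)) 1"
    using eventually_conj[OF _ eventually_ge_at_top[of "max (max r (2 * \<bar>K\<bar>)) 1"]]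
      eventually_happens'[OF trivial_limit_at_top_linorder] by blast
  then have R0: "R > 0" and Kr: "K \<le> R / 2" "r \<le> 3 * R" by auto
  define B where "B = exp (e * (3 * R)\<^sup>2)"
  have bound: "norm (f z) \<le> B" if "norm z = 3 * R" for z
    using r[of z] that Kr by (simp add: B_def)
  obtain M g where M: "\<And>u. u \<in># M \<Longrightarrow> \<exists>z. u = z\<^sup>2 \<and> f z = 0"
    "\<And>z. f z = 0 \<Longrightarrow> norm z \<le> R \<Longrightarrow> z\<^sup>2 \<in># M"
    and g: "g holomorphic_on UNIV" and fg: "\<And>z. f z = (\<Prod>u\<in>#M. 1 - z\<^sup>2 / u) * g z"
    and gnz: "\<And>z. norm z \<le> R \<Longrightarrow> g z \<noteq> 0" and gB: "\<And>z. norm z \<le> R \<Longrightarrow> norm (g z) \<le> B"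
    using even_entire_extract_zeros[OF hol even f0 R0 bound] by blast
  have g0: "g 0 = f 0"
  proof -
    have "(\<Prod>u\<in>#M. 1 - 0\<^sup>2 / u) = (1::complex)" by (induction M) auto
    then show ?thesis using fg[of 0] by simp
  qed
  have ghol: "g holomorphic_on ball 0 R" using g holomorphic_on_subset by blast
  obtain l where l: "l holomorphic_on ball 0 R" "\<And>z. z \<in> ball 0 R \<Longrightarrow> exp (l z) = g z"
  proof (rule holomorphic_logarithm_exists[OF _ _ ghol, of 0])
    show "g z \<noteq> 0" if "z \<in> ball 0 R" for z using gnz that by simp
  qed (use R0 in auto)
  \<comment> \<open>Only norms matter, so the logarithm may be symmetrised instead of being shown to be even.\<close>
  define L where "L = (\<lambda>z. (l z + l (- z)) / 2 - l 0)"
  have lneg: "(\<lambda>z. l (- z)) holomorphic_on ball 0 R"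
    by (rule holomorphic_reflect[OF l(1)]) auto
  have L: "L holomorphic_on ball 0 R" unfolding L_def by (intro holomorphic_intros l lneg) auto
  have Rel: "Re (l z) = ln (norm (g z))" if "norm z < R" for z
    using l(2)[of z] that by (metis ln_exp mem_ball_0 norm_exp_eq_Re)
  have geven: "g (- z) = g z" for z
  proof (cases "f z = 0")
    case False
    then show ?thesis using fg[of z] fg[of "-z"] even[of z] by auto
  next
    case True
    show ?thesis
    proof (rule analytic_continuation_open[where s = "{z. f z \<noteq> 0}" and s' = UNIV and f = "\<lambda>z. g (- z)" and g = g])
      have "{z. f z \<noteq> 0} = f -` (- {0})" by auto
      also have "open \<dots>" using holomorphic_on_imp_continuous_on[OF hol]
        by (intro open_vimage) auto
      finally show "open {z. f z \<noteq> 0}" .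
      show "{z. f z \<noteq> 0} \<noteq> {}" using f0 by auto
      show "(\<lambda>z. g (- z)) holomorphic_on UNIV"
        by (rule holomorphic_reflect[OF g]) auto
      show "g (- z) = g z" if "z \<in> {z. f z \<noteq> 0}" for z
        using that fg[of z] fg[of "-z"] even[of z] by auto
    qed (use g in auto)
  qed
  have ReL: "Re (L z) = ln (norm (g z)) - ln (norm (f 0))" if "norm z < R" for z
    using Rel[of z] Rel[of "-z"] Rel[of 0] that R0 by (simp add: L_def geven g0)
  define A where "A = 9 * e * R\<^sup>2 + c"
  have ReLA: "Re (L z) < A" if "norm z < R" for z
  proof -
    have "ln (norm (g z)) \<le> ln B" using gB[of z] gnz[of z] that by (intro ln_mono) auto
    then show ?thesis unfolding ReL[OF that] by (simp add: B_def A_def c_def power_mult_distrib)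
  qed
  have A0: "A > 0" using ReLA[of 0] R0 by (simp add: L_def)
  have small: "\<bar>Re (L z)\<bar> \<le> d" if z: "norm z \<le> K" for z
  proof -
    have "\<bar>Re (L z)\<bar> \<le> norm (L z)" by (rule abs_Re_le_cmod)
    also have "\<dots> \<le> 8 * A * (norm z)\<^sup>2 / R\<^sup>2"
      by (rule Borel_Caratheodory_even[OF L _ _ ReLA R0]) (use z Kr in \<open>auto simp: L_def add.commute\<close>)
    also have "\<dots> \<le> 8 * (9 * e * R\<^sup>2 + \<bar>c\<bar>) * C / R\<^sup>2"
    proof -
      have "(norm z)\<^sup>2 \<le> K\<^sup>2" using z by (intro power_mono) auto
      then have "A * (norm z)\<^sup>2 \<le> (9 * e * R\<^sup>2 + \<bar>c\<bar>) * C"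
        using A0 by (intro mult_mono) (auto simp: A_def C_def)
      then have "8 * (A * (norm z)\<^sup>2) \<le> 8 * ((9 * e * R\<^sup>2 + \<bar>c\<bar>) * C)" by simp
      then show ?thesis by (intro divide_right_mono) (simp_all only: mult.assoc zero_le_power2)
    qed
    also have "\<dots> = 72 * e * C + 8 * \<bar>c\<bar> * C / R\<^sup>2" using R0 by (simp add: field_simps)
    also have "\<dots> \<le> d / 2 + d / 2" using R(1) C by (simp add: e_def)
    finally show ?thesis by simp
  qed
  have ng: "norm (g z) = norm (f 0) * exp (Re (L z))" if "norm z \<le> K" for z
    using ReL[of z] gnz[of z] f0 that Kr R0 by (simp add: exp_diff)
  show ?thesis
  proof (rule that[of M])
    fix z :: complex assume z: "norm z \<le> K"
    let ?P = "norm (f 0) * norm (\<Prod>u\<in>#M. 1 - z\<^sup>2 / u)"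
    have eq: "norm (f z) = exp (Re (L z)) * ?P" using fg[of z] ng[OF z] by (simp add: norm_mult)
    have "exp (Re (L z)) * ?P \<le> exp d * ?P" using small[OF z] by (intro mult_right_mono) auto
    then show "norm (f z) \<le> exp d * ?P" unfolding eq .
    have "1 * ?P \<le> exp (d + Re (L z)) * ?P" using small[OF z] by (intro mult_right_mono) auto
    then show "?P \<le> exp d * norm (f z)" unfolding eq by (simp add: exp_add mult_ac)
  qed (use M Kr R0 in auto)
qed

section \<open>The gamma factor\<close>

lemma artanh_bounds:
  fixes z :: real
  assumes "0 \<le> z" "z < 1"
  shows "z \<le> artanh z" "artanh z \<le> z / (1 - z\<^sup>2)"
proof -
  have d: "1 - u\<^sup>2 > 0" if "0 \<le> u" "u \<le> z" for u
    using that assms by (simp add: power_less_one_iff abs_square_less_1)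
  have "(\<lambda>u. artanh u - u) 0 \<le> (\<lambda>u. artanh u - u) z"
  proof (rule DERIV_nonneg_imp_nondecreasing[OF assms(1)])
    fix u assume u: "0 \<le> u" "u \<le> z"
    have "((\<lambda>u. artanh u - u) has_real_derivative 1 / (1 - u\<^sup>2) - 1) (at u)"
      using u assms by (auto intro!: derivative_eq_intros)
    moreover have "1 / (1 - u\<^sup>2) - 1 \<ge> 0" using d[OF u] by (simp add: field_simps)
    ultimately show "\<exists>y. ((\<lambda>u. artanh u - u) has_real_derivative y) (at u) \<and> 0 \<le> y" by blast
  qed
  then show "z \<le> artanh z" by simp
  have "(\<lambda>u. u / (1 - u\<^sup>2) - artanh u) 0 \<le> (\<lambda>u. u / (1 - u\<^sup>2) - artanh u) z"
  proof (rule DERIV_nonneg_imp_nondecreasing[OF assms(1)])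
    fix u assume u: "0 \<le> u" "u \<le> z"
    have "((\<lambda>u. u / (1 - u\<^sup>2) - artanh u) has_real_derivative (1 + u\<^sup>2) / (1 - u\<^sup>2)\<^sup>2 - 1 / (1 - u\<^sup>2)) (at u)"
      using d[OF u] u assms by (auto intro!: derivative_eq_intros simp: power2_eq_square field_simps)
    moreover have "(1 + u\<^sup>2) / (1 - u\<^sup>2)\<^sup>2 - 1 / (1 - u\<^sup>2) = 2 * u\<^sup>2 / (1 - u\<^sup>2)\<^sup>2"
      using d[OF u] by (simp add: power2_eq_square divide_simps)
    moreover have "2 * u\<^sup>2 / (1 - u\<^sup>2)\<^sup>2 \<ge> 0" by simp
    ultimately show "\<exists>y. ((\<lambda>u. u / (1 - u\<^sup>2) - artanh u) has_real_derivative y) (at u) \<and> 0 \<le> y" by metis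
  qed
  then show "artanh z \<le> z / (1 - z\<^sup>2)" by simp
qed

lemma log_difference_artanh:
  fixes A u :: real
  assumes "\<bar>u\<bar> < A"
  shows "ln (A + u) / 2 - ln (A - u) / 2 = artanh (u / A)"
proof -
  have A: "A > 0" "A + u > 0" "A - u > 0" using assms by linarith+
  have "(1 + u / A) / (1 - u / A) = (A + u) / (A - u)" using A by (simp add: field_simps)
  then show ?thesis using A unfolding artanh_def by (simp add: ln_div diff_divide_distrib)
qed

text \<open>For Y = y^2 this is the logarithm of the modulus of u + i y; its derivative in
  \<open>u\<close> is u / (u^2 + Y).\<close>

definition log_norm :: "real \<Rightarrow> real \<Rightarrow> real" where
  "log_norm Y u = ln (u\<^sup>2 + Y) / 2"

text \<open>
  The sum of \<open>u / (u\<^sup>2 + Y)\<close> over \<open>u = x + k\<close> is the real part of a truncated digamma series. Shifting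
  \<open>Y\<close> by \<open>- 1/4\<close> for \<open>u \<ge> 0\<close> and by \<open>3/4\<close> for \<open>u < 0\<close> makes the midpoint rule an exact
  inequality, so that the sum telescopes, with one correction where \<open>u\<close> changes sign.
\<close>

lemma quotient_le_log_norm_diff:
  fixes u Y :: real
  assumes "Y \<ge> 16"
  shows "u \<ge> 0 \<Longrightarrow> u / (u\<^sup>2 + Y) \<le> log_norm (Y - 1/4) (u + 1/2) - log_norm (Y - 1/4) (u - 1/2)"
    and "u < 0 \<Longrightarrow> u / (u\<^sup>2 + Y) \<le> log_norm (Y + 3/4) (u + 1/2) - log_norm (Y + 3/4) (u - 1/2)"
proof -
  have uu: "\<bar>u\<bar> < u\<^sup>2 + Y"
  proof -
    have "0 \<le> (\<bar>u\<bar> - 1)\<^sup>2" by simp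
    then show ?thesis using assms by (simp add: power2_diff)
  qed
  show "u / (u\<^sup>2 + Y) \<le> log_norm (Y - 1/4) (u + 1/2) - log_norm (Y - 1/4) (u - 1/2)" if u: "u \<ge> 0"
  proof -
    \<comment> \<open>The shift by 1/4 completes the square: (u + 1/2)^2 + Y - 1/4 = u^2 + Y + u,
      and likewise with both signs reversed.\<close>
    have "log_norm (Y - 1/4) (u + 1/2) - log_norm (Y - 1/4) (u - 1/2) = ln (u\<^sup>2 + Y + u) / 2 - ln (u\<^sup>2 + Y - u) / 2"
      unfolding log_norm_def by (simp add: power2_eq_square algebra_simps)
    also have "\<dots> = artanh (u / (u\<^sup>2 + Y))" by (rule log_difference_artanh[OF uu])
    also have "\<dots> \<ge> u / (u\<^sup>2 + Y)" by (rule artanh_bounds) (use u uu in \<open>auto simp: field_simps\<close>)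
    finally show ?thesis .
  qed
  show "u / (u\<^sup>2 + Y) \<le> log_norm (Y + 3/4) (u + 1/2) - log_norm (Y + 3/4) (u - 1/2)" if u: "u < 0"
  proof -
    define a where "a = - u"
    define B where "B = a\<^sup>2 + Y"
    have a: "a > 0" and B: "B \<ge> a\<^sup>2" "B \<ge> 16" "a < B" using u uu assms by (auto simp: a_def B_def intro: add_increasing)
    define z where "z = a / (B + 1)"
    have z: "0 \<le> z" "z < 1" using a B by (auto simp: z_def field_simps)
    have "log_norm (Y + 3/4) (u + 1/2) - log_norm (Y + 3/4) (u - 1/2) = ln ((B + 1) - a) / 2 - ln ((B + 1) + a) / 2"
      unfolding log_norm_def a_def B_def by (simp add: power2_eq_square algebra_simps)
    also have "\<dots> = - artanh z"
      using log_difference_artanh[of a "B + 1"] a B by (simp add: z_def)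
    finally have 1: "log_norm (Y + 3/4) (u + 1/2) - log_norm (Y + 3/4) (u - 1/2) = - artanh z" .
    \<comment> \<open>The target is artanh z <= a / B. After this estimate and clearing denominators
      it amounts to a^2 <= B + 1.\<close>
    have "artanh z \<le> z / (1 - z\<^sup>2)" by (rule artanh_bounds[OF z])
    also have "\<dots> = a * (B + 1) / ((B + 1)\<^sup>2 - a\<^sup>2)"
    proof -
      define C where "C = B + 1"
      have C: "C > 0" "C\<^sup>2 - a\<^sup>2 > 0" using a B by (auto simp: C_def intro!: power_strict_mono)
      have "1 - z\<^sup>2 = (C\<^sup>2 - a\<^sup>2) / C\<^sup>2" using C by (simp add: z_def C_def[symmetric] power_divide field_simps)
      then have "z / (1 - z\<^sup>2) = a / C * (C\<^sup>2 / (C\<^sup>2 - a\<^sup>2))" by (simp add: z_def C_def[symmetric])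
      also have "\<dots> = a * C / (C\<^sup>2 - a\<^sup>2)" using C by (simp add: power2_eq_square)
      finally show ?thesis unfolding C_def .
    qed
    also have "\<dots> \<le> a * (B + 1) / (B * (B + 1))"
    proof (rule divide_left_mono)
      show "B * (B + 1) \<le> (B + 1)\<^sup>2 - a\<^sup>2" using B by (simp add: power2_eq_square algebra_simps)
      show "0 < ((B + 1)\<^sup>2 - a\<^sup>2) * (B * (B + 1))"
      proof (intro mult_pos_pos)
        have "a\<^sup>2 < (B + 1)\<^sup>2" using a B by (intro power_strict_mono) auto
        then show "0 < (B + 1)\<^sup>2 - a\<^sup>2" by simp
      qed (use B in auto)
    qed (use a B in auto)
    also have "\<dots> = - (u / (u\<^sup>2 + Y))" using B by (simp add: a_def B_def)
    finally show ?thesis unfolding 1 by simp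
  qed
qed

lemma sum_quotient_le:
  fixes x Y :: real and n :: nat
  assumes Y: "Y \<ge> 16"
  shows "(\<Sum>k<n. (x + k) / ((x + k)\<^sup>2 + Y)) \<le>
    log_norm (Y - 1/4) (x + n - 1/2) - log_norm (Y - 1/4) (x - 1/2) + 1 / (2 * (Y - 1/4))"
proof -
  let ?L = "log_norm (Y - 1/4)" and ?U = "log_norm (Y + 3/4)" and ?D = "1 / (2 * (Y - 1/4))"
  let ?S = "\<lambda>n. \<Sum>k<n. (x + real k) / ((x + real k)\<^sup>2 + Y)"
  have LU: "?L b \<le> ?U b" "?U b \<le> ?L b + ?D" for b
  proof -
    have pos: "b\<^sup>2 + (Y - 1/4) > 0" using Y by (simp add: add_nonneg_pos)
    then show "?L b \<le> ?U b" unfolding log_norm_def by (auto intro!: divide_right_mono)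
    have "ln (b\<^sup>2 + (Y + 3/4)) - ln (b\<^sup>2 + (Y - 1/4)) = ln (1 + 1 / (b\<^sup>2 + (Y - 1/4)))"
    proof -
      have "1 + 1 / (b\<^sup>2 + (Y - 1/4)) = (b\<^sup>2 + (Y + 3/4)) / (b\<^sup>2 + (Y - 1/4))"
        using pos by (simp add: field_simps)
      moreover have "ln ((b\<^sup>2 + (Y + 3/4)) / (b\<^sup>2 + (Y - 1/4))) = ln (b\<^sup>2 + (Y + 3/4)) - ln (b\<^sup>2 + (Y - 1/4))"
        using pos by (simp add: ln_div)
      ultimately show ?thesis by simp
    qed
    also have "\<dots> \<le> 1 / (b\<^sup>2 + (Y - 1/4))"
      by (rule ln_add_one_self_le_self) (use pos in auto)
    also have "\<dots> \<le> 1 / (Y - 1/4)" using Y pos by (intro divide_left_mono mult_pos_pos) auto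
    finally have "ln (b\<^sup>2 + (Y + 3/4)) - ln (b\<^sup>2 + (Y - 1/4)) \<le> 1 / (Y - 1/4)" .
    also have "1 / (Y - 1/4) = 2 * ?D" using Y by (simp add: field_simps)
    finally have le: "ln (b\<^sup>2 + (Y + 3/4)) - ln (b\<^sup>2 + (Y - 1/4)) \<le> 2 * ?D" .
    have half: "p / 2 \<le> q / 2 + d" if "p - q \<le> 2 * d" for p q d :: real using that by simp
    show "?U b \<le> ?L b + ?D" unfolding log_norm_def by (rule half[OF le])
  qed
  \<comment> \<open>While all arguments are negative the sum telescopes with \<open>?U\<close>. The
    price \<open>?D\<close> for passing from \<open>?U\<close> to \<open>?L\<close> is paid only
    once, and the second conjunct carries the bound in which it is still unspent.\<close>
  have "?S n \<le> ?L (x + n - 1/2) - ?L (x - 1/2) + ?D \<and>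
     (x + n - 1 < 0 \<longrightarrow> ?S n \<le> ?U (x + n - 1/2) - ?U (x - 1/2))"
  proof (induction n)
    case (Suc n)
    let ?u = "x + real n"
    have e: "x + real (Suc n) - 1/2 = ?u + 1/2" "x + real (Suc n) - 1 = ?u"
      by simp_all
    have SS: "?S (Suc n) = ?S n + ?u / (?u\<^sup>2 + Y)" by (rule sum.lessThan_Suc)
    note IH = Suc.IH
    show ?case
    proof (cases "?u < 0")
      case True
      then have "x + real n - 1 < 0" by simp
      then have "?S n \<le> ?U (?u - 1/2) - ?U (x - 1/2)" by (rule conjunct2[OF IH, THEN mp])
      then have U: "?S (Suc n) \<le> ?U (?u + 1/2) - ?U (x - 1/2)"
        using quotient_le_log_norm_diff(2)[OF Y True] unfolding SS by linarith
      then have V: "?S (Suc n) \<le> ?L (?u + 1/2) - ?L (x - 1/2) + ?D"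
        using LU(2)[of "?u + 1/2"] LU(1)[of "x - 1/2"] by linarith
      show ?thesis unfolding e by (rule conjI[OF V impI[OF U]])
    next
      case False
      then have "0 \<le> ?u" by simp
      then have "?S (Suc n) \<le> ?L (?u + 1/2) - ?L (x - 1/2) + ?D"
        using quotient_le_log_norm_diff(1)[OF Y, of ?u] conjunct1[OF IH] unfolding SS by linarith
      then show ?thesis unfolding e by (rule conjI) (use False in blast)
    qed
  next
    case 0
    have "?D \<ge> 0" using Y by simp
    then show ?case by simp
  qed
  then show ?thesis by (rule conjunct1)
qed

text \<open>Here 1/8 is the decay rate kept for the reciprocal Gamma function, and 1/20 is slack to
  be consumed by the passage to the limit in Gauss's product.\<close>

lemma log_pi_bound:
  assumes "Y \<ge> (16::real)"
  shows "ln pi + 1/8 + 1/20 \<le> log_norm (Y - 1/4) b - 1 / (2 * (Y - 1/4))"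
proof -
  have "pi\<^sup>2 \<le> 3.1416\<^sup>2" using pi_approx by (intro power_mono) auto
  moreover have "exp (5/12 :: real) \<le> 1591/1000"
  proof -
    have "exp (5/12 :: real) \<le> 1 + 5/12 + (5/12)\<^sup>2" by (rule exp_bound) auto
    also have "\<dots> \<le> 1591/1000" by (simp add: power2_eq_square)
    finally show ?thesis .
  qed
  ultimately have "pi\<^sup>2 * exp (5/12) \<le> 3.1416\<^sup>2 * (1591/1000)" by (intro mult_mono) auto
  also have "\<dots> \<le> 63/4" by (simp add: power2_eq_square)
  also have "\<dots> \<le> b\<^sup>2 + (Y - 1/4)" using assms by (simp add: add_increasing)
  finally have "ln (pi\<^sup>2 * exp (5/12)) \<le> ln (b\<^sup>2 + (Y - 1/4))" by (rule ln_mono) simp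
  then have "2 * ln pi + 5/12 \<le> ln (b\<^sup>2 + (Y - 1/4))" by (simp add: ln_mult ln_realpow)
  moreover have "1 / (2 * (Y - 1/4)) \<le> 1 / (2 * (16 - 1/4))" using assms by (intro divide_left_mono) auto
  ultimately show ?thesis by (simp add: log_norm_def)
qed

text \<open>The bound must not depend on \<open>x\<close> within the range, so that one threshold
  for \<open>n\<close> serves the whole segment on which the derivative is estimated.\<close>

lemma sum_quotient_le_uniform:
  fixes x X Y :: real and n :: nat
  assumes Y: "Y \<ge> 16" and x: "\<bar>x\<bar> \<le> X"
  shows "(\<Sum>k<n. (x + k) / ((x + k)\<^sup>2 + Y)) \<le>
    log_norm (Y - 1/4) (X + n + 1/2) - (ln pi + 1/8 + 1/20)"
proof -
  define a b where "a = x + real n - 1/2" and "b = X + real n + 1/2"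
  have "\<bar>a\<bar> \<le> \<bar>b\<bar>" using x by (auto simp: a_def b_def)
  then have "a\<^sup>2 + (Y - 1/4) \<le> b\<^sup>2 + (Y - 1/4)" by (simp add: abs_le_square_iff)
  moreover have "0 < a\<^sup>2 + (Y - 1/4)" using Y by (intro add_nonneg_pos) auto
  ultimately have "log_norm (Y - 1/4) a \<le> log_norm (Y - 1/4) b"
    unfolding log_norm_def by (intro divide_right_mono ln_mono) auto
  moreover have "(\<Sum>k<n. (x + k) / ((x + k)\<^sup>2 + Y)) \<le>
      log_norm (Y - 1/4) a - log_norm (Y - 1/4) (x - 1/2) + 1 / (2 * (Y - 1/4))"
    unfolding a_def by (rule sum_quotient_le[OF Y])
  moreover note log_pi_bound[OF Y, of "x - 1/2"]
  ultimately show ?thesis unfolding b_def by linarith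
qed

text \<open>The integrated form of Re psi(x + i y) >= ln pi + 1/8. It is proved for the approximants
  of Gauss's product, whose logarithmic derivatives are finite sums, and then passed to the
  limit.\<close>

lemma norm_rGamma_decrease:
  assumes "x1 < x2" "\<bar>y\<bar> \<ge> 4"
  shows "norm (rGamma (Complex x2 y)) \<le> exp (- (ln pi + 1/8) * (x2 - x1)) * norm (rGamma (Complex x1 y))"
proof -
  define Y where "Y = y\<^sup>2"
  have Y: "Y \<ge> 16" using power_mono[OF assms(2), of 2] by (simp add: Y_def)
  define phi where "phi = (\<lambda>n x. (\<Sum>k<Suc n. log_norm Y (x + real k)) - x * ln (real n))"
  have norm_eq: "norm (rGamma_series (Complex x y) n) = exp (phi n x) / fact n" for x n
  proof -
    have "norm (pochhammer (Complex x y) (n + 1)) = exp (\<Sum>k<Suc n. log_norm Y (x + real k))"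
    proof -
      have "norm (Complex x y + of_nat k) = exp (log_norm Y (x + real k))" for k
      proof -
        have "exp (log_norm Y (x + real k)) = sqrt ((x + real k)\<^sup>2 + Y)"
          using Y by (simp add: log_norm_def add_nonneg_pos ln_sqrt[symmetric])
        then show ?thesis by (simp add: cmod_def Y_def)
      qed
      then show ?thesis
        by (simp add: pochhammer_prod prod_norm[symmetric] exp_sum atLeast0LessThan
            del: sum.lessThan_Suc prod.lessThan_Suc prod.op_ivl_Suc)
    qed
    moreover have "norm (exp (Complex x y * of_real (ln (of_nat n)))) = exp (x * ln (real n))"
      by (simp add: norm_exp_eq_Re)
    ultimately show ?thesis
      by (simp add: rGamma_series_def norm_divide norm_mult phi_def exp_diff)
  qed
  define X where "X = max \<bar>x1\<bar> \<bar>x2\<bar>"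
  have X: "\<bar>x\<bar> \<le> X" if "x1 \<le> x" "x \<le> x2" for x using that by (auto simp: X_def)
  have "(\<lambda>n. log_norm (Y - 1/4) (X + real (Suc n) + 1/2) - ln (real n)) \<longlonglongrightarrow> 0"
    using Y unfolding log_norm_def by real_asymp
  from order_tendstoD(2)[OF this, of "1/20"]
  have ev: "\<forall>\<^sub>F n in sequentially. log_norm (Y - 1/4) (X + real (Suc n) + 1/2) - ln (real n) < 1/20" by simp
  have "\<forall>\<^sub>F n in sequentially. norm (rGamma_series (Complex x2 y) n) \<le>
      exp (- (ln pi + 1/8) * (x2 - x1)) * norm (rGamma_series (Complex x1 y) n)"
    using ev
  proof eventually_elim
    case (elim n)
    let ?c = "ln pi + 1/8"
    have "(\<lambda>x. phi n x + ?c * x) x2 \<le> (\<lambda>x. phi n x + ?c * x) x1"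
    proof (rule DERIV_nonpos_imp_nonincreasing[where f = "\<lambda>x. phi n x + ?c * x", OF less_imp_le[OF assms(1)]])
      fix x assume x: "x1 \<le> x" "x \<le> x2"
      have "(log_norm Y has_real_derivative u / (u\<^sup>2 + Y)) (at u)" for u
      proof -
        have "u\<^sup>2 + Y > 0" using Y by (simp add: add_nonneg_pos)
        then have "((\<lambda>u. ln (u\<^sup>2 + Y)) has_real_derivative 2 * u / (u\<^sup>2 + Y)) (at u)"
          by (auto intro!: derivative_eq_intros)
        from DERIV_cdivide[OF this, of 2]
        have "((\<lambda>u. ln (u\<^sup>2 + Y) / 2) has_real_derivative 2 * u / (u\<^sup>2 + Y) / 2) (at u)" .
        moreover have "2 * u / (u\<^sup>2 + Y) / 2 = u / (u\<^sup>2 + Y)"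
          using \<open>u\<^sup>2 + Y > 0\<close> by (simp add: divide_simps)
        ultimately show ?thesis unfolding log_norm_def by (simp only:)
      qed
      then have dk: "((\<lambda>x. log_norm Y (x + real k)) has_real_derivative (x + real k) / ((x + real k)\<^sup>2 + Y)) (at x)" for k
        by (rule DERIV_shift[THEN iffD1])
      have "((\<lambda>x. phi n x + ?c * x) has_real_derivative
        (\<Sum>k<Suc n. (x + real k) / ((x + real k)\<^sup>2 + Y)) - 1 * ln (real n) + ?c * 1) (at x)"
        unfolding phi_def
        by (intro DERIV_add DERIV_diff DERIV_cmult_right DERIV_cmult DERIV_ident DERIV_sum dk)
      then have "((\<lambda>x. phi n x + ?c * x) has_real_derivative
        (\<Sum>k<Suc n. (x + real k) / ((x + real k)\<^sup>2 + Y)) - ln (real n) + ?c) (at x)"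
        by (simp only: mult_1 mult_1_right)
      moreover have "(\<Sum>k<Suc n. (x + real k) / ((x + real k)\<^sup>2 + Y)) - ln (real n) + ?c \<le> 0"
      proof -
        have "s - l + c \<le> 0" if "s \<le> p - (c + 1/20)" "p - l < 1/20" for s l c p :: real
          using that by linarith
        from this[OF sum_quotient_le_uniform[OF Y X[OF x], of "Suc n"] elim] show ?thesis .
      qed
      ultimately show "\<exists>D. ((\<lambda>x. phi n x + ?c * x) has_real_derivative D) (at x) \<and> D \<le> 0" by blast
    qed
    then have "phi n x2 \<le> - ?c * (x2 - x1) + phi n x1" by (simp add: algebra_simps diff_divide_distrib)
    then have "exp (phi n x2) \<le> exp (- ?c * (x2 - x1)) * exp (phi n x1)" by (simp flip: exp_add)
    then have "exp (phi n x2) / (fact n :: real) \<le> exp (- ?c * (x2 - x1)) * exp (phi n x1) / fact n"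
      by (intro divide_right_mono) simp_all
    then show ?case unfolding norm_eq by (simp only: times_divide_eq_right)
  qed
  moreover have "(\<lambda>n. norm (rGamma_series (Complex x2 y) n)) \<longlonglongrightarrow> norm (rGamma (Complex x2 y))"
    by (intro tendsto_norm rGamma_series_LIMSEQ)
  moreover have "(\<lambda>n. exp (- (ln pi + 1/8) * (x2 - x1)) * norm (rGamma_series (Complex x1 y) n)) \<longlonglongrightarrow>
      exp (- (ln pi + 1/8) * (x2 - x1)) * norm (rGamma (Complex x1 y))"
    by (intro tendsto_mult_left tendsto_norm rGamma_series_LIMSEQ)
  ultimately show ?thesis by - (rule tendsto_le[OF trivial_limit_sequentially], assumption+)
qed

text \<open>For real u, u / (u^2 + t^2) is at most 1 / (2 |t|), hence at most 1/16; with u = 1 - a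
  this bounds the rate at which ln |s - 1| can fall.\<close>

lemma norm_minus_one_increase:
  fixes a b t :: real
  assumes "a \<le> b" "\<bar>t\<bar> \<ge> 8"
  shows "norm (Complex a t - 1) \<le> exp ((b - a) / 16) * norm (Complex b t - 1)"
proof -
  have t: "t\<^sup>2 \<ge> 64" using power_mono[OF assms(2), of 2] by simp
  have pos: "u\<^sup>2 + t\<^sup>2 > 0" for u :: real
  proof -
    have "0 \<le> u\<^sup>2" by simp
    with t show ?thesis by linarith
  qed
  have "(\<lambda>u. ln (u\<^sup>2 + t\<^sup>2) - u / 8) (1 - a) \<le> (\<lambda>u. ln (u\<^sup>2 + t\<^sup>2) - u / 8) (1 - b)"
  proof (rule DERIV_nonpos_imp_nonincreasing[where f = "\<lambda>u. ln (u\<^sup>2 + t\<^sup>2) - u / 8"])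
    fix u :: real
    have "((\<lambda>u. ln (u\<^sup>2 + t\<^sup>2) - u / 8) has_real_derivative 2 * u / (u\<^sup>2 + t\<^sup>2) - 1/8) (at u)"
      using pos[of u] by (auto intro!: derivative_eq_intros)
    moreover have "2 * u / (u\<^sup>2 + t\<^sup>2) - 1/8 \<le> 0"
    proof -
      have "0 \<le> (u - 8)\<^sup>2" by simp
      then have "16 * u \<le> u\<^sup>2 + t\<^sup>2" using t by (simp add: power2_diff)
      then show ?thesis using pos[of u] by (simp add: field_simps)
    qed
    ultimately show "\<exists>y. ((\<lambda>u. ln (u\<^sup>2 + t\<^sup>2) - u / 8) has_real_derivative y) (at u) \<and> y \<le> 0" by blast
  qed (use assms in auto)
  then have "ln ((1 - a)\<^sup>2 + t\<^sup>2) / 2 \<le> (b - a) / 16 + ln ((1 - b)\<^sup>2 + t\<^sup>2) / 2"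
    by (simp add: field_simps)
  then have "exp (ln ((1 - a)\<^sup>2 + t\<^sup>2) / 2) \<le> exp ((b - a) / 16) * exp (ln ((1 - b)\<^sup>2 + t\<^sup>2) / 2)"
    by (simp flip: exp_add)
  moreover have "norm (Complex c t - 1) = exp (ln ((1 - c)\<^sup>2 + t\<^sup>2) / 2)" for c
    using pos[of "1 - c"] by (simp add: cmod_def ln_sqrt[symmetric] power2_commute[of c 1])
  ultimately show ?thesis by simp
qed

section \<open>Monotonicity and the location of zeros\<close>

text \<open>The zero \<open>z0\<close> makes the inequality strict: its factor shrinks by a ratio
  fixed in advance, whereas the other factors, which may change with the accuracy demanded, are only
  used as not increasing.\<close>

lemma even_entire_strict_mono:
  fixes f :: "complex \<Rightarrow> complex"
  assumes hol: "f holomorphic_on UNIV" and even: "\<And>z. f (- z) = f z" and f0: "f 0 \<noteq> 0"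
    and growth: "\<And>e. e > 0 \<Longrightarrow> \<exists>r. \<forall>z. norm z \<ge> r \<longrightarrow> norm (f z) \<le> exp (e * (norm z)\<^sup>2)"
    and zeros: "\<And>z. f z = 0 \<Longrightarrow> \<bar>Re z\<bar> \<le> b" and z0: "f z0 = 0"
    and w: "Re w < Re w'" "Re w' \<le> - b" "Im w = Im w'"
  shows "norm (f w') < norm (f w)"
proof -
  have closer: "norm (1 - w'\<^sup>2 / z\<^sup>2) < norm (1 - w\<^sup>2 / z\<^sup>2)" if z: "f z = 0" for z
  proof -
    have nz: "z \<noteq> 0" using z f0 by auto
    have less: "norm (w' + c * z) < norm (w + c * z)" if "c = 1 \<or> c = - 1" for c
    proof -
      have "\<bar>Re (c * z)\<bar> \<le> b" using that zeros[OF z] by auto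
      then have "\<bar>Re w' + Re (c * z)\<bar> < \<bar>Re w + Re (c * z)\<bar>" using w by linarith
      then have "(Re w' + Re (c * z))\<^sup>2 < (Re w + Re (c * z))\<^sup>2"
        using power_strict_mono[of "\<bar>Re w' + Re (c * z)\<bar>" "\<bar>Re w + Re (c * z)\<bar>" 2] by (simp only: power2_abs abs_ge_zero)
      then have "(norm (w' + c * z))\<^sup>2 < (norm (w + c * z))\<^sup>2"
        unfolding cmod_power2 plus_complex.sel w(3) by (rule add_strict_right_mono)
      then show ?thesis by (rule power2_less_imp_less) simp
    qed
    have eq: "norm (1 - v\<^sup>2 / z\<^sup>2) = norm (v + 1 * z) * norm (v + (- 1) * z) / (norm z)\<^sup>2" for v
    proof -
      have "1 - v\<^sup>2 / z\<^sup>2 = - ((v + 1 * z) * (v + (- 1) * z) / z\<^sup>2)"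
        using nz by (simp add: field_simps power2_eq_square)
      then show ?thesis by (simp only: norm_minus_cancel norm_mult norm_divide norm_power)
    qed
    have "norm (w' + 1 * z) * norm (w' + (- 1) * z) < norm (w + 1 * z) * norm (w + (- 1) * z)"
      by (intro mult_strict_mono' less) auto
    then show ?thesis unfolding eq using nz by (intro divide_strict_right_mono) auto
  qed
  have fw: "f w \<noteq> 0"
  proof
    assume "f w = 0"
    from closer[OF this] show False
      using zeros[OF \<open>f w = 0\<close>] w by auto
  qed
  define q where "q = norm (1 - w'\<^sup>2 / z0\<^sup>2) / norm (1 - w\<^sup>2 / z0\<^sup>2)"
  have pos: "norm (1 - w\<^sup>2 / z0\<^sup>2) > 0" using closer[OF z0] by (rule le_less_trans[OF norm_ge_zero])
  have q: "q < 1" "q \<ge> 0" using closer[OF z0] pos by (auto simp: q_def)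
  \<comment> \<open>\<open>q\<close> is 0 if \<open>w'\<close> is itself \<open>z0\<close> or its
    negative; a positive bound is needed to take the logarithm.\<close>
  define r where "r = max q (1/2)"
  have r: "q \<le> r" "0 < r" "r < 1" using q by (auto simp: r_def)
  \<comment> \<open>Two approximations cost exp (2 * d), the inverse square root of
    \<open>r\<close>, so of the gain \<open>r\<close> a factor sqrt r survives.\<close>
  define d where "d = - ln r / 4"
  have d: "d > 0" using r by (simp add: d_def)
  define K where "K = max (norm z0) (max (norm w) (norm w'))"
  obtain M where M: "\<And>u. u \<in># M \<Longrightarrow> \<exists>z. u = z\<^sup>2 \<and> f z = 0"
    "\<And>z. f z = 0 \<Longrightarrow> norm z \<le> K \<Longrightarrow> z\<^sup>2 \<in># M"
    "\<And>z. norm z \<le> K \<Longrightarrow> norm (f z) \<le> exp d * (norm (f 0) * norm (\<Prod>u\<in>#M. 1 - z\<^sup>2 / u))"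
    "\<And>z. norm z \<le> K \<Longrightarrow> norm (f 0) * norm (\<Prod>u\<in>#M. 1 - z\<^sup>2 / u) \<le> exp d * norm (f z)"
    using even_entire_product_approx[OF hol even f0 growth d, of K] by metis
  have "z0\<^sup>2 \<in># M" using M(2)[OF z0] by (simp add: K_def)
  then obtain N where N: "M = add_mset (z0\<^sup>2) N" by (metis insert_DiffM)
  have "norm (\<Prod>u\<in>#N'. 1 - w'\<^sup>2 / u) \<le> norm (\<Prod>u\<in>#N'. 1 - w\<^sup>2 / u)" if "set_mset N' \<subseteq> set_mset M" for N'
    using that
  proof (induction N')
    case (add u N')
    then obtain z where "u = z\<^sup>2" "f z = 0" using M(1)[of u] by auto
    then have "norm (1 - w'\<^sup>2 / u) \<le> norm (1 - w\<^sup>2 / u)" using closer by (simp add: less_imp_le)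
    then show ?case using add by (auto simp: norm_mult intro: mult_mono)
  qed simp
  from this[of N] have NN: "norm (\<Prod>u\<in>#N. 1 - w'\<^sup>2 / u) \<le> norm (\<Prod>u\<in>#N. 1 - w\<^sup>2 / u)" by (auto simp: N)
  have "norm (\<Prod>u\<in>#M. 1 - w'\<^sup>2 / u) = norm (1 - w'\<^sup>2 / z0\<^sup>2) * norm (\<Prod>u\<in>#N. 1 - w'\<^sup>2 / u)"
    by (simp add: N norm_mult)
  also have "\<dots> \<le> (r * norm (1 - w\<^sup>2 / z0\<^sup>2)) * norm (\<Prod>u\<in>#N. 1 - w\<^sup>2 / u)"
  proof (rule mult_mono[OF _ NN])
    have "norm (1 - w'\<^sup>2 / z0\<^sup>2) = q * norm (1 - w\<^sup>2 / z0\<^sup>2)" using pos by (simp add: q_def)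
    also have "\<dots> \<le> r * norm (1 - w\<^sup>2 / z0\<^sup>2)" using r by (intro mult_right_mono) auto
    finally show "norm (1 - w'\<^sup>2 / z0\<^sup>2) \<le> r * norm (1 - w\<^sup>2 / z0\<^sup>2)" .
  qed (use r in auto)
  also have "\<dots> = r * norm (\<Prod>u\<in>#M. 1 - w\<^sup>2 / u)" by (simp add: N norm_mult mult.assoc)
  finally have PP: "norm (\<Prod>u\<in>#M. 1 - w'\<^sup>2 / u) \<le> r * norm (\<Prod>u\<in>#M. 1 - w\<^sup>2 / u)" .
  have "norm (f w') \<le> exp d * (norm (f 0) * norm (\<Prod>u\<in>#M. 1 - w'\<^sup>2 / u))"
    by (rule M(3)) (simp add: K_def)
  also have "\<dots> \<le> exp d * (norm (f 0) * (r * norm (\<Prod>u\<in>#M. 1 - w\<^sup>2 / u)))"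
    by (intro mult_left_mono PP) auto
  also have "\<dots> = exp d * r * (norm (f 0) * norm (\<Prod>u\<in>#M. 1 - w\<^sup>2 / u))" by (simp add: mult_ac)
  also have "\<dots> \<le> exp d * r * (exp d * norm (f w))"
    using r by (intro mult_left_mono M(4)) (auto simp: K_def)
  also have "\<dots> = exp (ln r / 2) * norm (f w)"
  proof -
    have "exp d * exp d * r = exp (d + d + ln r)" using r by (simp only: exp_add exp_ln)
    also have "d + d + ln r = ln r / 2" by (simp add: d_def)
    finally show ?thesis by (simp add: mult_ac)
  qed
  also have "\<dots> < 1 * norm (f w)"
    using r fw by (intro mult_strict_right_mono) auto
  finally show ?thesis by simp
qed

section \<open>Existence of zeros and exclusion of low ones\<close>

lemma Xi_0_nonzero: "Xi 0 \<noteq> 0"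
  using norm_Xi_0(1) by auto

text \<open>Without zeros every approximating product is empty, so |Xi| would nowhere exceed |Xi 0|
  by more than an arbitrarily small factor; yet \<open>Xi (1/2) = 1\<close> does.\<close>

lemma Xi_has_zero: "\<exists>z. Xi z = 0"
proof (rule ccontr)
  assume "\<nexists>z. Xi z = 0"
  define d where "d = - ln (norm (Xi 0)) / 2"
  have n0: "norm (Xi 0) > 0" using Xi_0_nonzero by simp
  have d: "d > 0" using norm_Xi_0(2) n0 by (simp add: d_def)
  obtain M where M: "\<And>u. u \<in># M \<Longrightarrow> \<exists>z. u = z\<^sup>2 \<and> Xi z = 0"
    "\<And>z. norm z \<le> 1 \<Longrightarrow> norm (Xi z) \<le> exp d * (norm (Xi 0) * norm (\<Prod>u\<in>#M. 1 - z\<^sup>2 / u))"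
    using even_entire_product_approx[OF Xi_holomorphic Xi_minus Xi_0_nonzero Xi_growth d, of 1] by metis
  have "M = {#}" using M(1) \<open>\<nexists>z. Xi z = 0\<close> by (meson multiset_nonemptyE)
  then have "1 \<le> exp d * norm (Xi 0)" using M(2)[of "1/2"] by (simp add: Xi_half norm_divide)
  also have "\<dots> = exp (d + ln (norm (Xi 0)))" using n0 by (simp add: exp_add)
  also have "\<dots> = exp (- d)" by (simp add: d_def)
  also have "\<dots> < 1" using d by simp
  finally show False by simp
qed

text \<open>|z - 1/2|^2 and |z + 1/2|^2 are |z|^2 + 1/4 minus and plus Re z, so their product is
  (|z|^2 + 1/4)^2 - (Re z)^2.\<close>

lemma norm_factor_square:
  fixes z :: complex
  assumes "z \<noteq> 0"
  shows "(norm (1 - (1/2)\<^sup>2 / z\<^sup>2))\<^sup>2 =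
    1 + ((norm z)\<^sup>2 / 2 + 1/16 - (Re z)\<^sup>2) / ((norm z)\<^sup>2)\<^sup>2"
proof -
  have "1 - (1/2)\<^sup>2 / z\<^sup>2 = (z - 1/2) * (z + 1/2) / z\<^sup>2"
    using assms by (simp add: field_simps power2_eq_square)
  then have "norm (1 - (1/2)\<^sup>2 / z\<^sup>2) = norm (z - 1/2) * norm (z + 1/2) / (norm z)\<^sup>2"
    by (simp only: norm_mult norm_divide norm_power)
  then have "(norm (1 - (1/2)\<^sup>2 / z\<^sup>2))\<^sup>2 = (norm (z - 1/2))\<^sup>2 * (norm (z + 1/2))\<^sup>2 / ((norm z)\<^sup>2)\<^sup>2"
    by (simp only: power_divide power_mult_distrib)
  also have "(norm (z - 1/2))\<^sup>2 * (norm (z + 1/2))\<^sup>2 = ((norm z)\<^sup>2)\<^sup>2 + ((norm z)\<^sup>2 / 2 + 1/16 - (Re z)\<^sup>2)"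
    unfolding cmod_power2 by (simp add: power2_eq_square algebra_simps)
  finally show ?thesis using assms by (simp add: add_divide_distrib)
qed

text \<open>
  A zero off the line with \<open>\<bar>Im z\<bar> < 8\<close> and its conjugate contribute two different factors to the
  product for \<open>Xi (1/2) / Xi 0\<close>; together they exceed 1.0075, all others are at least 1, but the
  quotient itself is at most 1 / (1 - 57/8000).
\<close>

lemma Xi_low_zero_on_line:
  assumes z: "Xi z = 0" and im: "\<bar>Im z\<bar> < 8"
  shows "Re z = 0"
proof (rule ccontr)
  assume re: "Re z \<noteq> 0"
  define p where "p = (\<lambda>u::complex. norm (1 - (1/2)\<^sup>2 / u))"
  have zero_ge: "p (y\<^sup>2) \<ge> 1" if y: "Xi y = 0" for y
  proof -
    have y0: "y \<noteq> 0" using y Xi_0_nonzero by auto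
    have "(Re y)\<^sup>2 \<le> (1/2)\<^sup>2" using power_mono[OF Xi_zero_Re[OF y], of 2] by simp
    moreover have "(norm y)\<^sup>2 \<ge> 0" by simp
    moreover have "(norm y)\<^sup>2 \<ge> (Im y)\<^sup>2" by (simp add: cmod_power2)
    moreover have "(Im y)\<^sup>2 \<ge> 34" by (rule Xi_zero_Im[OF y Xi_zero_Re[OF y]])
    ultimately have "(norm y)\<^sup>2 / 2 + 1/16 - (Re y)\<^sup>2 \<ge> 0" by (simp add: power2_eq_square)
    then have "(p (y\<^sup>2))\<^sup>2 \<ge> 1\<^sup>2" unfolding p_def norm_factor_square[OF y0] by simp
    then show ?thesis by (rule power2_le_imp_le) (simp add: p_def)
  qed
  have z0: "z \<noteq> 0" using z Xi_0_nonzero by auto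
  have imz: "(Im z)\<^sup>2 \<ge> 34" by (rule Xi_zero_Im[OF z Xi_zero_Re[OF z]])
  have large: "(p (z\<^sup>2))\<^sup>2 \<ge> 10075/10000"
  proof -
    define m where "m = (norm z)\<^sup>2"
    have "(Re z)\<^sup>2 \<le> (1/2)\<^sup>2" using power_mono[OF Xi_zero_Re[OF z], of 2] by simp
    then have r: "(Re z)\<^sup>2 \<le> 1/4" by (simp add: power2_eq_square)
    have "(Im z)\<^sup>2 \<le> 64" using power_mono[of "\<bar>Im z\<bar>" 8 2] im by simp
    moreover have "m = (Re z)\<^sup>2 + (Im z)\<^sup>2" by (simp add: m_def cmod_power2)
    moreover have "0 \<le> (Re z)\<^sup>2" by simp
    ultimately have m: "34 \<le> m" "m \<le> 64 + 1/4" using imz r by linarith+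
    \<comment> \<open>This bounds the convex square of \<open>m\<close> by its chord over
      [34, 64 + 1/4], leaving a linear inequality.\<close>
    have "0 \<le> (m - 34) * (64 + 1/4 - m)" using m by (intro mult_nonneg_nonneg) auto
    moreover have "(m - 34) * (64 + 1/4 - m) = (98 + 1/4) * m - 34 * (64 + 1/4) - m\<^sup>2"
      by (simp add: power2_eq_square field_simps)
    ultimately have "75/10000 * m\<^sup>2 \<le> 75/10000 * ((98 + 1/4) * m - 34 * (64 + 1/4))" by simp
    also have "\<dots> \<le> m / 2 + 1/16 - 1/4 + (m * (75/10000 * (98 + 1/4) - 1/2) - 16)" by (simp add: algebra_simps)
    also have "\<dots> \<le> m / 2 + 1/16 - 1/4" using m by simp
    also have "\<dots> \<le> m / 2 + 1/16 - (Re z)\<^sup>2" using r by simp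
    finally have "75/10000 * m\<^sup>2 \<le> m / 2 + 1/16 - (Re z)\<^sup>2" .
    moreover have "m\<^sup>2 > 0" using m by simp
    ultimately have "75/10000 \<le> (m / 2 + 1/16 - (Re z)\<^sup>2) / m\<^sup>2" by (simp only: pos_le_divide_eq)
    then show ?thesis unfolding p_def norm_factor_square[OF z0] m_def by simp
  qed
  have zc: "Xi (cnj z) = 0" using z by (simp add: Xi_cnj)
  have pc: "p ((cnj z)\<^sup>2) = p (z\<^sup>2)"
  proof -
    have "1 - (1/2)\<^sup>2 / (cnj z)\<^sup>2 = cnj (1 - (1/2)\<^sup>2 / z\<^sup>2)" by simp
    then show ?thesis unfolding p_def by (simp only: complex_mod_cnj)
  qed
  \<comment> \<open>On the critical line the conjugate of \<open>z\<close> is \<open>- z\<close> and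
    both squares coincide. Off it they differ, which guarantees two separate entries of the multiset
    without any knowledge of multiplicities.\<close>
  have distinct: "(cnj z)\<^sup>2 \<noteq> z\<^sup>2"
  proof
    assume "(cnj z)\<^sup>2 = z\<^sup>2"
    then have "cnj z = z \<or> cnj z = - z" by (simp add: power2_eq_iff)
    then show False using re imz by (auto simp: complex_eq_iff)
  qed
  \<comment> \<open>The contradiction rests on (1 - 57/8000) * 1.0075 > 1.0003; an approximation
    error of 1.0002 stays below this.\<close>
  define d :: real where "d = ln (10002/10000)"
  have d: "d > 0" by (simp add: d_def)
  define K where "K = max (norm z) 1"
  obtain M where M: "\<And>u. u \<in># M \<Longrightarrow> \<exists>z. u = z\<^sup>2 \<and> Xi z = 0"
    "\<And>z. Xi z = 0 \<Longrightarrow> norm z \<le> K \<Longrightarrow> z\<^sup>2 \<in># M"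
    "\<And>z. norm z \<le> K \<Longrightarrow> norm (Xi 0) * norm (\<Prod>u\<in>#M. 1 - z\<^sup>2 / u) \<le> exp d * norm (Xi z)"
    using even_entire_product_approx[OF Xi_holomorphic Xi_minus Xi_0_nonzero Xi_growth d, of K] by metis
  have "z\<^sup>2 \<in># M" "(cnj z)\<^sup>2 \<in># M" using M(2)[OF z] M(2)[OF zc] by (auto simp: K_def)
  then obtain N where N: "M = add_mset (z\<^sup>2) (add_mset ((cnj z)\<^sup>2) N)"
    using distinct by (metis insert_DiffM insert_noteq_member)
  define P where "P = (\<lambda>N::complex multiset. norm (\<Prod>u\<in>#N. 1 - (1/2)\<^sup>2 / u))"
  have P_add: "P (add_mset u N) = p u * P N" for u N by (simp add: P_def p_def norm_mult)
  have "1 \<le> P N'" if "set_mset N' \<subseteq> set_mset M" for N'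
    using that
  proof (induction N')
    case (add u N')
    then obtain y where "u = y\<^sup>2" "Xi y = 0" using M(1)[of u] by auto
    then have "1 \<le> p u" using zero_ge[of y] by simp
    moreover have "1 \<le> P N'" using add by simp
    ultimately have "1 * 1 \<le> p u * P N'" by (intro mult_mono) simp_all
    then show ?case by (simp add: P_add)
  qed (simp add: P_def)
  from this[of N] have PN: "1 \<le> P N" by (auto simp: N)
  have "P M = (p (z\<^sup>2))\<^sup>2 * P N"
    by (simp only: N P_add pc power2_eq_square[of "p (z\<^sup>2)"] mult.assoc)
  also have "\<dots> \<ge> 10075/10000 * 1" by (rule mult_mono[OF large PN]) simp_all
  finally have "10075/10000 * 1 \<le> P M" .
  then have "(1 - 57/8000) * (10075/10000 * 1) \<le> norm (Xi 0) * P M"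
    by (rule mult_mono[OF norm_Xi_0(1)]) simp_all
  also have "\<dots> \<le> exp d * norm (Xi (1/2))"
    unfolding P_def by (rule M(3)) (simp add: K_def norm_divide)
  also have "\<dots> = 10002/10000" by (simp add: Xi_half d_def)
  finally show False by simp
qed

section \<open>Transfer to zeta, eta and xi\<close>

lemma norm_Xi_strict_antimono:
  assumes zeros: "\<And>z. Xi z = 0 \<Longrightarrow> \<bar>Re z\<bar> \<le> b"
  shows "strict_antimono_on {..1/2 - b} (\<lambda>\<sigma>. norm (Xi (Complex \<sigma> t - 1/2)))"
proof (rule monotone_onI)
  fix x y :: real assume xy: "x \<in> {..1/2 - b}" "y \<in> {..1/2 - b}" "x < y"
  obtain z0 where "Xi z0 = 0" using Xi_has_zero by blast
  show "norm (Xi (Complex y t - 1/2)) < norm (Xi (Complex x t - 1/2))"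
    by (rule even_entire_strict_mono[OF Xi_holomorphic Xi_minus Xi_0_nonzero Xi_growth zeros \<open>Xi z0 = 0\<close>])
       (use xy in auto)
qed

lemma strict_antimono_on_mult:
  fixes f g :: "real \<Rightarrow> real"
  assumes f: "strict_antimono_on S f" and f0: "\<And>x. x \<in> S \<Longrightarrow> f x \<ge> 0"
    and g: "antimono_on S g" and g0: "\<And>x. x \<in> S \<Longrightarrow> g x > 0"
  shows "strict_antimono_on S (\<lambda>x. f x * g x)"
proof (rule monotone_onI)
  fix x y assume xy: "x \<in> S" "y \<in> S" "x < y"
  have "f y * g y \<le> f y * g x"
    using monotone_onD[OF g xy(1,2)] f0 xy by (intro mult_left_mono) auto
  also have "\<dots> < f x * g x"
    using monotone_onD[OF f xy] g0[OF xy(1)] by (intro mult_strict_right_mono)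
  finally show "f y * g y < f x * g x" .
qed

lemma norm_pi_powr: "norm (of_real pi powr z :: complex) = pi powr Re z"
  by (simp add: norm_powr_real_powr)

definition zeta_factor :: "real \<Rightarrow> real \<Rightarrow> real" where
  "zeta_factor t \<sigma> = pi powr (\<sigma> / 2) * norm (rGamma (1 + Complex \<sigma> t / 2)) / (2 * norm (Complex \<sigma> t - 1))"

lemma norm_zeta_eq:
  assumes "t \<noteq> 0"
  shows "norm (riemann_zeta (Complex \<sigma> t)) = norm (Xi (Complex \<sigma> t - 1/2)) * zeta_factor t \<sigma>"
proof -
  have "Complex \<sigma> t \<noteq> 1" using assms by (auto simp: complex_eq_iff)
  from riemann_zeta_eq[OF this] show ?thesis
    unfolding zeta_factor_def by (simp only: norm_divide norm_mult norm_pi_powr) simp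
qed

lemma zeta_factor_pos:
  assumes "t \<noteq> 0" shows "zeta_factor t \<sigma> > 0"
proof -
  have "Complex \<sigma> t \<noteq> 1" using assms by (auto simp: complex_eq_iff)
  then show ?thesis using rGamma_nonzero_upper[of "Complex \<sigma> t"] assms
    by (auto simp: zeta_factor_def)
qed

text \<open>Per unit of the real part, the logarithm receives (ln pi) / 2 from the power of pi, at
  most -(ln pi + 1/8) / 2 from the reciprocal Gamma function, and at most 1/16 from the reciprocal
  of |s - 1|. The three bounds add up to exactly 0.\<close>

lemma zeta_factor_antimono:
  assumes t: "\<bar>t\<bar> \<ge> 8" shows "antimono_on S (zeta_factor t)"
proof (rule monotone_onI)
  fix x y :: real assume "x \<le> y"
  show "zeta_factor t y \<le> zeta_factor t x"
  proof (cases "x = y")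
    case False
    with \<open>x \<le> y\<close> have xy: "x < y" by simp
    define h where "h = (y - x) / 2"
    have C: "1 + Complex u t / 2 = Complex (1 + u / 2) (t / 2)" for u by (simp add: complex_eq_iff)
    have G: "norm (rGamma (1 + Complex y t / 2)) \<le> exp (- (ln pi + 1/8) * h) * norm (rGamma (1 + Complex x t / 2))"
      unfolding C using norm_rGamma_decrease[of "1 + x/2" "1 + y/2" "t/2"] xy t
      by (simp add: h_def diff_divide_distrib)
    have P: "pi powr (y / 2) = pi powr (x / 2) * exp (ln pi * h)"
      by (simp add: powr_def h_def exp_add[symmetric] algebra_simps diff_divide_distrib)
    have N: "norm (Complex x t - 1) \<le> exp (h / 8) * norm (Complex y t - 1)"
      using norm_minus_one_increase[of x y t] xy t by (simp add: h_def)
    have nz: "norm (Complex u t - 1) > 0" for u using t by (auto simp: complex_eq_iff)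
    have "zeta_factor t y \<le> pi powr (x / 2) * exp (ln pi * h) *
        (exp (- (ln pi + 1/8) * h) * norm (rGamma (1 + Complex x t / 2))) / (2 * norm (Complex y t - 1))"
      unfolding zeta_factor_def P by (intro divide_right_mono mult_left_mono G) auto
    also have "\<dots> = pi powr (x / 2) * norm (rGamma (1 + Complex x t / 2)) / (2 * (exp (h / 8) * norm (Complex y t - 1)))"
    proof -
      have "ln pi * h + - (ln pi + 1/8) * h = - (h / 8)" by (simp add: algebra_simps)
      then have e: "exp (ln pi * h) * exp (- (ln pi + 1/8) * h) = 1 / exp (h / 8)"
        by (simp only: exp_add[symmetric] exp_minus inverse_eq_divide)
      have "a * b * (c * r) / (2 * n) = a * r / (2 * (e * n))" if "b * c = 1 / e" for a b c r n e :: real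
      proof -
        have "a * b * (c * r) / (2 * n) = a * (b * c) * r / (2 * n)" by (simp only: mult.assoc)
        then show ?thesis unfolding that by simp
      qed
      from this[OF e] show ?thesis .
    qed
    also have "\<dots> \<le> zeta_factor t x"
      unfolding zeta_factor_def using N nz[of x] nz[of y] by (intro divide_left_mono) (auto intro!: mult_pos_pos)
    finally show ?thesis .
  qed simp
qed

text \<open>With r = 2 powr (1 - \<sigma>), the squared modulus is (r - cos (t ln 2))^2 + sin (t ln
  2)^2. On the half-line r > 1 >= cos (t ln 2), so this grows with r.\<close>

lemma eta_factor_antimono: "antimono_on {..1/2} (\<lambda>\<sigma>. norm (1 - 2 powr (1 - Complex \<sigma> t)))"
  and eta_factor_pos: "\<sigma> \<le> 1/2 \<Longrightarrow> norm (1 - 2 powr (1 - Complex \<sigma> t)) > 0"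
proof -
  have eq: "(norm (1 - 2 powr (1 - Complex \<sigma> t)))\<^sup>2 = (2 powr (1 - \<sigma>) - cos (t * ln 2))\<^sup>2 + (sin (t * ln 2))\<^sup>2" for \<sigma>
  proof -
    have "2 powr (1 - Complex \<sigma> t) = exp ((1 - Complex \<sigma> t) * of_real (ln 2))"
      by (simp add: powr_def Ln_of_real[of 2, simplified])
    then have "2 powr (1 - Complex \<sigma> t) = Complex (2 powr (1 - \<sigma>) * cos (t * ln 2)) (- (2 powr (1 - \<sigma>) * sin (t * ln 2)))"
      by (simp add: complex_eq_iff Re_exp Im_exp powr_def)
    then have "(norm (1 - 2 powr (1 - Complex \<sigma> t)))\<^sup>2 =
        (1 - 2 powr (1 - \<sigma>) * cos (t * ln 2))\<^sup>2 + (2 powr (1 - \<sigma>) * sin (t * ln 2))\<^sup>2"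
      by (simp add: cmod_power2)
    also have "\<dots> = (2 powr (1 - \<sigma>) - cos (t * ln 2))\<^sup>2 + (sin (t * ln 2))\<^sup>2"
    proof -
      have "(1 - r * c)\<^sup>2 + (r * s)\<^sup>2 = (r - c)\<^sup>2 + s\<^sup>2" if "s\<^sup>2 + c\<^sup>2 = 1" for r c s :: real
        using that by algebra
      from this[OF sin_cos_squared_add] show ?thesis .
    qed
    finally show ?thesis .
  qed
  have gt: "2 powr (1 - \<sigma>) > 1" if "\<sigma> \<le> 1/2" for \<sigma> :: real using that by simp
  show "norm (1 - 2 powr (1 - Complex \<sigma> t)) > 0" if "\<sigma> \<le> 1/2"
  proof -
    have "2 powr (1 - \<sigma>) - cos (t * ln 2) > 0" using gt[OF that] cos_le_one[of "t * ln 2"] by linarith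
    then have "(norm (1 - 2 powr (1 - Complex \<sigma> t)))\<^sup>2 > 0" unfolding eq by (intro add_pos_nonneg) auto
    then show ?thesis by simp
  qed
  show "antimono_on {..1/2} (\<lambda>\<sigma>. norm (1 - 2 powr (1 - Complex \<sigma> t)))"
  proof (rule monotone_onI)
    fix x y :: real assume xy: "x \<in> {..1/2}" "y \<in> {..1/2}" "x \<le> y"
    have "2 powr (1 - y) \<le> 2 powr (1 - x)" using xy by simp
    then have "(2 powr (1 - y) - cos (t * ln 2))\<^sup>2 \<le> (2 powr (1 - x) - cos (t * ln 2))\<^sup>2"
      using order.trans[OF cos_le_one less_imp_le[OF gt[of y]], of "t * ln 2"] xy
      by (intro power_mono) auto
    then have "(norm (1 - 2 powr (1 - Complex y t)))\<^sup>2 \<le> (norm (1 - 2 powr (1 - Complex x t)))\<^sup>2"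
      unfolding eq by simp
    then show "norm (1 - 2 powr (1 - Complex y t)) \<le> norm (1 - 2 powr (1 - Complex x t))"
      by (rule power2_le_imp_le) simp
  qed
qed

lemma norm_xi_eq:
  assumes "t \<noteq> 0"
  shows "norm (riemann_xi (Complex \<sigma> t)) = norm (Xi (Complex \<sigma> t - 1/2)) * (1/2)"
proof -
  define s where "s = Complex \<sigma> t"
  have s: "s \<noteq> 1" using assms by (auto simp: complex_eq_iff s_def)
  have g: "Gamma (1 + s / 2) * rGamma (1 + s / 2) = 1"
    using rGamma_nonzero_upper[of s] assms by (simp add: Gamma_def s_def)
  have p: "of_real pi powr (- s / 2) * of_real pi powr (s / 2) = (1::complex)"
    by (simp add: powr_add[symmetric])
  have "riemann_xi s = Xi (s - 1/2) * (Gamma (1 + s / 2) * rGamma (1 + s / 2)) *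
      (of_real pi powr (- s / 2) * of_real pi powr (s / 2)) / 2"
    unfolding riemann_xi_def riemann_zeta_eq[OF s] using s by (simp add: field_simps)
  then have eq: "riemann_xi s = Xi (s - 1/2) / 2" unfolding g p by simp
  show ?thesis unfolding s_def[symmetric] eq by (simp add: norm_divide)
qed

text \<open>Both halves of the result are instances: \<open>b = 1/2\<close> holds unconditionally,
  and \<open>b = 0\<close> is the Riemann hypothesis.\<close>

lemma strict_antimono_norm:
  assumes f: "f \<in> {euler_eta, riemann_zeta, riemann_xi}"
    and zeros: "\<And>z. Xi z = 0 \<Longrightarrow> \<bar>Re z\<bar> \<le> b" and b: "b \<ge> 0" and t: "\<bar>t\<bar> \<ge> 8"
  shows "strict_antimono_on {..1/2 - b} (\<lambda>\<sigma>. norm (f (Complex \<sigma> t)))"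
proof -
  have t0: "t \<noteq> 0" using t by auto
  note X = norm_Xi_strict_antimono[of b t, OF zeros]
  have Z: "strict_antimono_on {..1/2 - b} (\<lambda>\<sigma>. norm (riemann_zeta (Complex \<sigma> t)))"
    unfolding norm_zeta_eq[OF t0]
    by (rule strict_antimono_on_mult[OF X _ zeta_factor_antimono[OF t]]) (auto simp: zeta_factor_pos[OF t0])
  have E: "strict_antimono_on {..1/2 - b} (\<lambda>\<sigma>. norm (riemann_zeta (Complex \<sigma> t)) * norm (1 - 2 powr (1 - Complex \<sigma> t)))"
    by (rule strict_antimono_on_mult[OF Z _ monotone_on_subset[OF eta_factor_antimono]])
       (use b eta_factor_pos in auto)
  have xi: "strict_antimono_on {..1/2 - b} (\<lambda>\<sigma>. norm (riemann_xi (Complex \<sigma> t)))"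
    unfolding norm_xi_eq[OF t0]
    by (rule strict_antimono_on_mult[OF X]) (auto simp: monotone_on_def)
  show ?thesis using f Z E xi by (auto simp: euler_eta_def norm_mult mult.commute)
qed

text \<open>Zeros of \<open>Xi\<close> are not real, hence correspond neither to the pole nor to
  trivial zeros. Conversely, a zero of zeta that comes from \<open>rGamma (1 + s / 2)\<close> has s
  = -2 (n + 1) and is trivial.\<close>

lemma riemann_hypothesis_iff: "riemann_hypothesis \<longleftrightarrow> (\<forall>z. Xi z = 0 \<longrightarrow> Re z = 0)"
proof
  assume RH: "riemann_hypothesis"
  show "\<forall>z. Xi z = 0 \<longrightarrow> Re z = 0"
  proof (intro allI impI)
    fix z assume z: "Xi z = 0"
    define s where "s = z + 1/2"
    have im: "Im s \<noteq> 0" using Xi_zero_Im[OF z Xi_zero_Re[OF z]] by (auto simp: s_def)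
    then have "s \<noteq> 1" by auto
    moreover have "riemann_zeta s = 0" using z \<open>s \<noteq> 1\<close> by (simp add: riemann_zeta_eq s_def)
    moreover have "s \<noteq> - 2 * of_nat n" for n
    proof
      assume "s = - 2 * of_nat n"
      then have "Im s = 0" by simp
      with im show False by simp
    qed
    ultimately have "Re s = 1/2" using RH by (auto simp: riemann_hypothesis_def nontrivial_zeta_zeros_def)
    then show "Re z = 0" by (simp add: s_def)
  qed
next
  assume X: "\<forall>z. Xi z = 0 \<longrightarrow> Re z = 0"
  show riemann_hypothesis
    unfolding riemann_hypothesis_def
  proof
    fix s assume s: "s \<in> nontrivial_zeta_zeros"
    then have s1: "s \<noteq> 1" and z: "riemann_zeta s = 0" and nt: "\<And>n::nat. n \<ge> 1 \<Longrightarrow> s \<noteq> - 2 * of_nat n"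
      by (auto simp: nontrivial_zeta_zeros_def)
    have "rGamma (1 + s / 2) \<noteq> 0"
    proof
      assume "rGamma (1 + s / 2) = 0"
      then obtain n where n: "1 + s / 2 = - of_nat n"
        by (auto simp: rGamma_eq_zero_iff elim!: nonpos_Ints_cases')
      have "s = 2 * (1 + s / 2) - 2" by simp
      then have "s = - 2 * of_nat (Suc n)" unfolding n by simp
      with nt[of "Suc n"] show False by simp
    qed
    then have "Xi (s - 1/2) = 0" using z s1 by (auto simp: riemann_zeta_eq)
    with X have "Re (s - 1/2) = 0" by blast
    then show "Re s = 1/2" by simp
  qed
qed

theorem theorem1p4:
  fixes f :: "complex \<Rightarrow> complex"
  assumes "f \<in> {euler_eta, riemann_zeta, riemann_xi}"
  shows "(\<forall>t::real. \<bar>t\<bar> \<ge> 8 \<longrightarrow>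
            strict_antimono_on {..0} (\<lambda>\<sigma>::real. cmod (f (Complex \<sigma> t)))) \<and>
         ((\<forall>t::real. \<bar>t\<bar> \<ge> 8 \<longrightarrow>
            strict_antimono_on {..1/2} (\<lambda>\<sigma>::real. cmod (f (Complex \<sigma> t))))
          \<longleftrightarrow> riemann_hypothesis)"
proof (intro conjI iffI allI impI)
  fix t :: real assume "\<bar>t\<bar> \<ge> 8"
  from strict_antimono_norm[OF assms Xi_zero_Re _ this]
  show "strict_antimono_on {..0} (\<lambda>\<sigma>. cmod (f (Complex \<sigma> t)))" by simp
next
  fix t :: real assume RH: riemann_hypothesis and "\<bar>t\<bar> \<ge> 8"
  have "\<bar>Re z\<bar> \<le> 0" if "Xi z = 0" for z using RH that by (simp add: riemann_hypothesis_iff)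
  from strict_antimono_norm[OF assms this _ \<open>\<bar>t\<bar> \<ge> 8\<close>]
  show "strict_antimono_on {..1/2} (\<lambda>\<sigma>. cmod (f (Complex \<sigma> t)))" by simp
next
  assume mono: "\<forall>t. \<bar>t\<bar> \<ge> 8 \<longrightarrow> strict_antimono_on {..1/2} (\<lambda>\<sigma>. cmod (f (Complex \<sigma> t)))"
  have "Re z = 0" if z: "Xi z = 0" for z
  proof (rule ccontr)
    assume re: "Re z \<noteq> 0"
    \<comment> \<open>By evenness the zero can be taken to the left of the critical line, inside the
      half-line of the hypothesis.\<close>
    define w where "w = (if Re z < 0 then z else - z)"
    have w: "Xi w = 0" "Re w < 0" using re z by (auto simp: w_def Xi_minus)
    define \<sigma> t where "\<sigma> = Re w + 1/2" and "t = Im w"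
    have t: "\<bar>t\<bar> \<ge> 8" using Xi_low_zero_on_line[OF w(1)] w(2) unfolding t_def by (metis less_irrefl not_le)
    then have t0: "t \<noteq> 0" by auto
    have "Complex \<sigma> t - 1/2 = w" by (simp add: \<sigma>_def t_def complex_eq_iff)
    then have "riemann_zeta (Complex \<sigma> t) = 0" "riemann_xi (Complex \<sigma> t) = 0"
      using norm_zeta_eq[OF t0, of \<sigma>] norm_xi_eq[OF t0, of \<sigma>] w(1) by auto
    then have "f (Complex \<sigma> t) = 0" using assms by (auto simp: euler_eta_def)
    moreover have "strict_antimono_on {..1/2} (\<lambda>\<sigma>. cmod (f (Complex \<sigma> t)))" using mono t by blast
    \<comment> \<open>A modulus that is 0 at \<sigma> < 1/2 would have to be negative at
      1/2.\<close>
    from monotone_onD[OF this, of \<sigma> "1/2"] w(2)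
    have "cmod (f (Complex (1/2) t)) < cmod (f (Complex \<sigma> t))" by (simp add: \<sigma>_def)
    ultimately show False by simp
  qed
  then show riemann_hypothesis by (simp add: riemann_hypothesis_iff)
qed

end
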